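(* Let $\frac12<\alpha<1$ and $q\in(0,1)$ with $\alpha q<1$, and let $u_0\in X_q$. Assume: (i) $B_1(t),\ldots,B_r(t)$, $t\in J$, are linear closed operators from $X_q$ into $Y$, defined on dense sets $S_1,\ldots,S_r\supset D(A)$, respectively. (ii) $f:J\times X_q^r\to Y$ is such that for each $W\in X_q^r$, in particular for $W(t)=(B_1(t)u,\ldots,B_r(t)u)$ with $u\in\bigcap_{i=1}^r S_i$, the function $t\mapsto f(t,W(t))$ is measurable. (iii) For every $\rho>0$ there exist a constant $L_f(\rho)>0$ and functions $m_1,\ldots,m_r\in L^1(J,\mathbb{R}^+)$ such that for all $u,u^*\in X_q$ with $\|u\|_q,\|u^*\|_q\le\rho$, $$\|f(t,W(t))-f(t,W^*(t))\|\le L_f(\rho)\,[m_1(t)+\cdots+m_r(t)]\,\|u-u^*\|_q\quad\text{for almost all }t\in J,$$ where $W(t)=(B_1(t)u,\ldots,B_r(t)u)$ and $W^*(t)=(B_1(t)u^*,\ldots,B_r(t)u^* )$. (iv) There is a constant $a_f>0$ such that $\|f(t,W)\|\le a_f(1+r\|u\|_q)$ for all $W=(B_1(t)u,\ldots,B_r(t)u)\in X_q^r$ and all $t\in J$. (v) $h:C(J,X_q)\to X_q$ and there exist constants $k_1,k_2>0$ such that $\|h(u)-h(v)\|_q\le k_1\|u-v\|_\infty$ and $\|h(u)\|_q\le k_2$ for all $u,v\in C(J,X_q)$. Then the system $${}^CD_t^{\alpha}[Lu(t)]=Eu(t)+f(t,W(t)),\qquad {}^LD_t^{1-\alpha}[Mu(0)]=u_0+h(u(t)),$$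 with $W(t)=(B_1(t)u(t),\ldots,B_r(t)u(t))$, has a mild solution on $J$.
   Context: $J=[0,a]$, $a>0$. $X,Y$ are Banach spaces, $Y$ densely and continuously embedded in $X$. ${}^CD^\alpha_t$ and ${}^LD^{1-\alpha}_t$ are the Caputo and Riemann–Liouville fractional derivatives (integrals of vector-valued functions are Bochner integrals). Standing assumptions on operators: $E:D(E)\subset X\to Y$ is linear and closed; $L:D(L)\subset X\to Y$ and $M:D(M)\subset X\to X$ are linear; $D(M)\subset D(L)\subset D(E)$; $L$ and $M$ are bijective; $L^{-1}:Y\to D(L)\subset X$ and $M^{-1}:X\to D(M)\subset X$ are linear, bounded and compact. The operator $A=EL^{-1}:D(A)\subset Y\to Y$ is the infinitesimal generator of a compact analytic semigroup $\{Q(t)\}_{t\ge0}$ of uniformly bounded linear operators, $\|Q(t)\|\le M_0$ for all $t\ge0$, and $0\in\rho(A)$. For $0<q\le1$, $A^q$ is the fractional power (closed, domain $D(A^q)$, inverse $A^{-q}$), $X_q$ is the Banach space $D(A^q)$ with norm $\|u\|_q=\|A^qu\|$, and $\Omega_q=C(J,X_q)$ with norm $\|u\|_\infty=\sup_{t\in J}\|u(t)\|_q$. Put $$S_\alpha(t)=\int_0^\infty L^{-1}\zeta_\alpha(\theta)Q(t^\alpha\theta)\,d\theta,\qquad T_\alpha(t)=\alpha\int_0^\infty L^{-1}\theta\zeta_\alpha(\theta)Q(t^\alpha\theta)\,d\theta,$$ where $\zeta_\alpha(\theta)=\frac1\alpha\theta^{-1-1/\alpha}\varpi_\alpha(\theta^{-1/\alpha})$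 and $\varpi_\alpha(\theta)=\frac1\pi\sum_{n=1}^\infty(-1)^{n-1}\theta^{-\alpha n-1}\frac{\Gamma(n\alpha+1)}{n!}\sin(n\pi\alpha)$, $\theta\in(0,\infty)$; $\zeta_\alpha$ is a probability density on $(0,\infty)$. $v_0\in X$ is given ($v_0=Mu(0)|_{t=0}$). A mild solution of the system is a function $u\in\Omega_q$ satisfying, for $t\in J$, $$u(t)=S_\alpha(t)LM^{-1}\Big[v_0+\frac1{\Gamma(1-\alpha)}\int_0^t\frac{u_0+h(u(s))}{(t-s)^\alpha}\,ds\Big]+\int_0^t(t-s)^{\alpha-1}T_\alpha(t-s)f(s,W(s))\,ds,$$ where $W(s)=(B_1(s)u(s),\ldots,B_r(s)u(s))$, and $h(u(s))$ stands for the element $h(u)\in X_q$ obtained by applying $h$ to the function $u\in C(J,X_q)$.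
   Formalization: In (iii) the exceptional null set of t is required not to depend on u, u* (for almost all t the inequality holds for all u, u* with norm at most ρ); with a null set depending on the pair the claim is false. *)

theory Defs
  imports "HOL-Analysis.Analysis"
begin

text \<open>
  Analytic semigroups and resolvent sets are notions about complex Banach spaces, which the
  library does not provide: its class \<open>banach\<close> is over the reals.
\<close>

class complex_banach = banach +
  fixes scaleC :: "complex \<Rightarrow> 'a \<Rightarrow> 'a" (infixr "*\<^sub>C" 75)
  assumes scaleC_add_right: "c *\<^sub>C (x + y) = c *\<^sub>C x + c *\<^sub>C y"
    and scaleC_add_left: "(c + d) *\<^sub>C x = c *\<^sub>C x + d *\<^sub>C x"
    and scaleC_scaleC: "c *\<^sub>C (d *\<^sub>C x) = (c * d) *\<^sub>C x"
    and scaleR_scaleC: "r *\<^sub>R x = complex_of_real r *\<^sub>C x"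
    and norm_scaleC: "norm (c *\<^sub>C x) = cmod c * norm x"

instantiation complex :: complex_banach
begin

definition scaleC_complex :: "complex \<Rightarrow> complex \<Rightarrow> complex"
  where "scaleC_complex c x = c * x"

instance
  by standard
    (simp_all add: scaleC_complex_def distrib_left distrib_right mult.assoc
      scaleR_conv_of_real norm_mult)

end


section \<open>Linear operators\<close>

text \<open>A possibly unbounded operator is given by its domain and by a function whose values
  outside the domain are irrelevant.\<close>

definition clinear_on :: "'a::complex_banach set \<Rightarrow> ('a \<Rightarrow> 'b::complex_banach) \<Rightarrow> bool"
  where "clinear_on D F \<longleftrightarrow>
    0 \<in> D \<and>
    (\<forall>x\<in>D. \<forall>y\<in>D. x + y \<in> D \<and> F (x + y) = F x + F y) \<and>
    (\<forall>c. \<forall>x\<in>D. c *\<^sub>C x \<in> D \<and> F (c *\<^sub>C x) = c *\<^sub>C F x)"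

definition closed_operator :: "'a::complex_banach set \<Rightarrow> ('a \<Rightarrow> 'b::complex_banach) \<Rightarrow> bool"
  where "closed_operator D F \<longleftrightarrow> closed ((\<lambda>x. (x, F x)) ` D)"

definition bounded_clinear :: "('a::complex_banach \<Rightarrow> 'b::complex_banach) \<Rightarrow> bool"
  where "bounded_clinear F \<longleftrightarrow> bounded_linear F \<and> (\<forall>c x. F (c *\<^sub>C x) = c *\<^sub>C F x)"

definition compact_operator :: "('a::complex_banach \<Rightarrow> 'b::complex_banach) \<Rightarrow> bool"
  where "compact_operator F \<longleftrightarrow> bounded_clinear F \<and> compact (closure (F ` cball 0 1))"

definition resolvent_op :: "'a::complex_banach set \<Rightarrow> ('a \<Rightarrow> 'a) \<Rightarrow> complex \<Rightarrow> 'a \<Rightarrow> 'a"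
  where "resolvent_op D A z = inv_into D (\<lambda>x. z *\<^sub>C x - A x)"

definition resolvent_set :: "'a::complex_banach set \<Rightarrow> ('a \<Rightarrow> 'a) \<Rightarrow> complex set"
  where "resolvent_set D A =
    {z. bij_betw (\<lambda>x. z *\<^sub>C x - A x) D UNIV \<and> bounded_clinear (resolvent_op D A z)}"


section \<open>Semigroups\<close>

definition C0_semigroup :: "(real \<Rightarrow> 'a::complex_banach \<Rightarrow> 'a) \<Rightarrow> bool"
  where "C0_semigroup Q \<longleftrightarrow>
    (\<forall>t\<ge>0. bounded_clinear (Q t)) \<and>
    (\<forall>x. Q 0 x = x) \<and>
    (\<forall>s\<ge>0. \<forall>t\<ge>0. \<forall>x. Q (s + t) x = Q s (Q t x)) \<and>
    (\<forall>x. ((\<lambda>t. Q t x) \<longlongrightarrow> x) (at_right 0))"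

definition infinitesimal_generator ::
    "'a::complex_banach set \<Rightarrow> ('a \<Rightarrow> 'a) \<Rightarrow> (real \<Rightarrow> 'a \<Rightarrow> 'a) \<Rightarrow> bool"
  where "infinitesimal_generator D A Q \<longleftrightarrow>
    D = {x. \<exists>y. ((\<lambda>t. (1 / t) *\<^sub>R (Q t x - x)) \<longlongrightarrow> y) (at_right 0)} \<and>
    (\<forall>x\<in>D. ((\<lambda>t. (1 / t) *\<^sub>R (Q t x - x)) \<longlongrightarrow> A x) (at_right 0))"

definition compact_semigroup :: "(real \<Rightarrow> 'a::complex_banach \<Rightarrow> 'a) \<Rightarrow> bool"
  where "compact_semigroup Q \<longleftrightarrow> (\<forall>t>0. compact_operator (Q t))"

definition sector :: "real \<Rightarrow> complex set"
  where "sector \<delta> = {z. z \<noteq> 0 \<and> \<bar>Arg z\<bar> < \<delta>}"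

text \<open>The derivative in the fourth conjunct is complex differentiability of the
  vector-valued map \<open>w \<mapsto> T w x\<close>.\<close>

definition analytic_semigroup :: "(real \<Rightarrow> 'a::complex_banach \<Rightarrow> 'a) \<Rightarrow> bool"
  where "analytic_semigroup Q \<longleftrightarrow> C0_semigroup Q \<and>
    (\<exists>\<delta> T. 0 < \<delta> \<and> \<delta> \<le> pi / 2 \<and>
      (\<forall>t\<ge>0. \<forall>x. T (complex_of_real t) x = Q t x) \<and>
      (\<forall>z\<in>sector \<delta>. bounded_clinear (T z)) \<and>
      (\<forall>z\<in>sector \<delta>. \<forall>w\<in>sector \<delta>. \<forall>x. T (z + w) x = T z (T w x)) \<and>
      (\<forall>z\<in>sector \<delta>. \<forall>x. \<exists>d. ((\<lambda>w. T w x) has_derivative (\<lambda>k. k *\<^sub>C d)) (at z)) \<and>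
      (\<forall>x. ((\<lambda>z. T z x) \<longlongrightarrow> x) (at 0 within sector \<delta>)))"


section \<open>Fractional powers and the spaces built on them\<close>

text \<open>
  The Bochner integral of the library takes values in second countable (that is, separable)
  spaces.  For spaces \<open>Y\<close>, densely and continuously embedded in \<open>X\<close>, with a compact \<open>C\<^sub>0\<close>-semigroup
  \<open>Q\<close> on \<open>Y\<close> this is no restriction: \<open>Y\<close> is the closure of the union of the separable ranges of
  \<open>Q (1 / n)\<close>, and \<open>X\<close> is the closure of the image of \<open>Y\<close>.
\<close>

text \<open>
  If \<open>A\<close> generates a bounded semigroup and \<open>0\<close> lies in its resolvent set, the operator that has
  fractional powers is \<open>-A\<close>; replacing \<open>(-A)\<^sup>q\<close> by a branch \<open>exp (\<plusminus>i\<pi>q) (-A)\<^sup>q\<close> of \<open>A\<^sup>q\<close> changes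
  neither the domain nor the norm of the values.  For \<open>0 < q < 1\<close> the inverse power is defined by
  Balakrishnan's formula
    \<open>(-A)\<^sup>-\<^sup>q = (sin \<pi>q / \<pi>) \<integral>\<^sub>0\<^sup>\<infinity> t\<^sup>-\<^sup>q (t - A)\<^sup>-\<^sup>1 dt\<close>,
  whose integral converges absolutely under these hypotheses, and \<open>(-A)\<^sup>q\<close> is its inverse, with
  domain the range of \<open>(-A)\<^sup>-\<^sup>q\<close>.  (The formula \<open>\<integral>\<^sub>0\<^sup>\<infinity> t\<^sup>q\<^sup>-\<^sup>1 Q t dt / \<Gamma>(q)\<close> would in addition need decay
  of the semigroup.)
\<close>

definition frac_power_inv ::
    "'a::{complex_banach, second_countable_topology} set \<Rightarrow> ('a \<Rightarrow> 'a) \<Rightarrow> real \<Rightarrow> 'a \<Rightarrow> 'a"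
  where "frac_power_inv D A q x =
    (sin (pi * q) / pi) *\<^sub>R
      (LINT t:{0<..}|lebesgue. t powr (- q) *\<^sub>R resolvent_op D A (complex_of_real t) x)"

definition frac_power_dom ::
    "'a::{complex_banach, second_countable_topology} set \<Rightarrow> ('a \<Rightarrow> 'a) \<Rightarrow> real \<Rightarrow> 'a set"
  where "frac_power_dom D A q = range (frac_power_inv D A q)"

definition frac_power ::
    "'a::{complex_banach, second_countable_topology} set \<Rightarrow> ('a \<Rightarrow> 'a) \<Rightarrow> real \<Rightarrow> 'a \<Rightarrow> 'a"
  where "frac_power D A q = inv (frac_power_inv D A q)"

definition frac_norm ::
    "'a::{complex_banach, second_countable_topology} set \<Rightarrow> ('a \<Rightarrow> 'a) \<Rightarrow> real \<Rightarrow> 'a \<Rightarrow> real"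
  where "frac_norm D A q x = norm (frac_power D A q x)"

text \<open>Below, \<open>V\<close> is a linear subspace that carries its own norm \<open>nV\<close>; it is used with
  \<open>V = frac_power_dom D A q\<close> and \<open>nV = frac_norm D A q\<close>.\<close>

definition cont_fun_space :: "real \<Rightarrow> 'a::complex_banach set \<Rightarrow> ('a \<Rightarrow> real) \<Rightarrow> (real \<Rightarrow> 'a) set"
  where "cont_fun_space a V nV =
    {u. (\<forall>t\<in>{0..a}. u t \<in> V \<and> ((\<lambda>s. nV (u s - u t)) \<longlongrightarrow> 0) (at t within {0..a}))}"

definition sup_norm :: "real \<Rightarrow> ('a::complex_banach \<Rightarrow> real) \<Rightarrow> (real \<Rightarrow> 'a) \<Rightarrow> real"
  where "sup_norm a nV u = (SUP t\<in>{0..a}. nV (u t))"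

definition dense_in :: "'a::complex_banach set \<Rightarrow> 'a set \<Rightarrow> ('a \<Rightarrow> real) \<Rightarrow> bool"
  where "dense_in S V nV \<longleftrightarrow> S \<subseteq> V \<and> (\<forall>x\<in>V. \<forall>e>0. \<exists>y\<in>S. nV (y - x) < e)"

definition closed_operator_from ::
    "'a::complex_banach set \<Rightarrow> ('a \<Rightarrow> real) \<Rightarrow> 'a set \<Rightarrow> ('a \<Rightarrow> 'b::complex_banach) \<Rightarrow> bool"
  where "closed_operator_from V nV S F \<longleftrightarrow>
    (\<forall>x l y. (\<forall>n. x n \<in> S) \<and> l \<in> V \<and>
       (\<lambda>n. nV (x n - l)) \<longlonglongrightarrow> 0 \<and> (\<lambda>n. F (x n)) \<longlonglongrightarrow> y
       \<longrightarrow> l \<in> S \<and> F l = y)"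


section \<open>Solution operators and mild solutions\<close>

definition varpi_density :: "real \<Rightarrow> real \<Rightarrow> real"
  where "varpi_density \<alpha> \<theta> = (1 / pi) *
    (\<Sum>k. let n = Suc k in
       (- 1) ^ (n - 1) * \<theta> powr (- \<alpha> * real n - 1) *
       (Gamma (real n * \<alpha> + 1) / fact n) * sin (real n * pi * \<alpha>))"

definition zeta_density :: "real \<Rightarrow> real \<Rightarrow> real"
  where "zeta_density \<alpha> \<theta> =
    (1 / \<alpha>) * \<theta> powr (- 1 - 1 / \<alpha>) * varpi_density \<alpha> (\<theta> powr (- 1 / \<alpha>))"

definition S_op ::
    "real \<Rightarrow> ('y::{complex_banach, second_countable_topology} \<Rightarrow> 'x::{complex_banach, second_countable_topology})
      \<Rightarrow> (real \<Rightarrow> 'y \<Rightarrow> 'y) \<Rightarrow> real \<Rightarrow> 'y \<Rightarrow> 'x"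
  where "S_op \<alpha> Linv Q t y =
    (LINT \<theta>:{0<..}|lebesgue. Linv (zeta_density \<alpha> \<theta> *\<^sub>R Q (t powr \<alpha> * \<theta>) y))"

definition T_op ::
    "real \<Rightarrow> ('y::{complex_banach, second_countable_topology} \<Rightarrow> 'x::{complex_banach, second_countable_topology})
      \<Rightarrow> (real \<Rightarrow> 'y \<Rightarrow> 'y) \<Rightarrow> real \<Rightarrow> 'y \<Rightarrow> 'x"
  where "T_op \<alpha> Linv Q t y =
    \<alpha> *\<^sub>R (LINT \<theta>:{0<..}|lebesgue. Linv ((\<theta> * zeta_density \<alpha> \<theta>) *\<^sub>R Q (t powr \<alpha> * \<theta>) y))"

text \<open>
  The equation holds in \<open>X\<close>, the embedding \<open>\<iota>\<close> of \<open>Y\<close> into \<open>X\<close> being written out.  Since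
  library operations are total, a mild solution is explicitly required to stay in the domains
  \<open>S i\<close> of the operators \<open>B i t\<close>, to make their values admissible arguments of \<open>f\<close>, and to make
  the convolution integrand Bochner integrable; the integrand of the other integral always is.
\<close>

definition mild_solution ::
    "real \<Rightarrow> real
      \<Rightarrow> ('y::{complex_banach, second_countable_topology} \<Rightarrow> 'x::{complex_banach, second_countable_topology})
      \<Rightarrow> 'x set \<Rightarrow> ('x \<Rightarrow> 'y) \<Rightarrow> 'x set \<Rightarrow> ('x \<Rightarrow> 'x) \<Rightarrow> (real \<Rightarrow> 'y \<Rightarrow> 'y)
      \<Rightarrow> 'y set \<Rightarrow> ('y \<Rightarrow> real)
      \<Rightarrow> 'y \<Rightarrow> 'x \<Rightarrow> ((real \<Rightarrow> 'y) \<Rightarrow> 'y)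
      \<Rightarrow> ('r::finite \<Rightarrow> 'y set) \<Rightarrow> ('r \<Rightarrow> real \<Rightarrow> 'y \<Rightarrow> 'y) \<Rightarrow> (real \<Rightarrow> 'y ^ 'r \<Rightarrow> 'y)
      \<Rightarrow> (real \<Rightarrow> 'y) \<Rightarrow> bool"
  where "mild_solution a \<alpha> \<iota> DL L DM M Q Xq nq u0 v0 h S B f u \<longleftrightarrow>
    u \<in> cont_fun_space a Xq nq \<and>
    (\<forall>t\<in>{0..a}. \<forall>i. u t \<in> S i \<and> B i t (u t) \<in> Xq) \<and>
    (\<forall>t\<in>{0..a}.
      set_integrable lebesgue {0..t}
        (\<lambda>s. (t - s) powr (\<alpha> - 1) *\<^sub>R
             T_op \<alpha> (inv_into DL L) Q (t - s) (f s (\<chi> i. B i s (u s)))) \<and>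
      \<iota> (u t) =
        S_op \<alpha> (inv_into DL L) Q t
          (L (inv_into DM M
            (v0 + (1 / Gamma (1 - \<alpha>)) *\<^sub>R
               (LINT s:{0..t}|lebesgue. (1 / (t - s) powr \<alpha>) *\<^sub>R \<iota> (u0 + h u)))))
        + (LINT s:{0..t}|lebesgue.
             (t - s) powr (\<alpha> - 1) *\<^sub>R
             T_op \<alpha> (inv_into DL L) Q (t - s) (f s (\<chi> i. B i s (u s)))))"

end

theory Submission
  imports Defs
begin

text \<open>
  The inclusion \<open>D(L) \<subseteq> D(E)\<close> makes \<open>A = E L\<^sup>-\<^sup>1\<close> an operator defined on all of \<open>Y\<close>, and this confines
  the system to finite dimension.  For every \<open>x\<close> the difference quotients \<open>(Q t x - x) / t\<close> converge as
  \<open>t\<close> tends to \<open>0\<close>, so Baire's theorem bounds them uniformly on the unit ball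
  (\<open>difference_quotients_bounded\<close>).  Hence \<open>Q t\<close> tends to the identity in norm; since the \<open>Q t\<close> are
  compact, so is the unit ball of \<open>Y\<close> (\<open>compact_cball_if_compact_approximations\<close>), and \<open>Y\<close> has a finite
  spanning set (\<open>finite_span_if_compact_cball\<close>).  The dense image of \<open>Y\<close> in \<open>X\<close> is then closed, so the
  embedding is an isomorphism, and \<open>L M\<^sup>-\<^sup>1\<close>, being linear on a finite-dimensional space, is bounded.
  Moreover \<open>D(A) \<subseteq> S\<^sub>i \<subseteq> X\<^sub>q\<close> gives \<open>X\<^sub>q = Y\<close>: the inverse fractional power is onto, therefore linear and
  bijective (\<open>linear_if_surj_integral\<close>), and the norm of \<open>X\<^sub>q\<close> is equivalent to that of \<open>Y\<close>.  So the
  unknown ranges over \<open>C(J, Y)\<close>.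

  What remains is an equation
    \<open>u t = c t (h u) + \<integral>\<^sub>0\<^sup>t (t - s)\<^sup>\<alpha>\<^sup>-\<^sup>1 k (t - s) (g s (u s)) ds\<close>
  in \<open>Y\<close>, where \<open>g s y = f s (B\<^sub>1 s y, \<dots>, B\<^sub>r s y)\<close> is a Caratheodory function of linear growth and where \<open>c\<close>
  and \<open>k\<close>, which come from \<open>S\<^sub>\<alpha>\<close> and \<open>T\<^sub>\<alpha>\<close>, are jointly continuous by dominated convergence
  (\<open>subordinated_family\<close>).  The domination needs the absolute integrability of \<open>\<zeta>\<^sub>\<alpha>(\<theta>)\<close> and
  \<open>\<theta> \<zeta>\<^sub>\<alpha>(\<theta>)\<close> (\<open>zeta_density_integrable\<close>).  Near \<open>0\<close> it is read off the power series of \<open>\<zeta>\<^sub>\<alpha>\<close>.  Near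
  infinity the Gamma factors of the series are written as Laplace integrals along a ray that is turned
  into the right half plane until the integrand no longer grows, which exhibits decay faster than
  \<open>\<theta>\<^sup>-\<^sup>2\<close>.

  The functions \<open>m\<^sub>i\<close> in the Lipschitz condition are merely integrable, so their products with
  \<open>(t - s)\<^sup>\<alpha>\<^sup>-\<^sup>1\<close> may fail to be integrable and a contraction argument is not available; moreover \<open>h\<close> sees the
  whole function \<open>u\<close>.  The equation is therefore solved by Schauder's theorem
  (\<open>singular_volterra_exists\<close>): a weighted supremum norm turns linear growth into an invariant ball, the
  singular kernel makes the image of that ball equicontinuous, and compactness of balls of \<open>Y\<close> makes
  equicontinuous sets relatively compact.  Schauder's theorem rests on Brouwer's theorem for cubes whose
  dimension is a natural number rather than a type, which follows from Kuhn's combinatorial lemma.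
\<close>

section \<open>Fixed points of continuous maps on compact convex sets\<close>

text \<open>
  The cube \<open>[0, 1]\<^sup>n\<close> with \<open>n\<close> a number: a point is an infinite sequence that vanishes from position \<open>n\<close>
  on, so that all cubes live in one type and carry the product topology.
\<close>

definition unit_cube :: "nat \<Rightarrow> (nat \<Rightarrow> real) set"
  where "unit_cube n = (\<Pi>\<^sub>E i\<in>UNIV. if i < n then {0..1} else {0})"

lemma unit_cube_iff: "x \<in> unit_cube n \<longleftrightarrow> (\<forall>i<n. 0 \<le> x i \<and> x i \<le> 1) \<and> (\<forall>i\<ge>n. x i = 0)"
proof -
  have "x \<in> unit_cube n \<longleftrightarrow> (\<forall>i. (i < n \<longrightarrow> 0 \<le> x i \<and> x i \<le> 1) \<and> (\<not> i < n \<longrightarrow> x i = 0))"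
    unfolding unit_cube_def PiE_iff by auto
  then show ?thesis by (auto simp: not_less)
qed

lemma seq_compact_unit_cube:
  assumes "\<And>k::nat. x k \<in> unit_cube n"
  obtains l r where "l \<in> unit_cube n" "strict_mono (r :: nat \<Rightarrow> nat)" "(x \<circ> r) \<longlonglongrightarrow> l"
proof -
  have "compact (unit_cube n)"
    unfolding unit_cube_def compactin_euclidean_iff[symmetric] euclidean_product_topology[symmetric]
    by (subst compactin_PiE) auto
  then have "seq_compact (unit_cube n)"
    by (rule compact_imp_seq_compact)
  with assms that show ?thesis
    unfolding seq_compact_def by metis
qed

lemma tendsto_coordinatewise_iff:
  fixes X :: "'a \<Rightarrow> 'i \<Rightarrow> 'b::topological_space"
  shows "(X \<longlongrightarrow> l) F \<longleftrightarrow> (\<forall>i. ((\<lambda>p. X p i) \<longlongrightarrow> l i) F)"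
  using limitin_componentwise[of "\<lambda>_. euclidean" UNIV X l F]
  by (simp add: euclidean_product_topology)

text \<open>
  Label a point \<open>x\<close> in coordinate \<open>i\<close> by the direction in which \<open>f\<close> moves it.  On each grid Kuhn's lemma
  finds a cell that carries both labels in every coordinate; along a subsequence these cells shrink to a
  point, and continuity forces that point not to move in any coordinate.
\<close>

theorem brouwer_unit_cube:
  assumes cont: "continuous_on (unit_cube n) f" and maps: "f ` unit_cube n \<subseteq> unit_cube n"
  shows "\<exists>x\<in>unit_cube n. f x = x"
proof -
  have "\<exists>l. (\<forall>x i. l x i \<le> (1::nat)) \<and>
             (\<forall>x i. x \<in> unit_cube n \<and> i < n \<and> x i = 0 \<longrightarrow> l x i = 0) \<and>
             (\<forall>x i. x \<in> unit_cube n \<and> i < n \<and> x i = 1 \<longrightarrow> l x i = 1) \<and>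
             (\<forall>x i. x \<in> unit_cube n \<and> i < n \<and> l x i = 0 \<longrightarrow> x i \<le> f x i) \<and>
             (\<forall>x i. x \<in> unit_cube n \<and> i < n \<and> l x i = 1 \<longrightarrow> f x i \<le> x i)"
    by (rule kuhn_labelling_lemma') (use maps in \<open>auto simp: unit_cube_iff image_subset_iff\<close>)
  then obtain label :: "(nat \<Rightarrow> real) \<Rightarrow> nat \<Rightarrow> nat" where le1: "\<And>x i. label x i \<le> 1"
    and l0: "\<And>x i. x \<in> unit_cube n \<Longrightarrow> i < n \<Longrightarrow> x i = 0 \<Longrightarrow> label x i = 0"
    and l1: "\<And>x i. x \<in> unit_cube n \<Longrightarrow> i < n \<Longrightarrow> x i = 1 \<Longrightarrow> label x i = 1"
    and up: "\<And>x i. x \<in> unit_cube n \<Longrightarrow> i < n \<Longrightarrow> label x i = 0 \<Longrightarrow> x i \<le> f x i"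
    and down: "\<And>x i. x \<in> unit_cube n \<Longrightarrow> i < n \<Longrightarrow> label x i = 1 \<Longrightarrow> f x i \<le> x i"
    by blast
  define pt where "pt p k i = (if i < n then real (k i) / real (Suc p) else 0)" for p and k :: "nat \<Rightarrow> nat" and i
  have pt_cube: "pt p k \<in> unit_cube n" if "\<And>i. i < n \<Longrightarrow> k i \<le> Suc p" for p k
    using that unfolding unit_cube_iff pt_def by (auto simp del: of_nat_Suc)
  have "\<exists>q. (\<forall>i<n. q i < Suc p) \<and>
         (\<forall>i<n. \<exists>r s. (\<forall>j<n. q j \<le> r j \<and> r j \<le> q j + 1) \<and> (\<forall>j<n. q j \<le> s j \<and> s j \<le> q j + 1) \<and>
            label (pt p r) i \<noteq> label (pt p s) i)" for p
  proof (rule kuhn_lemma[of "Suc p" n "\<lambda>k. label (pt p k)"])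
    show "\<forall>x. (\<forall>i<n. x i \<le> Suc p) \<longrightarrow> (\<forall>i<n. label (pt p x) i = 0 \<or> label (pt p x) i = 1)"
      using le1 by (metis le_numeral_extra(3) less_one nle_le order_le_less)
    show "\<forall>x. (\<forall>i<n. x i \<le> Suc p) \<longrightarrow> (\<forall>i<n. x i = 0 \<longrightarrow> label (pt p x) i = 0)"
      by (intro allI impI l0 pt_cube) (auto simp: pt_def)
    show "\<forall>x. (\<forall>i<n. x i \<le> Suc p) \<longrightarrow> (\<forall>i<n. x i = Suc p \<longrightarrow> label (pt p x) i = 1)"
      by (intro allI impI l1 pt_cube) (auto simp: pt_def)
  qed blast+
  then have "\<forall>p. \<exists>q. (\<forall>i<n. q i < Suc p) \<and>
         (\<forall>i<n. \<exists>r s. (\<forall>j<n. q j \<le> r j \<and> r j \<le> q j + 1) \<and> (\<forall>j<n. q j \<le> s j \<and> s j \<le> q j + 1) \<and>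
            label (pt p r) i \<noteq> label (pt p s) i)" ..
  from choice[OF this] obtain q where q: "\<And>p i. i < n \<Longrightarrow> q p i < Suc p"
    and ex: "\<And>p i. i < n \<Longrightarrow> \<exists>r s. (\<forall>j<n. q p j \<le> r j \<and> r j \<le> q p j + 1) \<and>
         (\<forall>j<n. q p j \<le> s j \<and> s j \<le> q p j + 1) \<and> label (pt p r) i \<noteq> label (pt p s) i"
    by blast
  \<comment> \<open>at \<open>r\<close> the map does not decrease coordinate \<open>i\<close>, at the neighbouring point \<open>s\<close> it does not increase it\<close>
  have "\<exists>r s. (\<forall>j<n. q p j \<le> r j \<and> r j \<le> q p j + 1) \<and> (\<forall>j<n. q p j \<le> s j \<and> s j \<le> q p j + 1) \<and>
         label (pt p r) i = 0 \<and> label (pt p s) i = 1" if i: "i < n" for p i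
  proof -
    obtain r s where rs: "\<forall>j<n. q p j \<le> r j \<and> r j \<le> q p j + 1" "\<forall>j<n. q p j \<le> s j \<and> s j \<le> q p j + 1"
      "label (pt p r) i \<noteq> label (pt p s) i"
      using ex[OF i, of p] by blast
    have "label (pt p r) i = 0 \<and> label (pt p s) i = 1 \<or> label (pt p s) i = 0 \<and> label (pt p r) i = 1"
      using rs(3) le1[of "pt p r" i] le1[of "pt p s" i] by arith
    with rs(1,2) show ?thesis by blast
  qed
  then have "\<forall>p i. \<exists>r s. i < n \<longrightarrow> (\<forall>j<n. q p j \<le> r j \<and> r j \<le> q p j + 1) \<and>
      (\<forall>j<n. q p j \<le> s j \<and> s j \<le> q p j + 1) \<and> label (pt p r) i = 0 \<and> label (pt p s) i = 1"
    by blast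
  then obtain r s where "\<And>p i. i < n \<Longrightarrow> (\<forall>j<n. q p j \<le> r p i j \<and> r p i j \<le> q p j + 1) \<and>
      (\<forall>j<n. q p j \<le> s p i j \<and> s p i j \<le> q p j + 1) \<and> label (pt p (r p i)) i = 0 \<and> label (pt p (s p i)) i = 1"
    unfolding choice_iff by blast
  then have r: "\<And>p i j. i < n \<Longrightarrow> j < n \<Longrightarrow> q p j \<le> r p i j \<and> r p i j \<le> q p j + 1"
    and s: "\<And>p i j. i < n \<Longrightarrow> j < n \<Longrightarrow> q p j \<le> s p i j \<and> s p i j \<le> q p j + 1"
    and lr: "\<And>p i. i < n \<Longrightarrow> label (pt p (r p i)) i = 0"
    and ls: "\<And>p i. i < n \<Longrightarrow> label (pt p (s p i)) i = 1"
    by blast+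
  have qc: "pt p (q p) \<in> unit_cube n" for p
    by (rule pt_cube) (use q in \<open>auto simp: less_imp_le\<close>)
  then obtain l \<rho> where l: "l \<in> unit_cube n" "strict_mono \<rho>" "((\<lambda>p. pt p (q p)) \<circ> \<rho>) \<longlonglongrightarrow> l"
    by (rule seq_compact_unit_cube)
  have conv: "(\<lambda>p. pt (\<rho> p) (k (\<rho> p))) \<longlonglongrightarrow> l"
    if k: "\<And>p j. j < n \<Longrightarrow> q p j \<le> k p j \<and> k p j \<le> q p j + 1" for k
  proof (subst tendsto_coordinatewise_iff, rule allI)
    fix j
    have lj: "(\<lambda>p. pt (\<rho> p) (q (\<rho> p)) j) \<longlonglongrightarrow> l j"
      using l(3) unfolding tendsto_coordinatewise_iff o_def ..
    have "(\<lambda>p. inverse (real (Suc (\<rho> p)))) \<longlonglongrightarrow> 0"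
      using LIMSEQ_subseq_LIMSEQ[OF LIMSEQ_inverse_real_of_nat l(2)] by (simp add: o_def)
    moreover have "\<bar>pt (\<rho> p) (k (\<rho> p)) j - pt (\<rho> p) (q (\<rho> p)) j\<bar> \<le> inverse (real (Suc (\<rho> p)))" for p
    proof (cases "j < n")
      case True
      then have "pt (\<rho> p) (k (\<rho> p)) j - pt (\<rho> p) (q (\<rho> p)) j =
          (real (k (\<rho> p) j) - real (q (\<rho> p) j)) / real (Suc (\<rho> p))"
        by (simp only: pt_def if_True diff_divide_distrib)
      moreover have "\<bar>real (k (\<rho> p) j) - real (q (\<rho> p) j)\<bar> \<le> 1"
        using k[OF True, of "\<rho> p"] by linarith
      ultimately show ?thesis
        by (simp only: abs_divide inverse_eq_divide abs_of_nat divide_right_mono of_nat_0_le_iff)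
    qed (simp add: pt_def)
    ultimately have "(\<lambda>p. pt (\<rho> p) (k (\<rho> p)) j - pt (\<rho> p) (q (\<rho> p)) j) \<longlonglongrightarrow> 0"
      by (metis (no_types, lifting) Lim_null_comparison always_eventually real_norm_def)
    from tendsto_add[OF this lj] show "(\<lambda>p. pt (\<rho> p) (k (\<rho> p)) j) \<longlonglongrightarrow> l j"
      by simp
  qed
  have fconv: "(\<lambda>p. f (X p) i) \<longlonglongrightarrow> f l i" if "X \<longlonglongrightarrow> l" "\<And>p. X p \<in> unit_cube n" for X i
  proof -
    have "(\<lambda>p. f (X p)) \<longlonglongrightarrow> f l"
      using cont l(1) that unfolding continuous_on_sequentially by (auto simp: o_def)
    then show ?thesis unfolding tendsto_coordinatewise_iff ..
  qed
  have "f l i = l i" for i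
  proof (cases "i < n")
    case True
    have c: "pt p (r p i) \<in> unit_cube n" "pt p (s p i) \<in> unit_cube n" for p
    proof -
      have "r p i j \<le> Suc p \<and> s p i j \<le> Suc p" if j: "j < n" for j
        using r[OF True j, of p] s[OF True j, of p] q[OF j, of p] by linarith
      then show "pt p (r p i) \<in> unit_cube n" "pt p (s p i) \<in> unit_cube n"
        by (auto intro: pt_cube)
    qed
    have cr: "(\<lambda>p. pt (\<rho> p) (r (\<rho> p) i)) \<longlonglongrightarrow> l" and cs: "(\<lambda>p. pt (\<rho> p) (s (\<rho> p) i)) \<longlonglongrightarrow> l"
      using r s True by (auto intro!: conv)
    have li: "(\<lambda>p. pt (\<rho> p) (r (\<rho> p) i) i) \<longlonglongrightarrow> l i" "(\<lambda>p. pt (\<rho> p) (s (\<rho> p) i) i) \<longlonglongrightarrow> l i"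
      using cr cs unfolding tendsto_coordinatewise_iff by blast+
    have "l i \<le> f l i"
      by (rule tendsto_le[OF _ fconv[OF cr c(1)] li(1)]) (auto intro!: always_eventually up[OF c(1) True lr[OF True]])
    moreover have "f l i \<le> l i"
      by (rule tendsto_le[OF _ li(2) fconv[OF cs c(2)]]) (auto intro!: always_eventually down[OF c(2) True ls[OF True]])
    ultimately show ?thesis by simp
  next
    case False
    with l(1) maps show ?thesis by (force simp: unit_cube_iff image_subset_iff)
  qed
  then show ?thesis using l(1) by blast
qed

text \<open>
  If the smallest displacement \<open>e\<close> of \<open>T\<close> on \<open>K\<close> were positive, take an \<open>e\<close>-net of \<open>K\<close>.  The Schauder
  projection, which averages the points of the net with weights vanishing at distance \<open>e\<close>, moves no point
  of \<open>K\<close> by \<open>e\<close> or more.  Composed with \<open>T\<close> it acts on a simplex, where it has a fixed point, and that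
  point is displaced by \<open>T\<close> by less than \<open>e\<close>.
\<close>

theorem schauder_compact:
  fixes K :: "'a::real_normed_vector set"
  assumes K: "compact K" "convex K" "K \<noteq> {}" and T: "continuous_on K T" "T ` K \<subseteq> K"
  shows "\<exists>x\<in>K. T x = x"
proof (rule ccontr)
  assume contra: "\<not> ?thesis"
  have "continuous_on K (\<lambda>x. norm (T x - x))"
    using T by (intro continuous_intros)
  then obtain x0 where x0: "x0 \<in> K" "\<And>x. x \<in> K \<Longrightarrow> norm (T x0 - x0) \<le> norm (T x - x)"
    using continuous_attains_inf[OF K(1,3)] by blast
  define e where "e = norm (T x0 - x0)"
  have e: "e > 0" using contra x0 by (auto simp: e_def)
  obtain F where F: "finite F" "F \<subseteq> K" "K \<subseteq> (\<Union>x\<in>F. ball x e)"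
    by (rule compactE_image[OF K(1), of K "\<lambda>x. ball x e"]) (use e in auto)
  have "F \<noteq> {}" using F K(3) by auto
  obtain p n where p: "bij_betw p {..<n::nat} F"
    using ex_bij_betw_nat_finite[OF F(1)] by (metis atLeast0LessThan)
  have n: "n > 0" using p \<open>F \<noteq> {}\<close> by (cases n) (auto simp: bij_betw_def)
  have pK: "p i \<in> K" if "i < n" for i
    using p F that by (auto simp: bij_betw_def)
  define w where "w i y = max 0 (e - norm (y - p i))" for i y
  define W where "W y = (\<Sum>i<n. w i y)" for y
  have w0: "w i y \<ge> 0" for i y by (simp add: w_def)
  have W: "W y > 0" if y: "y \<in> K" for y
  proof -
    obtain x where "x \<in> F" "dist x y < e" using F(3) y by auto
    then obtain i where i: "i < n" "w i y > 0"
      using p by (auto simp: bij_betw_def w_def dist_norm norm_minus_commute)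
    show ?thesis unfolding W_def using i w0 by (intro sum_pos2[of _ i]) auto
  qed
  \<comment> \<open>a retraction of the cube onto the simplex of weights: missing mass goes to the first vertex, excess
      mass is divided out\<close>
  define c where "c x i = (x i + (if i = 0 then max 0 (1 - (\<Sum>j<n. x j)) else 0)) / max 1 (\<Sum>j<n. x j)"
    for x :: "nat \<Rightarrow> real" and i
  define z where "z x = (\<Sum>i<n. c x i *\<^sub>R p i)" for x
  have c0: "c x i \<ge> 0" if "x \<in> unit_cube n" "i < n" for x i
    using that by (auto simp: c_def unit_cube_iff)
  have c1: "(\<Sum>i<n. c x i) = 1" for x
  proof -
    have "(\<Sum>i<n. x i + (if i = 0 then max 0 (1 - (\<Sum>j<n. x j)) else 0)) = max 1 (\<Sum>j<n. x j)"
      using n by (simp add: sum.distrib max_def)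
    then show ?thesis unfolding c_def sum_divide_distrib[symmetric] by simp
  qed
  have zK: "z x \<in> K" if "x \<in> unit_cube n" for x
    unfolding z_def using that K(2) pK c0 c1 by (intro convex_sum) auto
  define f where "f x i = (if i < n then w i (T (z x)) / W (T (z x)) else 0)" for x i
  have TzK: "T (z x) \<in> K" if "x \<in> unit_cube n" for x
    using zK[OF that] T(2) by auto
  have "continuous_on (unit_cube n) f"
  proof (rule continuous_on_coordinatewise_then_product)
    fix i
    have co: "continuous_on (unit_cube n) (\<lambda>x. x j)" for j
      by (rule continuous_on_subset[OF continuous_on_product_coordinates]) simp
    have "continuous_on (unit_cube n) (\<lambda>x. c x j)" for j
      unfolding c_def by (cases "j = 0") (auto intro!: continuous_intros co)
    then have "continuous_on (unit_cube n) z"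
      unfolding z_def by (intro continuous_intros)
    then have Tz: "continuous_on (unit_cube n) (\<lambda>x. T (z x))"
      by (rule continuous_on_compose2[OF T(1)]) (use zK in auto)
    have "continuous_on (unit_cube n) (\<lambda>x. w j (T (z x)))" for j
      unfolding w_def by (intro continuous_intros Tz)
    then show "continuous_on (unit_cube n) (\<lambda>x. f x i)"
      unfolding f_def W_def[abs_def]
      by (cases "i < n") (auto intro!: continuous_intros less_imp_neq[THEN not_sym] simp: W[unfolded W_def] TzK)
  qed
  moreover have "f ` unit_cube n \<subseteq> unit_cube n"
    using w0 W[OF TzK]
    by (auto simp: unit_cube_iff f_def divide_le_eq_1 less_imp_le W_def intro!: member_le_sum)
  ultimately obtain x where x: "x \<in> unit_cube n" "f x = x"
    using brouwer_unit_cube by blast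
  define y where "y = T (z x)"
  have yK: "y \<in> K" using TzK[OF x(1)] by (simp add: y_def)
  have xi: "x i = w i y / W y" if "i < n" for i
    using fun_cong[OF x(2), of i] that by (simp add: f_def y_def)
  have sx: "(\<Sum>i<n. x i) = 1"
    using W[OF yK] by (simp add: xi sum_divide_distrib[symmetric] W_def)
  then have zx: "z x = (\<Sum>i<n. x i *\<^sub>R p i)"
    unfolding z_def c_def by (intro sum.cong) simp_all
  have "y - z x = (\<Sum>i<n. x i *\<^sub>R (y - p i))"
    by (simp only: zx scaleR_right_diff_distrib sum_subtractf scaleR_left.sum[symmetric] sx scaleR_one)
  also have "norm \<dots> \<le> (\<Sum>i<n. x i * norm (y - p i))"
    by (rule order_trans[OF norm_sum]) (use x(1) in \<open>auto simp: unit_cube_iff intro!: sum_mono\<close>)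
  also have "\<dots> < (\<Sum>i<n. x i * e)"
  proof (rule sum_strict_mono_ex1)
    show "\<forall>i\<in>{..<n}. x i * norm (y - p i) \<le> x i * e"
    proof
      fix i assume "i \<in> {..<n}"
      then show "x i * norm (y - p i) \<le> x i * e"
        using x(1) by (cases "norm (y - p i) \<le> e") (simp_all add: mult_left_mono unit_cube_iff, simp add: xi w_def)
    qed
    have "\<exists>i<n. x i \<noteq> 0"
      using sx by (metis lessThan_iff sum.neutral zero_neq_one)
    then obtain i where i: "i < n" "x i \<noteq> 0" by blast
    then have "x i > 0" using x(1) unfolding unit_cube_iff by (metis order_less_le)
    moreover have "norm (y - p i) < e"
      using i by (auto simp: xi w_def max_def split: if_splits)
    ultimately show "\<exists>i\<in>{..<n}. x i * norm (y - p i) < x i * e"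
      using i(1) by (intro bexI[of _ i]) simp_all
  qed simp
  also have "\<dots> = e" by (simp add: sum_distrib_right[symmetric] sx)
  finally show False
    using x0(2)[OF zK[OF x(1)]] by (simp add: e_def y_def)
qed

section \<open>Normed spaces with a finite spanning set\<close>

text \<open>
  Here \<open>d\<close> is the distance from \<open>x\<close> to \<open>S\<close>: it controls the coefficient of \<open>x\<close> in any vector of
  \<open>S + span {x}\<close>, which is the induction step of the next two lemmas.
\<close>

lemma subspace_complement_bound:
  fixes S :: "'a::real_normed_vector set"
  assumes "closed S" "subspace S" "x \<notin> S"
  obtains d where "0 < d" "\<And>c v. v \<in> S \<Longrightarrow> \<bar>c\<bar> * d \<le> norm (c *\<^sub>R x + v)"
proof -
  obtain d where d: "d > 0" "\<And>y. dist y x < d \<Longrightarrow> y \<notin> S"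
    using assms(1,3) by (metis open_Compl ComplD ComplI open_dist)
  have "\<bar>c\<bar> * d \<le> norm (c *\<^sub>R x + v)" if "v \<in> S" for c v
  proof (cases "c = 0")
    case False
    have "(- 1 / c) *\<^sub>R v \<in> S"
      using assms(2) that by (rule subspace_scale)
    then have "d \<le> dist ((- 1 / c) *\<^sub>R v) x"
      using d(2) not_le by blast
    then have "\<bar>c\<bar> * d \<le> \<bar>c\<bar> * norm ((1 / c) *\<^sub>R v + x)"
      by (intro mult_left_mono) (simp_all add: dist_norm norm_minus_commute add.commute)
    also have "\<dots> = norm (c *\<^sub>R ((1 / c) *\<^sub>R v + x))"
      by simp
    also have "c *\<^sub>R ((1 / c) *\<^sub>R v + x) = c *\<^sub>R x + v"
      using False by (simp add: scaleR_add_right)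
    finally show ?thesis .
  qed simp
  with d(1) that show ?thesis by blast
qed

lemma complete_span_finite:
  fixes F :: "'a::real_normed_vector set"
  assumes "finite F"
  shows "complete (span F)"
  using assms
proof (induction F)
  case (insert x F)
  show ?case
  proof (cases "x \<in> span F")
    case True
    with insert.IH show ?thesis by (simp add: span_redundant)
  next
    case False
    obtain d where d: "0 < d" "\<And>c v. v \<in> span F \<Longrightarrow> \<bar>c\<bar> * d \<le> norm (c *\<^sub>R x + v)"
      using subspace_complement_bound[OF complete_imp_closed[OF insert.IH] subspace_span False] by blast
    show ?thesis
    proof (rule completeI)
      fix f assume f: "\<forall>n. f n \<in> span (insert x F)" "Cauchy f"
      have "\<forall>n. \<exists>k. f n - k *\<^sub>R x \<in> span F"
        using f(1) by (simp add: span_insert)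
      then obtain k where k: "\<And>n. f n - k n *\<^sub>R x \<in> span F"
        by metis
      have kd: "\<bar>k m - k n\<bar> * d \<le> norm (f m - f n)" for m n
        using d(2)[OF span_diff[OF k[of m] k[of n]], of "k m - k n"]
        by (simp add: algebra_simps)
      have "Cauchy k"
      proof (rule CauchyI)
        fix e :: real assume "e > 0"
        then obtain N where N: "\<forall>m\<ge>N. \<forall>n\<ge>N. norm (f m - f n) < e * d"
          using CauchyD[OF f(2), of "e * d"] d(1) by auto
        show "\<exists>N. \<forall>m\<ge>N. \<forall>n\<ge>N. norm (k m - k n) < e"
        proof (intro exI[of _ N] allI impI)
          fix m n assume "N \<le> m" "N \<le> n"
          then have "\<bar>k m - k n\<bar> * d < e * d"
            using kd[of m n] N by force
          then show "norm (k m - k n) < e" using d(1) by simp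
        qed
      qed
      then obtain c where c: "k \<longlonglongrightarrow> c" by (metis Cauchy_convergent_iff convergent_def)
      then have "(\<lambda>n. k n *\<^sub>R x) \<longlonglongrightarrow> c *\<^sub>R x"
        by (intro tendsto_intros)
      moreover have "Cauchy (\<lambda>n. f n - k n *\<^sub>R x)"
      proof (rule CauchyI)
        fix e :: real assume "e > 0"
        then have "e / (1 + norm x / d) > 0" using d(1) by (simp add: add_pos_nonneg)
        then obtain N where N: "\<forall>m\<ge>N. \<forall>n\<ge>N. norm (f m - f n) < e / (1 + norm x / d)"
          using CauchyD[OF f(2)] by blast
        show "\<exists>N. \<forall>m\<ge>N. \<forall>n\<ge>N. norm ((f m - k m *\<^sub>R x) - (f n - k n *\<^sub>R x)) < e"
        proof (intro exI[of _ N] allI impI)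
          fix m n assume mn: "N \<le> m" "N \<le> n"
          have "norm ((f m - k m *\<^sub>R x) - (f n - k n *\<^sub>R x)) = norm ((f m - f n) - (k m - k n) *\<^sub>R x)"
            by (simp add: algebra_simps)
          also have "\<dots> \<le> norm (f m - f n) + \<bar>k m - k n\<bar> * norm x"
            using norm_triangle_ineq4[of "f m - f n" "(k m - k n) *\<^sub>R x"] by simp
          also have "\<dots> \<le> norm (f m - f n) + norm (f m - f n) / d * norm x"
            using kd[of m n] d(1) by (intro add_left_mono mult_right_mono) (simp_all add: field_simps)
          also have "\<dots> = norm (f m - f n) * (1 + norm x / d)"
            by (simp add: algebra_simps)
          also have "\<dots> < e"
            using N mn d(1) by (simp add: pos_less_divide_eq add_pos_nonneg)
          finally show "norm ((f m - k m *\<^sub>R x) - (f n - k n *\<^sub>R x)) < e" .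
        qed
      qed
      then obtain v where v: "v \<in> span F" "(\<lambda>n. f n - k n *\<^sub>R x) \<longlonglongrightarrow> v"
        using completeE[OF insert.IH] k by metis
      ultimately have "(\<lambda>n. (f n - k n *\<^sub>R x) + k n *\<^sub>R x) \<longlonglongrightarrow> v + c *\<^sub>R x"
        by (intro tendsto_add)
      moreover have "v + c *\<^sub>R x \<in> span (insert x F)"
        using v(1) unfolding span_insert by (auto intro!: exI[of _ c])
      ultimately show "\<exists>l\<in>span (insert x F). f \<longlonglongrightarrow> l"
        by auto
    qed
  qed
qed (simp add: compact_imp_complete)

lemma linear_bounded_on_span_finite:
  fixes F :: "'a::real_normed_vector set" and g :: "'a \<Rightarrow> 'b::real_normed_vector"
  assumes "finite F" "linear g"
  shows "\<exists>K\<ge>0. \<forall>y\<in>span F. norm (g y) \<le> K * norm y"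
  using assms(1)
proof (induction F)
  case empty
  then show ?case using linear_0[OF assms(2)] by (intro exI[of _ 0]) auto
next
  case (insert x F)
  interpret linear g by fact
  show ?case
  proof (cases "x \<in> span F")
    case True
    with insert.IH show ?thesis by (simp add: span_redundant)
  next
    case False
    obtain d where d: "0 < d" "\<And>c v. v \<in> span F \<Longrightarrow> \<bar>c\<bar> * d \<le> norm (c *\<^sub>R x + v)"
      using subspace_complement_bound[OF complete_imp_closed[OF complete_span_finite] subspace_span False]
        insert.hyps by blast
    obtain K where K: "K \<ge> 0" "\<And>y. y \<in> span F \<Longrightarrow> norm (g y) \<le> K * norm y"
      using insert.IH by blast
    have "norm (g y) \<le> ((norm (g x) + K * norm x) / d + K) * norm y" if y: "y \<in> span (insert x F)" for y
    proof -
      obtain c where c: "y - c *\<^sub>R x \<in> span F"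
        using y by (auto simp: span_insert)
      have cd: "\<bar>c\<bar> \<le> norm y / d"
        using d(2)[OF c, of c] d(1) by (simp add: field_simps)
      have "norm (g y) = norm (c *\<^sub>R g x + g (y - c *\<^sub>R x))"
        by (simp add: diff scale)
      also have "\<dots> \<le> \<bar>c\<bar> * norm (g x) + K * norm (y - c *\<^sub>R x)"
        by (rule order_trans[OF norm_triangle_ineq]) (use K(2)[OF c] in simp)
      also have "\<dots> \<le> \<bar>c\<bar> * norm (g x) + K * (norm y + \<bar>c\<bar> * norm x)"
        using norm_triangle_ineq4[of y "c *\<^sub>R x"] K(1) by (intro add_left_mono mult_left_mono) auto
      also have "\<dots> = \<bar>c\<bar> * (norm (g x) + K * norm x) + K * norm y"
        by (simp add: algebra_simps)
      also have "\<dots> \<le> norm y / d * (norm (g x) + K * norm x) + K * norm y"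
        using cd K(1) by (intro add_right_mono mult_right_mono) auto
      finally show ?thesis by (simp add: algebra_simps add_divide_distrib)
    qed
    moreover have "(norm (g x) + K * norm x) / d + K \<ge> 0"
      using K(1) d(1) by simp
    ultimately show ?thesis by blast
  qed
qed

lemma bounded_linear_if_finite_span:
  fixes F :: "'a::real_normed_vector set" and g :: "'a \<Rightarrow> 'b::real_normed_vector"
  assumes "finite F" "span F = UNIV" "linear g"
  shows "bounded_linear g"
proof -
  obtain K where "\<And>y. norm (g y) \<le> K * norm y"
    using linear_bounded_on_span_finite[OF assms(1,3)] assms(2) by auto
  then show ?thesis
    using assms(3) by (intro bounded_linear_intro[of g K]) (auto simp: linear_add linear_scale mult.commute)
qed

text \<open>
  The argument of Riesz: a finite \<open>1/2\<close>-net of the unit ball spans, for otherwise a unit vector pointing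
  almost perpendicularly away from its closed span would be far from the net.
\<close>

lemma finite_span_if_compact_cball:
  assumes "compact (cball (0::'a::real_normed_vector) 1)"
  obtains F where "finite F" "span F = (UNIV :: 'a set)"
proof -
  obtain F where F: "finite F" "F \<subseteq> cball (0::'a) 1" "cball 0 1 \<subseteq> (\<Union>x\<in>F. ball x (1/2))"
    by (rule compactE_image[OF assms, of "cball 0 1" "\<lambda>x. ball x (1/2)"]) auto
  have "x \<in> span F" for x
  proof (rule ccontr)
    assume x: "x \<notin> span F"
    have cl: "closed (span F)"
      using F(1) by (intro complete_imp_closed complete_span_finite)
    define d where "d = infdist x (span F)"
    have ne: "span F \<noteq> {}" using span_zero by blast
    have d: "d > 0"
      using in_closed_iff_infdist_zero[OF cl ne] x infdist_nonneg[of x "span F"] by (auto simp: d_def)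
    have "\<not> (\<forall>v\<in>span F. 2 * d \<le> dist x v)"
      using cINF_greatest[OF ne, of "2 * d" "dist x"] d ne by (auto simp: d_def infdist_def)
    then obtain v where v: "v \<in> span F" "dist x v < 2 * d"
      by (auto simp: not_le)
    define r where "r = norm (x - v)"
    have r: "r > 0" using v x by (auto simp: r_def)
    have "(1 / r) *\<^sub>R (x - v) \<in> cball 0 1"
      using r by (simp add: r_def)
    then have "(1 / r) *\<^sub>R (x - v) \<in> (\<Union>f\<in>F. ball f (1 / 2))"
      using F(3) by blast
    then obtain f where f: "f \<in> F" "dist f ((1 / r) *\<^sub>R (x - v)) < 1 / 2"
      unfolding UN_iff mem_ball by blast
    have "v + r *\<^sub>R f \<in> span F"
      using v f by (auto intro: span_add span_scale span_base)
    then have "d \<le> dist x (v + r *\<^sub>R f)"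
      unfolding d_def by (rule infdist_le)
    also have "\<dots> = norm (r *\<^sub>R ((1 / r) *\<^sub>R (x - v) - f))"
      using r by (simp add: dist_norm algebra_simps)
    also have "\<dots> = r * dist f ((1 / r) *\<^sub>R (x - v))"
      using r by (simp add: dist_norm norm_minus_commute del: scaleR_right_diff_distrib)
    also have "\<dots> < r * (1 / 2)"
      using r f by (intro mult_strict_left_mono)
    also have "\<dots> < d" using v(2) by (simp add: r_def dist_norm)
    finally show False .
  qed
  with F(1) that show ?thesis by blast
qed

text \<open>
  Turns a finite spanning set into an instance of the locale that carries the dimension theory.
\<close>

lemma finite_dimensional_if_finite_span:
  fixes F :: "'a::real_vector set"
  assumes "finite F" "span F = UNIV"
  shows "\<exists>Bs. finite_dimensional_vector_space (scaleR :: real \<Rightarrow> 'a \<Rightarrow> 'a) Bs"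
proof -
  obtain Bs where Bs: "Bs \<subseteq> F" "independent Bs" "F \<subseteq> span Bs"
    using real_vector.maximal_independent_subset[of F] by blast
  have "finite Bs" using Bs(1) assms(1) finite_subset by blast
  moreover have "span Bs = UNIV"
    using assms(2) span_minimal[OF Bs(3) subspace_span] by blast
  ultimately have "finite_dimensional_vector_space (scaleR :: real \<Rightarrow> 'a \<Rightarrow> 'a) Bs"
    using Bs(2) by unfold_locales (simp_all add: dependent_raw_def span_raw_def)
  then show ?thesis ..
qed

text \<open>
  A map cannot raise dimension.  Linearity is asked for on \<open>N\<close> only because \<open>f\<close> will be an integral
  whose value is meaningful only where the integrand is integrable.
\<close>

lemma subspace_eq_UNIV_if_image_UNIV:
  fixes F N :: "'a::real_vector set" and f :: "'a \<Rightarrow> 'a"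
  assumes F: "finite F" "span F = UNIV" and N: "subspace N"
    and f: "\<And>x y. x \<in> N \<Longrightarrow> y \<in> N \<Longrightarrow> f (x + y) = f x + f y" "\<And>c x. x \<in> N \<Longrightarrow> f (c *\<^sub>R x) = c *\<^sub>R f x"
    and onto: "f ` N = UNIV"
  shows "N = UNIV"
proof -
  obtain Bs where "finite_dimensional_vector_space (scaleR :: real \<Rightarrow> 'a \<Rightarrow> 'a) Bs"
    using finite_dimensional_if_finite_span[OF F] by blast
  then interpret finite_dimensional_vector_space "scaleR :: real \<Rightarrow> 'a \<Rightarrow> 'a" Bs
    rewrites "module.dependent (*\<^sub>R) = (dependent :: 'a set \<Rightarrow> bool)"
      and "module.subspace (*\<^sub>R) = (subspace :: 'a set \<Rightarrow> bool)"
      and "module.span (*\<^sub>R) = (span :: 'a set \<Rightarrow> 'a set)"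
      and "vector_space.dim (*\<^sub>R) = (dim :: 'a set \<Rightarrow> nat)"
      and "Vector_Spaces.linear (*\<^sub>R) (*\<^sub>R) = (linear :: ('a \<Rightarrow> 'a) \<Rightarrow> bool)"
    by (simp_all add: dependent_raw_def subspace_raw_def span_raw_def dim_raw_def linear_def[abs_def])
  obtain C where C: "C \<subseteq> N" "independent C" "N \<subseteq> span C" "card C = dim N"
    using basis_exists by blast
  have finC: "finite C" using C(2) finiteI_independent by auto
  have CN: "span C = N" using C(1,3) N span_minimal by blast
  have "x \<in> N \<and> f x \<in> span (f ` C)" if "x \<in> span C" for x
    using that
  proof (induction rule: span_induct_alt)
    case base
    have "f 0 = 0" using f(2)[of 0 0] N subspace_0 by auto
    then show ?case using N by (simp add: span_zero subspace_0)
  next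
    case (step c x y)
    then have "x \<in> N" "c *\<^sub>R x \<in> N" "y \<in> N" using C(1) N by (auto intro: subspace_scale)
    with step show ?case
      using N by (auto simp: f intro!: subspace_add span_add span_scale intro: span_base)
  qed
  then have "f ` N \<subseteq> span (f ` C)" using CN by blast
  then have "UNIV \<subseteq> span (f ` C)" using onto by simp
  then have "dim (UNIV :: 'a set) \<le> card (f ` C)"
    using finC by (intro span_card_ge_dim) auto
  also have "\<dots> \<le> dim N" using card_image_le[OF finC] C(4) by simp
  finally show ?thesis using subspace_dim_equal[OF N subspace_UNIV] by simp
qed

lemma surj_iff_inj_if_finite_span:
  fixes F :: "'a::real_vector set" and f :: "'a \<Rightarrow> 'a"
  assumes F: "finite F" "span F = UNIV" and f: "linear f"
  shows "surj f \<longleftrightarrow> inj f"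
proof -
  obtain Bs where "finite_dimensional_vector_space (scaleR :: real \<Rightarrow> 'a \<Rightarrow> 'a) Bs"
    using finite_dimensional_if_finite_span[OF F] by blast
  then interpret finite_dimensional_vector_space "scaleR :: real \<Rightarrow> 'a \<Rightarrow> 'a" Bs
    rewrites "module.dependent (*\<^sub>R) = (dependent :: 'a set \<Rightarrow> bool)"
      and "module.subspace (*\<^sub>R) = (subspace :: 'a set \<Rightarrow> bool)"
      and "module.span (*\<^sub>R) = (span :: 'a set \<Rightarrow> 'a set)"
      and "vector_space.dim (*\<^sub>R) = (dim :: 'a set \<Rightarrow> nat)"
      and "Vector_Spaces.linear (*\<^sub>R) (*\<^sub>R) = (linear :: ('a \<Rightarrow> 'a) \<Rightarrow> bool)"
    by (simp_all add: dependent_raw_def subspace_raw_def span_raw_def dim_raw_def linear_def[abs_def])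
  show ?thesis
    using linear_inj_imp_surj[OF f] linear_surj_imp_inj[OF f] by blast
qed

lemma linear_inv_if_bij:
  fixes f :: "'a::real_vector \<Rightarrow> 'b::real_vector"
  assumes f: "linear f" and bij: "bij f"
  shows "linear (inv f)"
proof (rule linearI)
  have ff: "f (inv f y) = y" "inv f (f x) = x" for x y
    using bij by (simp_all add: bij_is_surj surj_f_inv_f bij_is_inj)
  show "inv f (x + y) = inv f x + inv f y" for x y
    by (metis ff linear_add[OF f])
  show "inv f (r *\<^sub>R x) = r *\<^sub>R inv f x" for r x
    by (metis ff linear_scale[OF f])
qed

text \<open>
  The range is finite-dimensional, hence closed.
\<close>

lemma surj_if_dense_range_finite_span:
  fixes \<iota> :: "'a::real_normed_vector \<Rightarrow> 'b::real_normed_vector"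
  assumes F: "finite F" "span F = UNIV" and \<iota>: "linear \<iota>" "closure (range \<iota>) = UNIV"
  shows "surj \<iota>" and "span (\<iota> ` F) = UNIV"
proof -
  have r: "range \<iota> = span (\<iota> ` F)"
    using linear_span_image[OF \<iota>(1), of F] F(2) by simp
  moreover have "closed (span (\<iota> ` F))"
    using F(1) by (intro complete_imp_closed complete_span_finite) simp
  ultimately show "surj \<iota>" "span (\<iota> ` F) = UNIV"
    using \<iota>(2) by (simp_all add: closure_closed)
qed

section \<open>Semigroups whose generator is defined everywhere\<close>

text \<open>
  The uniform boundedness principle for the operators \<open>(Q t - 1) / t\<close>.  The sets of \<open>x\<close> on which they
  are bounded by \<open>n\<close> are closed and cover the space, so one of them contains a ball.
\<close>

lemma difference_quotients_bounded:
  fixes Q :: "real \<Rightarrow> 'a::banach \<Rightarrow> 'a"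
  assumes lin: "\<And>t. 0 \<le> t \<Longrightarrow> bounded_linear (Q t)"
    and bound: "\<And>t x. 0 \<le> t \<Longrightarrow> norm (Q t x) \<le> M0 * norm x"
    and diff: "\<And>x. \<exists>y. ((\<lambda>t. (1 / t) *\<^sub>R (Q t x - x)) \<longlongrightarrow> y) (at_right 0)"
  shows "\<exists>C\<ge>0. \<forall>t x. 0 < t \<and> t \<le> 1 \<longrightarrow> norm (Q t x - x) \<le> C * t * norm x"
proof -
  define F where "F n = (\<Inter>t\<in>{0<..1}. {x. norm (Q t x - x) \<le> real n * t})" for n :: nat
  have clF: "closed (F n)" for n
    unfolding F_def
    by (intro closed_INT ballI closed_Collect_le continuous_intros linear_continuous_on lin) auto
  have "x \<in> (\<Union>n. F n)" for x
  proof -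
    obtain y where y: "((\<lambda>t. (1 / t) *\<^sub>R (Q t x - x)) \<longlongrightarrow> y) (at_right 0)"
      using diff by blast
    have "\<forall>\<^sub>F t in at_right 0. norm ((1 / t) *\<^sub>R (Q t x - x)) < norm y + 1"
      using tendsto_norm[OF y] by (rule order_tendstoD) simp
    then obtain d where d: "d > 0" "\<And>t. 0 < t \<Longrightarrow> t < d \<Longrightarrow> norm ((1 / t) *\<^sub>R (Q t x - x)) < norm y + 1"
      unfolding eventually_at_right_field by auto
    define m where "m = max (norm y + 1) ((M0 * norm x + norm x) / d)"
    have "norm (Q t x - x) \<le> m * t" if t: "0 < t" for t
    proof (cases "t < d")
      case True
      then have "norm (Q t x - x) \<le> (norm y + 1) * t"
      proof -
        have "norm (Q t x - x) / t < norm y + 1"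
          using d(2)[OF t True] t by (simp only: norm_scaleR) simp
        then show ?thesis using t by (simp add: pos_divide_less_eq less_imp_le)
      qed
      also have "\<dots> \<le> m * t" using t by (intro mult_right_mono) (auto simp: m_def)
      finally show ?thesis .
    next
      case False
      have "norm (Q t x - x) \<le> M0 * norm x + norm x"
        by (rule order_trans[OF norm_triangle_ineq4]) (use bound[of t x] t in simp)
      also have "\<dots> = (M0 * norm x + norm x) / d * d" using d(1) by simp
      also have "\<dots> \<le> m * t"
        using False d(1) by (intro mult_mono) (auto simp: m_def intro: order_trans[OF _ max.cobounded1])
      finally show ?thesis .
    qed
    moreover obtain n where "m \<le> real n" using real_arch_simple by blast
    ultimately have "norm (Q t x - x) \<le> real n * t" if "0 < t" for t
      using that by (meson mult_right_mono less_imp_le order_trans)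
    then show ?thesis unfolding F_def by (intro UN_I[of n]) auto
  qed
  then have cover: "(\<Union>n. F n) = UNIV" by blast
  have "\<exists>n. interior (F n) \<noteq> {}"
  proof (rule ccontr)
    assume "\<not> ?thesis"
    then have "Met_TC.mtopology interior_of \<Union>(range F) = {}"
      by (intro Met_TC.metric_Baire_category_alt)
        (use clF in \<open>auto simp: mcomplete_iff_complete complete_UNIV\<close>)
    then show False using cover by simp
  qed
  then obtain n x0 where "x0 \<in> interior (F n)" by blast
  then obtain r where r: "r > 0" "cball x0 r \<subseteq> F n"
    using mem_interior_cball by blast
  have "norm (Q t x - x) \<le> (2 * real n / r) * t * norm x" if t: "0 < t" "t \<le> 1" for t x
  proof (cases "x = 0")
    case True
    then show ?thesis using bounded_linear.linear[OF lin[of t]] t by (simp add: linear_0)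
  next
    case False
    interpret bounded_linear "Q t" using lin t by simp
    define e where "e = (r / norm x) *\<^sub>R x"
    have "x0 + e \<in> cball x0 r" "x0 \<in> cball x0 r"
      using r(1) False by (auto simp: e_def dist_norm)
    moreover have "norm (Q t y - y) \<le> real n * t" if "y \<in> cball x0 r" for y
      using subsetD[OF r(2) that] t by (simp add: F_def)
    ultimately have a: "norm (Q t (x0 + e) - (x0 + e)) \<le> real n * t" "norm (Q t x0 - x0) \<le> real n * t"
      by blast+
    have "Q t x - x = (norm x / r) *\<^sub>R (Q t e - e)"
      using r(1) False by (simp add: e_def scale scaleR_right_diff_distrib)
    also have "Q t e - e = (Q t (x0 + e) - (x0 + e)) - (Q t x0 - x0)"
      by (simp add: add)
    finally have "norm (Q t x - x) = (norm x / r) * norm ((Q t (x0 + e) - (x0 + e)) - (Q t x0 - x0))"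
      using r(1) by simp
    also have "\<dots> \<le> (norm x / r) * (real n * t + real n * t)"
      by (intro mult_left_mono order_trans[OF norm_triangle_ineq4] add_mono a) (use r in simp)
    finally show ?thesis by (simp add: algebra_simps)
  qed
  then show ?thesis using r(1) by (intro exI[of _ "2 * real n / r"]) auto
qed

text \<open>
  A net of the relatively compact set \<open>Q t ` cball 0 1\<close> is a net of the ball itself up to an error \<open>C t\<close>.
\<close>

lemma compact_cball_if_compact_approximations:
  fixes Q :: "real \<Rightarrow> 'a::banach \<Rightarrow> 'a"
  assumes C: "C \<ge> 0" "\<And>t x. 0 < t \<Longrightarrow> t \<le> 1 \<Longrightarrow> norm (Q t x - x) \<le> C * t * norm x"
    and comp: "\<And>t. 0 < t \<Longrightarrow> compact (closure (Q t ` cball 0 1))"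
  shows "compact (cball (0::'a) 1)"
  unfolding compact_eq_totally_bounded
proof (intro conjI allI impI)
  show "complete (cball (0::'a) 1)"
    by (simp add: complete_eq_closed)
  fix e :: real assume e: "e > 0"
  define t where "t = min 1 (e / (2 * (C + 1)))"
  have t: "0 < t" "t \<le> 1" using e C by (auto simp: t_def)
  have "C * t \<le> (C + 1) * (e / (2 * (C + 1)))"
    using C(1) e by (intro mult_mono) (auto simp: t_def)
  also have "\<dots> = e / 2" using C(1) by (simp add: field_simps)
  finally have Ct: "C * t \<le> e / 2" .
  obtain k where k: "finite k" "closure (Q t ` cball 0 1) \<subseteq> (\<Union>x\<in>k. ball x (e / 2))"
    using comp[OF t(1)] e unfolding compact_eq_totally_bounded by (metis half_gt_zero)
  have "x \<in> (\<Union>x\<in>k. ball x e)" if x: "x \<in> cball 0 1" for x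
  proof -
    have "Q t x \<in> closure (Q t ` cball 0 1)"
      by (rule subsetD[OF closure_subset imageI[OF x]])
    then have "Q t x \<in> (\<Union>x\<in>k. ball x (e / 2))" by (rule subsetD[OF k(2)])
    then obtain y where y: "y \<in> k" "dist y (Q t x) < e / 2" by auto
    have "dist (Q t x) x \<le> C * t * norm x" using C(2)[OF t] by (simp add: dist_norm)
    also have "\<dots> \<le> C * t * 1" using x C(1) t(1) by (intro mult_left_mono) auto
    finally have "dist y x < e" using y(2) Ct dist_triangle[of y x "Q t x"] by simp
    then show ?thesis using y(1) by auto
  qed
  with k(1) have "finite k \<and> cball 0 1 \<subseteq> (\<Union>x\<in>k. ball x e)" by auto
  then show "\<exists>k. finite k \<and> cball (0::'a) 1 \<subseteq> (\<Union>x\<in>k. ball x e)" ..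
qed

text \<open>
  If \<open>x\<close> were an eigenvector of the generator for \<open>z > 0\<close>, then \<open>Q t x\<close> would grow like \<open>exp (z t) x\<close>
  against the bound \<open>M0\<close>.  The growth is read off discretely: with step \<open>h = T / n\<close> one has
  \<open>Q h x = (1 + z h) x + o(h)\<close>, and by Bernoulli's inequality \<open>(1 + z h)\<^sup>n \<ge> 1 + z T\<close>, which exceeds
  \<open>2 M0\<close> for \<open>T = 2 M0 / z\<close>.
\<close>

lemma positive_not_eigenvalue:
  fixes Q :: "real \<Rightarrow> 'a::real_normed_vector \<Rightarrow> 'a"
  assumes lin: "\<And>t. 0 \<le> t \<Longrightarrow> linear (Q t)"
    and bound: "\<And>t x. 0 \<le> t \<Longrightarrow> norm (Q t x) \<le> M0 * norm x"
    and Q0: "\<And>x. Q 0 x = x"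
    and sg: "\<And>s t x. 0 \<le> s \<Longrightarrow> 0 \<le> t \<Longrightarrow> Q (s + t) x = Q s (Q t x)"
    and diff: "((\<lambda>t. (1 / t) *\<^sub>R (Q t x - x)) \<longlongrightarrow> z *\<^sub>R x) (at_right 0)"
    and z: "z > 0"
  shows "x = 0"
proof (rule ccontr)
  assume x: "x \<noteq> 0"
  have M0: "M0 \<ge> 1" using bound[of 0 x] x Q0 by simp
  define g where "g h = norm ((1 + z * h) *\<^sub>R x - Q h x)" for h
  \<comment> \<open>telescoping along the differences of \<open>Q (j h) x / (1 + z h)\<^sup>j\<close> for \<open>j \<le> n\<close>\<close>
  have tele: "norm (x - (1 / (1 + z * h)) ^ n *\<^sub>R Q (real n * h) x) \<le> real n * (M0 * g h)" if h: "h > 0" for n h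
  proof (induction n)
    case 0
    then show ?case by (simp add: Q0)
  next
    case (Suc n)
    define c where "c = 1 / (1 + z * h)"
    have c: "0 < c" "c \<le> 1" using h z by (auto simp: c_def add_pos_pos)
    have nh: "real n * h \<ge> 0" using h by simp
    have "c ^ n * norm (Q (real n * h) (x - c *\<^sub>R Q h x)) \<le> 1 * (M0 * norm (x - c *\<^sub>R Q h x))"
      using c bound[OF nh] by (intro mult_mono power_le_one) auto
    also have "\<dots> \<le> M0 * g h"
    proof -
      have "1 + z * h > 0" using h z by (simp add: add_pos_pos)
      then have "c * (1 + z * h) = 1" by (simp add: c_def)
      then have "x - c *\<^sub>R Q h x = c *\<^sub>R ((1 + z * h) *\<^sub>R x - Q h x)"
        by (simp only: scaleR_right_diff_distrib scaleR_scaleR scaleR_one)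
      then have "norm (x - c *\<^sub>R Q h x) = c * g h" using c by (simp only: g_def norm_scaleR abs_of_pos)
      also have "\<dots> \<le> 1 * g h" using c by (intro mult_right_mono) (auto simp: g_def)
      finally show ?thesis using M0 by simp
    qed
    finally have *: "norm (c ^ n *\<^sub>R Q (real n * h) (x - c *\<^sub>R Q h x)) \<le> M0 * g h" using c by simp
    have "x - c ^ Suc n *\<^sub>R Q (real (Suc n) * h) x =
        (x - c ^ n *\<^sub>R Q (real n * h) x) + c ^ n *\<^sub>R Q (real n * h) (x - c *\<^sub>R Q h x)"
      using sg[OF nh, of h x] h lin[OF nh]
      by (simp add: algebra_simps linear_diff linear_scale)
    then have "norm (x - c ^ Suc n *\<^sub>R Q (real (Suc n) * h) x) \<le> real n * (M0 * g h) + M0 * g h"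
      using norm_triangle_le[OF add_mono[OF Suc[folded c_def] *]] by (simp only:)
    then show ?case by (simp only: c_def of_nat_Suc distrib_right mult_1 add.commute)
  qed
  have "((\<lambda>h. norm (z *\<^sub>R x - (1 / h) *\<^sub>R (Q h x - x))) \<longlongrightarrow> norm (z *\<^sub>R x - z *\<^sub>R x)) (at_right 0)"
    by (intro tendsto_intros diff)
  moreover have "\<forall>\<^sub>F h in at_right 0. norm (z *\<^sub>R x - (1 / h) *\<^sub>R (Q h x - x)) = g h / h"
  proof (rule eventually_at_right_less[THEN eventually_mono])
    fix h :: real assume h: "0 < h"
    have "(1 + z * h) *\<^sub>R x - Q h x = h *\<^sub>R (z *\<^sub>R x - (1 / h) *\<^sub>R (Q h x - x))"
      using h by (simp add: algebra_simps)
    then show "norm (z *\<^sub>R x - (1 / h) *\<^sub>R (Q h x - x)) = g h / h"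
      using h by (simp add: g_def)
  qed
  ultimately have gh: "((\<lambda>h. g h / h) \<longlongrightarrow> 0) (at_right 0)"
    using tendsto_cong by fastforce
  define T where "T = 2 * M0 / z"
  have T: "T > 0" using M0 z by (simp add: T_def)
  have "filterlim (\<lambda>n. T / real n) (at_right 0) sequentially"
    unfolding filterlim_at using T
    by (auto intro!: tendsto_divide_0[OF tendsto_const] filterlim_at_top_imp_at_infinity
        filterlim_real_sequentially eventually_mono[OF eventually_gt_at_top[of 0]])
  from filterlim_compose[OF gh this]
  have "(\<lambda>n. T * (M0 * (g (T / real n) / (T / real n)))) \<longlonglongrightarrow> T * (M0 * 0)"
    by (intro tendsto_intros)
  moreover have "norm x / 2 \<le> T * (M0 * (g (T / real n) / (T / real n)))" if n: "n > 0" for n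
  proof -
    define h where "h = T / real n"
    have h: "h > 0" "real n * h = T" using T n by (auto simp: h_def)
    define c where "c = 1 / (1 + z * h)"
    have c: "c > 0" using h z by (simp add: c_def add_pos_pos)
    have "1 + real n * (z * h) \<le> (1 + z * h) ^ n"
      using h z by (intro Bernoulli_inequality) (meson less_imp_le mult_pos_pos neg_le_0_iff_le order_trans zero_le_one)
    moreover have "real n * (z * h) = 2 * M0" using h(2) z by (simp add: T_def field_simps)
    ultimately have "c ^ n * (2 * M0) \<le> 1"
      using h z by (simp add: c_def power_divide pos_divide_le_eq add_pos_pos)
    then have cM: "c ^ n * M0 \<le> 1 / 2" by simp
    have "norm x \<le> norm (x - c ^ n *\<^sub>R Q T x) + norm (c ^ n *\<^sub>R Q T x)"
      using norm_triangle_ineq[of "x - c ^ n *\<^sub>R Q T x" "c ^ n *\<^sub>R Q T x"] by simp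
    also have "\<dots> \<le> real n * (M0 * g h) + c ^ n * (M0 * norm x)"
      using tele[OF h(1), of n] bound[of T x] c T by (intro add_mono) (auto simp: c_def h)
    also have "\<dots> \<le> real n * (M0 * g h) + norm x / 2"
      using mult_right_mono[OF cM norm_ge_zero[of x]] by simp
    finally have "norm x / 2 \<le> real n * (M0 * g h)" by simp
    also have "\<dots> = T * (M0 * (g h / h))" using h by (simp add: field_simps)
    finally show ?thesis by (simp add: h_def)
  qed
  ultimately have "norm x / 2 \<le> T * (M0 * 0)"
    by (intro tendsto_lowerbound) (auto intro!: eventually_mono[OF eventually_gt_at_top[of 0]])
  then show False using x by simp
qed

lemma strongly_continuous_if_Lipschitz_at_0:
  fixes Q :: "real \<Rightarrow> 'a::real_normed_vector \<Rightarrow> 'a"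
  assumes lin: "\<And>t. 0 \<le> t \<Longrightarrow> linear (Q t)"
    and bound: "\<And>t x. 0 \<le> t \<Longrightarrow> norm (Q t x) \<le> M0 * norm x"
    and sg: "\<And>s t x. 0 \<le> s \<Longrightarrow> 0 \<le> t \<Longrightarrow> Q (s + t) x = Q s (Q t x)"
    and C: "\<And>t. 0 < t \<Longrightarrow> t \<le> 1 \<Longrightarrow> norm (Q t x - x) \<le> C * t"
  shows "continuous_on {0..} (\<lambda>t. Q t x)"
proof (rule continuous_onI)
  fix s e :: real assume s: "s \<in> {0..}" and e: "0 < e"
  define K where "K = \<bar>M0\<bar> * \<bar>C\<bar> + 1"
  have K: "0 < K" by (simp add: K_def add_nonneg_pos)
  have step: "norm (Q (s + r) x - Q s x) \<le> K * r" if "0 \<le> s" "0 < r" "r \<le> 1" for s r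
  proof -
    have "Q (s + r) x - Q s x = Q s (Q r x - x)"
      using that sg[of s r] lin[OF that(1)] by (simp add: linear_diff)
    also have "norm \<dots> \<le> \<bar>M0\<bar> * norm (Q r x - x)"
      by (rule order_trans[OF bound[OF that(1)]]) (simp add: mult_right_mono)
    also have "\<dots> \<le> \<bar>M0\<bar> * (\<bar>C\<bar> * r)"
      using C[OF that(2,3)] that(2) by (intro mult_left_mono) (auto intro: order_trans mult_right_mono)
    also have "\<dots> \<le> K * r" using that(2) by (simp add: K_def distrib_right)
    finally show ?thesis .
  qed
  show "\<exists>d>0. \<forall>t\<in>{0..}. dist t s < d \<longrightarrow> dist (Q t x) (Q s x) \<le> e"
  proof (intro exI[of _ "min 1 (e / K)"] conjI ballI impI)
    show "0 < min 1 (e / K)" using e K by simp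
    fix t :: real assume t: "t \<in> {0..}" "dist t s < min 1 (e / K)"
    then have ts: "\<bar>t - s\<bar> \<le> 1" "K * \<bar>t - s\<bar> \<le> e"
      using K by (auto simp: dist_real_def field_simps)
    consider "t = s" | "s < t" | "t < s" by linarith
    then show "dist (Q t x) (Q s x) \<le> e"
    proof cases
      case 1 then show ?thesis using e by simp
    next
      case 2 then show ?thesis using step[of s "t - s"] s ts by (simp add: dist_norm)
    next
      case 3 then show ?thesis using step[of t "s - t"] t(1) ts by (simp add: dist_norm norm_minus_commute)
    qed
  qed
qed

section \<open>Integrals over sets\<close>

lemma set_borel_measurable_lebesgueI:
  fixes f :: "'a::euclidean_space \<Rightarrow> 'b::{second_countable_topology, real_normed_vector}"
  assumes "f \<in> borel_measurable borel" "A \<in> sets borel"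
  shows "set_borel_measurable lebesgue A f"
proof -
  have "(\<lambda>x. indicator A x *\<^sub>R f x) \<in> borel_measurable lborel"
    using assms by measurable
  then show ?thesis
    unfolding set_borel_measurable_def by (rule measurable_completion)
qed

lemma borel_measurable_lebesgue_cong_AE:
  fixes f g :: "'a::euclidean_space \<Rightarrow> 'b::topological_space"
  assumes f: "f \<in> borel_measurable lebesgue" and ae: "AE x in lebesgue. f x = g x"
  shows "g \<in> borel_measurable lebesgue"
proof (rule measurableI)
  obtain N where N: "N \<in> null_sets lebesgue" "\<And>x. x \<notin> N \<Longrightarrow> f x = g x"
    using ae unfolding completion.AE_iff_null_sets by auto
  fix S :: "'b set" assume S: "S \<in> sets borel"
  have "f -` S - N \<in> sets lebesgue"
    using measurable_sets[OF f S] N(1) by auto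
  moreover have "g -` S \<inter> N \<in> sets lebesgue"
    using null_sets_completion_subset[OF _ N(1), of "g -` S \<inter> N"] by auto
  moreover have "g -` S \<inter> space lebesgue = (f -` S - N) \<union> (g -` S \<inter> N)"
    using N(2) by auto
  ultimately show "g -` S \<inter> space lebesgue \<in> sets lebesgue"
    by (simp only: sets.Un)
qed simp

lemma set_integral_dominated_convergence:
  fixes f :: "nat \<Rightarrow> 'a \<Rightarrow> 'b::{banach, second_countable_topology}"
  assumes F: "set_borel_measurable M A F" and f: "\<And>i. set_borel_measurable M A (f i)"
    and g: "set_integrable M A (g :: 'a \<Rightarrow> real)"
    and lim: "AE x in M. x \<in> A \<longrightarrow> (\<lambda>i. f i x) \<longlonglongrightarrow> F x"
    and bound: "\<And>i x. x \<in> A \<Longrightarrow> norm (f i x) \<le> g x"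
  shows "set_integrable M A F"
    and "(\<lambda>i. LINT x:A|M. f i x) \<longlonglongrightarrow> (LINT x:A|M. F x)"
proof -
  have lim': "AE x in M. (\<lambda>i. indicator A x *\<^sub>R f i x) \<longlonglongrightarrow> indicator A x *\<^sub>R F x"
    using lim by eventually_elim (auto simp: indicator_def)
  have bd: "AE x in M. norm (indicator A x *\<^sub>R f i x) \<le> indicator A x *\<^sub>R g x" for i
    by (rule AE_I2) (use bound[of _ i] in \<open>auto simp: indicator_def\<close>)
  note dct = F[unfolded set_borel_measurable_def] f[unfolded set_borel_measurable_def]
    g[unfolded set_integrable_def] lim' bd
  show "set_integrable M A F"
    unfolding set_integrable_def by (rule integrable_dominated_convergence[OF dct])
  show "(\<lambda>i. LINT x:A|M. f i x) \<longlonglongrightarrow> (LINT x:A|M. F x)"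
    unfolding set_lebesgue_integral_def by (rule integral_dominated_convergence[OF dct])
qed

text \<open>
  If \<open>f\<close> is not integrable, its integral is \<open>0\<close> by convention, and \<open>g\<close> is nonnegative almost everywhere on
  \<open>A\<close>.
\<close>

lemma norm_set_integral_le:
  fixes f :: "'a \<Rightarrow> 'b::{banach, second_countable_topology}" and g :: "'a \<Rightarrow> real"
  assumes g: "set_integrable M A g" and le: "AE x in M. x \<in> A \<longrightarrow> norm (f x) \<le> g x"
  shows "norm (LINT x:A|M. f x) \<le> (LINT x:A|M. g x)"
proof -
  have le': "AE x in M. norm (indicator A x *\<^sub>R f x) \<le> indicator A x *\<^sub>R g x"
    using le by eventually_elim (auto simp: indicator_def)
  show ?thesis
  proof (cases "set_integrable M A f")
    case True
    have "norm (LINT x:A|M. f x) \<le> (\<integral>x. norm (indicator A x *\<^sub>R f x) \<partial>M)"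
      unfolding set_lebesgue_integral_def by (rule integral_norm_bound)
    also have "\<dots> \<le> (LINT x:A|M. g x)"
      unfolding set_lebesgue_integral_def
      using integrable_norm[OF True[unfolded set_integrable_def]] g[unfolded set_integrable_def] le'
      by (rule integral_mono_AE)
    finally show ?thesis .
  next
    case False
    then have "(LINT x:A|M. f x) = 0"
      by (simp add: set_integrable_def set_lebesgue_integral_def not_integrable_integral_eq)
    moreover have "0 \<le> (LINT x:A|M. g x)"
      unfolding set_lebesgue_integral_def
    proof (rule integral_nonneg_AE)
      show "AE x in M. 0 \<le> indicator A x *\<^sub>R g x"
        using le' by eventually_elim (rule order_trans[OF norm_ge_zero])
    qed
    ultimately show ?thesis by simp
  qed
qed

text \<open>
  A polynomial decay rate for \<open>exp (- x)\<close>; the range \<open>p \<le> 2\<close> lets the quadratic Taylor bound of \<open>exp\<close>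
  suffice.
\<close>

lemma powr_le_exp:
  assumes "0 < x" "0 \<le> p" "p \<le> (2::real)"
  shows "exp (- x) \<le> 3 * x powr (- p)"
proof -
  have "x powr p \<le> 1 + x\<^sup>2"
  proof (cases "x \<le> 1")
    case True
    then have "x powr p \<le> 1 powr p" using assms by (intro powr_mono2) auto
    then show ?thesis by (simp add: add_increasing2)
  next
    case False
    then have "x powr p \<le> x powr 2" using assms by (intro powr_mono) auto
    then show ?thesis using assms by simp
  qed
  also have "\<dots> \<le> 3 * exp x"
    using exp_lower_Taylor_quadratic[of x] zero_le_power2[of x] assms by linarith
  finally show ?thesis
    using assms by (simp add: powr_minus exp_minus field_simps)
qed

lemma set_integral_bounded_linear:
  fixes f :: "'a \<Rightarrow> 'b::{banach, second_countable_topology}"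
    and T :: "'b \<Rightarrow> 'c::{banach, second_countable_topology}"
  assumes T: "bounded_linear T" and f: "set_integrable M A f"
  shows "set_integrable M A (\<lambda>x. T (f x))"
    and "(LINT x:A|M. T (f x)) = T (LINT x:A|M. f x)"
proof -
  have eq: "(\<lambda>x. indicator A x *\<^sub>R T (f x)) = (\<lambda>x. T (indicator A x *\<^sub>R f x))"
    by (simp add: linear_scale bounded_linear.linear[OF T])
  show "set_integrable M A (\<lambda>x. T (f x))"
    using integrable_bounded_linear[OF T f[unfolded set_integrable_def]]
    unfolding set_integrable_def eq .
  show "(LINT x:A|M. T (f x)) = T (LINT x:A|M. f x)"
    using integral_bounded_linear[OF T f[unfolded set_integrable_def]]
    unfolding set_lebesgue_integral_def eq .
qed

section \<open>Integrability of the density \<open>\<zeta>\<^sub>\<alpha>\<close>\<close>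

lemma set_integrable_complex_of_real:
  assumes "set_integrable M A f"
  shows "set_integrable M A (\<lambda>x. complex_of_real (f x))"
  using integrable_of_real[OF assms[unfolded set_integrable_def], where 'a=complex]
  unfolding set_integrable_def by (simp add: scaleR_conv_of_real)

lemma gamma_kernel_integrable:
  assumes "0 < s" "0 < \<delta>"
  shows "set_integrable lebesgue {0<..} (\<lambda>t::real. t powr (s - 1) * exp (- \<delta> * t))"
proof -
  have "set_integrable lebesgue {0<..} (\<lambda>t. norm (complex_of_real t powr (of_real s - 1) / of_real (exp (\<delta> * t))))"
    using absolutely_integrable_Gamma_integral[of "of_real s" \<delta>] assms by (intro set_integrable_norm) auto
  then show ?thesis
    by (rule set_integrable_cong[THEN iffD1, rotated 3])
      (auto simp: norm_divide norm_powr_real_powr exp_minus field_simps)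
qed

lemma gamma_kernel_integral:
  assumes "0 < s"
  shows "(LINT t:{0<..}|lebesgue. complex_of_real (t powr (s - 1) * exp (- t))) = of_real (Gamma s)"
proof -
  have "(LINT t:{0<..}|lebesgue. complex_of_real t powr (of_real s - 1) / of_real (exp t)) = Gamma (of_real s)"
    using absolutely_integrable_Gamma_integral'[of "of_real s"] Gamma_integral_complex'[of "of_real s"] assms
    by (simp add: set_lebesgue_integral_eq_integral(2) integral_unique)
  also have "(LINT t:{0<..}|lebesgue. complex_of_real t powr (of_real s - 1) / of_real (exp t)) =
      (LINT t:{0<..}|lebesgue. complex_of_real (t powr (s - 1) * exp (- t)))"
    by (rule set_lebesgue_integral_cong)
      (auto simp: powr_of_real[symmetric] exp_minus field_simps)
  finally show ?thesis by (simp add: Gamma_complex_of_real)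
qed

lemma Re_ge_near_1: "1 - cmod (1 - w) \<le> Re w"
  using complex_Re_le_cmod[of "1 - w"] by simp

text \<open>
  Euler's integral along a rotated ray, \<open>\<Gamma>(s) w\<^sup>-\<^sup>s = \<integral> t\<^sup>s\<^sup>-\<^sup>1 e\<^sup>-\<^sup>w\<^sup>t dt\<close>.  Expanding \<open>e\<^sup>(\<^sup>1\<^sup>-\<^sup>w\<^sup>)\<^sup>t\<close> in powers of
  \<open>1 - w\<close> produces the binomial series of \<open>w\<^sup>-\<^sup>s\<close>.  The disc \<open>|1 - w| < 1\<close>, in which it converges, meets
  every ray in the open right half plane, so that no contour has to be moved.
\<close>

lemma Gamma_integral_rotated:
  assumes s: "0 < s" and w: "cmod (1 - w) < 1"
  shows "(LINT t:{0<..}|lebesgue. complex_of_real (t powr (s - 1)) * exp (- w * of_real t)) =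
    of_real (Gamma s) * w powr (- of_real s)"
proof -
  define z where "z = 1 - w"
  have z: "cmod z < 1" using w by (simp add: z_def)
  define f where "f N t = (\<Sum>k<N. z ^ k / fact k * of_real (t powr (s + real k - 1) * exp (- t)))" for N and t :: real
  define F where "F t = complex_of_real (t powr (s - 1)) * exp (- w * of_real t)" for t :: real
  define g where "g t = t powr (s - 1) * exp (- (1 - cmod z) * t)" for t :: real
  have f_eq: "f N t = (\<Sum>k<N. (z * of_real t) ^ k /\<^sub>R fact k) * of_real (t powr (s - 1) * exp (- t))"
    if t: "t \<in> {0<..}" for N t
  proof -
    have "t powr (s + real k - 1) = t ^ k * t powr (s - 1)" for k
      using t by (simp add: powr_realpow[symmetric] powr_add[symmetric] algebra_simps)
    then show ?thesis
      unfolding f_def sum_distrib_right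
      by (intro sum.cong) (simp_all add: power_mult_distrib scaleR_conv_of_real field_simps)
  qed
  have lim: "(\<lambda>N. f N t) \<longlonglongrightarrow> F t" if t: "t \<in> {0<..}" for t
  proof -
    have "(\<lambda>N. (\<Sum>k<N. (z * of_real t) ^ k /\<^sub>R fact k) * of_real (t powr (s - 1) * exp (- t)))
        \<longlonglongrightarrow> exp (z * of_real t) * of_real (t powr (s - 1) * exp (- t))"
      using exp_converges[of "z * of_real t"] unfolding sums_def by (intro tendsto_intros)
    also have "exp (z * of_real t) * of_real (t powr (s - 1) * exp (- t)) = F t"
      by (simp add: F_def z_def exp_of_real[symmetric] exp_add[symmetric] algebra_simps)
    finally show ?thesis by (simp only: f_eq[OF t])
  qed
  have bound: "norm (f N t) \<le> g t" if t: "t \<in> {0<..}" for N t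
  proof -
    have "norm (\<Sum>k<N. (z * of_real t) ^ k /\<^sub>R fact k) \<le> (\<Sum>k<N. (cmod z * t) ^ k /\<^sub>R fact k)"
      using t by (intro sum_norm_le) (simp add: norm_power norm_mult)
    also have "\<dots> \<le> exp (cmod z * t)"
      using t unfolding exp_def by (intro sum_le_suminf summable_exp_generic) auto
    finally have "norm (f N t) \<le> exp (cmod z * t) * (t powr (s - 1) * exp (- t))"
      unfolding f_eq[OF t] norm_mult by (intro mult_mono) (auto simp: norm_mult)
    also have "\<dots> = g t" by (simp add: g_def exp_add[symmetric] algebra_simps)
    finally show ?thesis .
  qed
  have int1: "set_integrable lebesgue {0<..} (\<lambda>t. z ^ k / fact k * of_real (t powr (s + real k - 1) * exp (- t)))" for k
    using gamma_kernel_integrable[of "s + real k" 1] s by (intro set_integrable_mult_right set_integrable_complex_of_real) auto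
  have "set_borel_measurable lebesgue {0<..} (f N)" for N
    unfolding f_def by (intro set_borel_measurable_lebesgueI) (auto simp: measurable_lborel1)
  moreover have "set_integrable lebesgue {0<..} g"
    unfolding g_def using gamma_kernel_integrable[of s "1 - cmod z"] s z by simp
  moreover have "set_borel_measurable lebesgue {0<..} F"
    unfolding F_def by (intro set_borel_measurable_lebesgueI) (auto simp: measurable_lborel1)
  ultimately have "(\<lambda>N. LINT t:{0<..}|lebesgue. f N t) \<longlonglongrightarrow> (LINT t:{0<..}|lebesgue. F t)"
    by (intro set_integral_dominated_convergence(2)[OF _ _ _ AE_I2 bound] impI lim)
  moreover have "(LINT t:{0<..}|lebesgue. f N t) = (\<Sum>k<N. of_real (Gamma s) * ((- of_real s gchoose k) * (- z) ^ k))" for N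
  proof -
    have "(LINT t:{0<..}|lebesgue. f N t) =
        (\<Sum>k<N. LINT t:{0<..}|lebesgue. z ^ k / fact k * of_real (t powr (s + real k - 1) * exp (- t)))"
      unfolding f_def set_lebesgue_integral_def scaleR_sum_right
      using int1 by (intro Bochner_Integration.integral_sum) (auto simp: set_integrable_def)
    also have "\<dots> = (\<Sum>k<N. z ^ k / fact k * of_real (Gamma (s + real k)))"
      using s by (simp add: gamma_kernel_integral del: of_real_mult)
    also have "\<dots> = (\<Sum>k<N. of_real (Gamma s) * ((- of_real s gchoose k) * (- z) ^ k))"
    proof (intro sum.cong refl)
      fix k
      have "s \<notin> \<int>\<^sub>\<le>\<^sub>0" using s by (auto elim!: nonpos_Ints_cases)
      then have "Gamma (s + real k) = pochhammer s k * Gamma s"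
        using pochhammer_Gamma[of s k] Gamma_real_pos[OF s] by simp
      then show "z ^ k / fact k * of_real (Gamma (s + real k)) =
          of_real (Gamma s) * ((- of_real s gchoose k) * (- z) ^ k)"
        by (simp add: gbinomial_pochhammer pochhammer_of_real power_minus[of z] field_simps)
    qed
    finally show ?thesis .
  qed
  moreover have "(\<lambda>N. \<Sum>k<N. of_real (Gamma s) * ((- of_real s gchoose k) * (- z) ^ k))
      \<longlonglongrightarrow> of_real (Gamma s) * (1 + (- z)) powr (- of_real s)"
    using gen_binomial_complex[of "- z" "- of_real s"] z
    unfolding sums_def sum_distrib_left[symmetric] by (intro tendsto_intros) auto
  ultimately show ?thesis
    using LIMSEQ_unique by (auto simp: F_def z_def)
qed

text \<open>
  Since \<open>\<alpha> < 1\<close>, the linear term \<open>\<delta> t\<close> dominates \<open>K t\<^sup>\<alpha>\<close> beyond the point \<open>T\<close>.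
\<close>

lemma stretched_exp_integrable:
  assumes "0 < \<alpha>" "\<alpha> < 1" "0 \<le> K" "0 < \<delta>"
  shows "set_integrable lebesgue {0<..} (\<lambda>t::real. exp (K * t powr \<alpha>) * exp (- \<delta> * t))"
proof -
  define T where "T = (2 * K / \<delta>) powr (1 / (1 - \<alpha>))"
  define C where "C = K * T powr \<alpha>"
  have *: "K * t powr \<alpha> \<le> C + \<delta> / 2 * t" if t: "0 < t" for t
  proof (cases "t \<le> T")
    case True
    then have "K * t powr \<alpha> \<le> C"
      unfolding C_def using t assms by (intro mult_left_mono powr_mono2) auto
    moreover have "0 \<le> \<delta> / 2 * t" using t assms by simp
    ultimately show ?thesis by linarith
  next
    case False
    then have "T powr (1 - \<alpha>) \<le> t powr (1 - \<alpha>)"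
      using t assms by (intro powr_mono2) (auto simp: T_def)
    moreover have "T powr (1 - \<alpha>) = 2 * K / \<delta>"
      using assms by (simp add: T_def powr_powr)
    ultimately have "2 * K / \<delta> * t powr \<alpha> \<le> t powr (1 - \<alpha>) * t powr \<alpha>"
      by (intro mult_right_mono) auto
    also have "\<dots> = t" using t by (simp add: powr_add[symmetric])
    finally have "K * t powr \<alpha> \<le> \<delta> / 2 * t" using assms by (simp add: field_simps)
    moreover have "C \<ge> 0" using assms by (simp add: C_def)
    ultimately show ?thesis by linarith
  qed
  have "set_integrable lebesgue {0<..} (\<lambda>t. exp C * (t powr (1 - 1) * exp (- (\<delta> / 2) * t)))"
    using assms by (intro set_integrable_mult_right gamma_kernel_integrable) auto
  then show ?thesis
  proof (rule set_integrable_bound)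
    show "set_borel_measurable lebesgue {0<..} (\<lambda>t. exp (K * t powr \<alpha>) * exp (- \<delta> * t))"
      by (rule set_borel_measurable_lebesgueI) auto
    show "AE t in lebesgue. t \<in> {0<..} \<longrightarrow> norm (exp (K * t powr \<alpha>) * exp (- \<delta> * t))
        \<le> norm (exp C * (t powr (1 - 1) * exp (- (\<delta> / 2) * t)))"
    proof (intro AE_I2 impI)
      fix t :: real assume "t \<in> {0<..}"
      then show "norm (exp (K * t powr \<alpha>) * exp (- \<delta> * t))
          \<le> norm (exp C * (t powr (1 - 1) * exp (- (\<delta> / 2) * t)))"
        using *[of t] by (simp add: exp_add[symmetric] algebra_simps)
    qed
  qed
qed

text \<open>
  The entire function \<open>\<Sum> y\<^sup>n \<Gamma>(n \<alpha> + 1) / n!\<close> as an integral along a ray of free direction: insert Euler's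
  integral for each Gamma factor and sum the exponential series under the integral sign.
\<close>

lemma wright_series_integral:
  assumes \<alpha>: "0 < \<alpha>" "\<alpha> < 1" and w: "cmod (1 - w) < 1"
  shows "(\<lambda>n. y ^ n / fact n * of_real (Gamma (real n * \<alpha> + 1))) sums
    (w * (LINT t:{0<..}|lebesgue. exp (y * w powr of_real \<alpha> * of_real (t powr \<alpha>)) * exp (- w * of_real t)))"
proof -
  define \<delta> where "\<delta> = 1 - cmod (1 - w)"
  have \<delta>: "\<delta> > 0" "\<delta> \<le> Re w" using w Re_ge_near_1 by (auto simp: \<delta>_def)
  have w0: "w \<noteq> 0" using w by auto
  define u where "u = y * w powr of_real \<alpha>"
  define f where "f N t = (\<Sum>n<N. (u * of_real (t powr \<alpha>)) ^ n /\<^sub>R fact n) * exp (- w * of_real t)" for N and t :: real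
  define g where "g t = exp (cmod u * t powr \<alpha>) * exp (- \<delta> * t)" for t :: real
  have ew: "cmod (exp (- w * of_real t)) \<le> exp (- \<delta> * t)" if "0 < t" for t
    using that \<delta>(2) by (simp add: norm_exp_eq_Re mult_right_mono)
  have term_bound: "norm ((u * of_real (t powr \<alpha>)) ^ n /\<^sub>R fact n * exp (- w * of_real t)) \<le> g t" if t: "0 < t" for n t
  proof -
    have "(cmod u * t powr \<alpha>) ^ n /\<^sub>R fact n \<le> exp (cmod u * t powr \<alpha>)"
      using sum_le_suminf[OF summable_exp_generic[of "cmod u * t powr \<alpha>"], of "{n}"] by (simp add: exp_def)
    then show ?thesis
      unfolding g_def norm_mult using ew[OF t] by (intro mult_mono) (auto simp: norm_mult norm_power)
  qed
  have bound: "norm (f N t) \<le> g t" if t: "t \<in> {0<..}" for N t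
  proof -
    have "norm (\<Sum>n<N. (u * of_real (t powr \<alpha>)) ^ n /\<^sub>R fact n) \<le> (\<Sum>n<N. (cmod u * t powr \<alpha>) ^ n /\<^sub>R fact n)"
      using t by (intro sum_norm_le) (simp add: norm_power norm_mult)
    also have "\<dots> \<le> exp (cmod u * t powr \<alpha>)"
      using t unfolding exp_def by (intro sum_le_suminf summable_exp_generic) auto
    finally show ?thesis
      unfolding f_def g_def norm_mult using ew[of t] t by (intro mult_mono) auto
  qed
  have g: "set_integrable lebesgue {0<..} g"
    unfolding g_def using \<alpha> \<delta> by (intro stretched_exp_integrable) auto
  have meas: "set_borel_measurable lebesgue {0<..} (f N)" for N
    unfolding f_def by (intro set_borel_measurable_lebesgueI) (auto simp: measurable_lborel1)
  have lim: "(\<lambda>N. f N t) \<longlonglongrightarrow> exp (u * of_real (t powr \<alpha>)) * exp (- w * of_real t)" for t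
    unfolding f_def using exp_converges[of "u * of_real (t powr \<alpha>)"] unfolding sums_def by (intro tendsto_intros)
  have int1: "set_integrable lebesgue {0<..} (\<lambda>t. (u * of_real (t powr \<alpha>)) ^ n /\<^sub>R fact n * exp (- w * of_real t))" for n
    using g
  proof (rule set_integrable_bound)
    show "set_borel_measurable lebesgue {0<..} (\<lambda>t. (u * of_real (t powr \<alpha>)) ^ n /\<^sub>R fact n * exp (- w * of_real t))"
      by (intro set_borel_measurable_lebesgueI) auto
    show "AE t in lebesgue. t \<in> {0<..} \<longrightarrow>
        norm ((u * of_real (t powr \<alpha>)) ^ n /\<^sub>R fact n * exp (- w * of_real t)) \<le> norm (g t)"
      using term_bound[of _ n] by (intro AE_I2) (auto simp: g_def)
  qed
  have summand: "w * (LINT t:{0<..}|lebesgue. (u * of_real (t powr \<alpha>)) ^ n /\<^sub>R fact n * exp (- w * of_real t))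
      = y ^ n / fact n * of_real (Gamma (real n * \<alpha> + 1))" for n
  proof -
    have "(LINT t:{0<..}|lebesgue. (u * of_real (t powr \<alpha>)) ^ n /\<^sub>R fact n * exp (- w * of_real t)) =
        (LINT t:{0<..}|lebesgue. u ^ n / fact n * (of_real (t powr (real n * \<alpha> + 1 - 1)) * exp (- w * of_real t)))"
      by (rule set_lebesgue_integral_cong)
        (auto simp: power_mult_distrib scaleR_conv_of_real powr_powr powr_realpow[symmetric] mult.commute divide_inverse
          simp flip: of_real_power)
    also have "\<dots> = u ^ n / fact n * (of_real (Gamma (real n * \<alpha> + 1)) * w powr (- of_real (real n * \<alpha> + 1)))"
      using Gamma_integral_rotated[OF _ w, of "real n * \<alpha> + 1"] \<alpha> by (simp add: add_nonneg_pos)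
    also have "u ^ n = y ^ n * w powr (of_real (real n * \<alpha>))"
      using w0 by (simp add: u_def power_mult_distrib powr_def exp_of_nat_mult[symmetric] mult_ac)
    finally have eq: "(LINT t:{0<..}|lebesgue. (u * of_real (t powr \<alpha>)) ^ n /\<^sub>R fact n * exp (- w * of_real t)) =
        y ^ n * w powr of_real (real n * \<alpha>) / fact n *
          (of_real (Gamma (real n * \<alpha> + 1)) * w powr (- of_real (real n * \<alpha> + 1)))" .
    have "w powr of_real (real n * \<alpha>) * w powr (- of_real (real n * \<alpha> + 1)) * w = w powr (of_real (real n * \<alpha>) + - of_real (real n * \<alpha> + 1) + 1)"
      using w0 by (simp only: powr_add) simp
    also have "\<dots> = 1" using w0 by simp
    finally have key: "w powr of_real (real n * \<alpha>) * w powr (- of_real (real n * \<alpha> + 1)) * w = 1" .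
    have "w * (y ^ n * W1 / fact n * (G * W2)) = (W1 * W2 * w) * (y ^ n / fact n * G)" for W1 W2 G :: complex
      by simp
    then show ?thesis unfolding eq by (simp only: key mult_1)
  qed
  have "(\<lambda>N. LINT t:{0<..}|lebesgue. f N t) \<longlonglongrightarrow>
      (LINT t:{0<..}|lebesgue. exp (u * of_real (t powr \<alpha>)) * exp (- w * of_real t))"
    by (intro set_integral_dominated_convergence(2)[OF _ meas g AE_I2 bound] set_borel_measurable_lebesgueI impI lim)
      (auto simp: measurable_lborel1)
  moreover have "(LINT t:{0<..}|lebesgue. f N t) =
      (\<Sum>n<N. LINT t:{0<..}|lebesgue. (u * of_real (t powr \<alpha>)) ^ n /\<^sub>R fact n * exp (- w * of_real t))" for N
    unfolding f_def set_lebesgue_integral_def sum_distrib_right scaleR_sum_right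
    using int1 by (intro Bochner_Integration.integral_sum) (auto simp: set_integrable_def)
  ultimately have "(\<lambda>N. w * (\<Sum>n<N. LINT t:{0<..}|lebesgue. (u * of_real (t powr \<alpha>)) ^ n /\<^sub>R fact n * exp (- w * of_real t)))
      \<longlonglongrightarrow> w * (LINT t:{0<..}|lebesgue. exp (u * of_real (t powr \<alpha>)) * exp (- w * of_real t))"
    by (intro tendsto_intros) simp
  then show ?thesis
    unfolding sums_def sum_distrib_left summand by (simp add: u_def)
qed

lemma Im_of_real_mult_cis: "Im (of_real x * cis y) = x * sin y"
  by simp

text \<open>
  In the variable \<open>\<theta>\<close> the series that defines \<open>\<zeta>\<^sub>\<alpha>\<close> is, up to a factor, the imaginary part of the series
  of \<open>wright_series_integral\<close> at \<open>y = - \<theta> e\<^sup>i\<^sup>\<pi>\<^sup>\<alpha>\<close>; its term of index \<open>0\<close> is real and drops out.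
\<close>

lemma zeta_density_eq:
  assumes \<alpha>: "0 < \<alpha>" and \<theta>: "0 < \<theta>"
    and G: "(\<lambda>n. (- of_real \<theta> * cis (pi * \<alpha>)) ^ n / fact n * of_real (Gamma (real n * \<alpha> + 1))) sums G"
  shows "zeta_density \<alpha> \<theta> = - Im G / (\<alpha> * pi * \<theta>)"
    and "(\<lambda>k. (- \<theta>) ^ Suc k * (Gamma (real (Suc k) * \<alpha> + 1) / fact (Suc k)) * sin (real (Suc k) * pi * \<alpha>)) sums Im G"
proof -
  define b where "b n = Gamma (real n * \<alpha> + 1) / fact n" for n
  have "(- of_real \<theta> * cis (pi * \<alpha>)) ^ n / fact n * of_real (Gamma (real n * \<alpha> + 1)) =
      of_real ((- \<theta>) ^ n * b n) * cis (real n * (pi * \<alpha>))" for n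
    unfolding power_mult_distrib Complex.DeMoivre by (simp add: b_def)
  then have ImH: "Im ((- of_real \<theta> * cis (pi * \<alpha>)) ^ n / fact n * of_real (Gamma (real n * \<alpha> + 1))) =
      (- \<theta>) ^ n * b n * sin (real n * pi * \<alpha>)" for n
    by (simp only: Im_of_real_mult_cis mult.assoc)
  have "(\<lambda>n. (- \<theta>) ^ n * b n * sin (real n * pi * \<alpha>)) sums Im G"
    using sums_Im[OF G] unfolding ImH .
  then have S: "(\<lambda>k. (- \<theta>) ^ Suc k * b (Suc k) * sin (real (Suc k) * pi * \<alpha>)) sums Im G"
    by (subst sums_Suc_iff) simp
  then show "(\<lambda>k. (- \<theta>) ^ Suc k * (Gamma (real (Suc k) * \<alpha> + 1) / fact (Suc k)) * sin (real (Suc k) * pi * \<alpha>)) sums Im G"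
    unfolding b_def .
  have "(\<theta> powr (- 1 / \<alpha>)) powr (- \<alpha> * real (Suc k) - 1) = \<theta> powr (1 / \<alpha>) * \<theta> ^ Suc k" for k
  proof -
    have "- 1 / \<alpha> * (- \<alpha> * real (Suc k) - 1) = 1 / \<alpha> + real (Suc k)"
      using \<alpha> by (simp add: field_simps)
    then show ?thesis
      using \<theta> by (simp only: powr_powr powr_add powr_realpow)
  qed
  then have "(let n = Suc k in (- 1) ^ (n - 1) * (\<theta> powr (- 1 / \<alpha>)) powr (- \<alpha> * real n - 1) *
       (Gamma (real n * \<alpha> + 1) / fact n) * sin (real n * pi * \<alpha>)) =
     - (\<theta> powr (1 / \<alpha>)) * ((- \<theta>) ^ Suc k * b (Suc k) * sin (real (Suc k) * pi * \<alpha>))" for k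
    unfolding Let_def b_def by (simp add: power_minus[of \<theta>] del: of_nat_Suc fact_Suc)
  then have "varpi_density \<alpha> (\<theta> powr (- 1 / \<alpha>)) = (1 / pi) * (- (\<theta> powr (1 / \<alpha>)) * Im G)"
    unfolding varpi_density_def using sums_unique[OF sums_mult[OF S]] by simp
  then have "zeta_density \<alpha> \<theta> =
      1 / \<alpha> * \<theta> powr (- 1 - 1 / \<alpha>) * (1 / pi * (- (\<theta> powr (1 / \<alpha>)) * Im G))"
    unfolding zeta_density_def by simp
  also have "\<dots> = - (\<theta> powr (- 1 - 1 / \<alpha>) * \<theta> powr (1 / \<alpha>)) * Im G / (\<alpha> * pi)"
    by simp
  also have "\<theta> powr (- 1 - 1 / \<alpha>) * \<theta> powr (1 / \<alpha>) = 1 / \<theta>"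
    using \<theta> by (simp add: powr_add[symmetric] powr_minus_divide)
  finally show "zeta_density \<alpha> \<theta> = - Im G / (\<alpha> * pi * \<theta>)" by simp
qed

text \<open>
  The missing real term makes the imaginary part vanish to first order, which cancels the factor
  \<open>1 / \<theta>\<close>.
\<close>

lemma zeta_density_near_0:
  assumes \<alpha>: "0 < \<alpha>" "\<alpha> < 1"
  shows "\<exists>C. \<forall>\<theta>. 0 < \<theta> \<and> \<theta> \<le> 1 \<longrightarrow> \<bar>zeta_density \<alpha> \<theta>\<bar> \<le> C"
proof -
  define b where "b n = Gamma (real n * \<alpha> + 1) / fact n" for n
  have b0: "b n \<ge> 0" for n
    using \<alpha> unfolding b_def by (intro divide_nonneg_nonneg Gamma_real_nonneg) (auto intro: add_nonneg_pos)
  have "summable (\<lambda>n. Re (1 ^ n / fact n * of_real (Gamma (real n * \<alpha> + 1))))"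
    by (rule summable_Re[OF sums_summable[OF wright_series_integral[OF \<alpha>, of 1 1]]]) simp
  moreover have "1 ^ n / fact n * of_real (Gamma (real n * \<alpha> + 1)) = complex_of_real (b n)" for n
    by (simp add: b_def)
  ultimately have "summable b" by simp
  then have sb: "summable (\<lambda>k. b (Suc k))" by (subst summable_Suc_iff)
  have "\<bar>zeta_density \<alpha> \<theta>\<bar> \<le> (\<Sum>k. b (Suc k)) / (\<alpha> * pi)" if \<theta>: "0 < \<theta>" "\<theta> \<le> 1" for \<theta>
  proof -
    obtain G where G: "(\<lambda>n. (- of_real \<theta> * cis (pi * \<alpha>)) ^ n / fact n * of_real (Gamma (real n * \<alpha> + 1))) sums G"
      using wright_series_integral[OF \<alpha>, of 1] by fastforce
    note z = zeta_density_eq[OF \<alpha>(1) \<theta>(1) G]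
    have S: "(\<lambda>k. (- \<theta>) ^ Suc k * b (Suc k) * sin (real (Suc k) * pi * \<alpha>)) sums Im G"
      using z(2) unfolding b_def .
    have le: "norm ((- \<theta>) ^ Suc k * b (Suc k) * sin (real (Suc k) * pi * \<alpha>)) \<le> \<theta> * b (Suc k)" for k
    proof -
      have "\<theta> ^ Suc k * b (Suc k) * \<bar>sin (real (Suc k) * pi * \<alpha>)\<bar> \<le> \<theta> * b (Suc k) * 1"
        using \<theta> b0 power_le_one[of \<theta> k] by (intro mult_mono) (auto simp: mult_left_le)
      then show ?thesis
        using \<theta> b0[of "Suc k"] by (simp add: abs_mult power_abs del: of_nat_Suc power_Suc)
    qed
    have "\<bar>Im G\<bar> \<le> (\<Sum>k. \<theta> * b (Suc k))"
      using norm_suminf_le[OF le summable_mult[OF sb]] sums_unique[OF S] by simp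
    also have "\<dots> = \<theta> * (\<Sum>k. b (Suc k))" using sb by (rule suminf_mult)
    finally have "\<bar>Im G\<bar> \<le> \<theta> * (\<Sum>k. b (Suc k))" .
    then show ?thesis
      using \<theta> \<alpha> unfolding z(1) by (simp add: abs_mult field_simps)
  qed
  then show ?thesis by blast
qed

lemma Re_of_real_mult: "Re (of_real x * z) = x * Re z"
  by simp

text \<open>
  On the real ray the integrand of \<open>wright_series_integral\<close> contains \<open>exp (- \<theta> e\<^sup>i\<^sup>\<pi>\<^sup>\<alpha> t\<^sup>\<alpha>)\<close>, which grows
  because \<open>\<alpha> > 1/2\<close>.  On the ray of direction \<open>e\<^sup>-\<^sup>i\<^sup>\<phi>\<close> the exponent acquires the angle \<open>\<alpha> (\<pi> - \<phi>)\<close>, which is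
  below \<open>\<pi>/2\<close> for a suitable \<open>\<phi> < \<pi>/2\<close> because \<open>\<alpha> < 1\<close>.  Estimating the now decaying exponential by
  \<open>(\<theta> t\<^sup>\<alpha>)\<^sup>-\<^sup>p\<close> keeps the integrand integrable at \<open>t = 0\<close> as long as \<open>p \<alpha> < 1\<close>, and this leaves room for
  some \<open>p > 1\<close>.
\<close>

lemma zeta_density_near_infinity:
  assumes \<alpha>: "1 / 2 < \<alpha>" "\<alpha> < 1"
  shows "\<exists>C p. 1 < p \<and> (\<forall>\<theta>>0. \<bar>zeta_density \<alpha> \<theta>\<bar> \<le> C * \<theta> powr (- p - 1))"
proof -
  have \<alpha>0: "0 < \<alpha>" using \<alpha> by simp
  \<comment> \<open>halfway between the smallest angle that makes \<open>\<alpha> (\<pi> - \<phi>) \<le> \<pi> / 2\<close> and \<open>\<pi> / 2\<close>\<close>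
  define \<phi> where "\<phi> = pi * (3 * \<alpha> - 1) / (4 * \<alpha>)"
  have \<phi>: "0 < \<phi>" "\<phi> < pi / 2"
    using \<alpha> by (auto simp: \<phi>_def field_simps)
  have turned: "\<alpha> * (pi - \<phi>) = pi * (\<alpha> + 1) / 4"
    using \<alpha>0 by (simp add: \<phi>_def field_simps)
  \<comment> \<open>the factor \<open>cos \<phi>\<close> brings the point of the ray closest to \<open>1\<close>, at distance \<open>sin \<phi>\<close>\<close>
  define w where "w = of_real (cos \<phi>) * cis (- \<phi>)"
  have cos0: "0 < cos \<phi>" using \<phi> by (intro cos_gt_zero_pi) auto
  have sin1: "0 < sin \<phi>" "sin \<phi> < 1"
    using \<phi> sin_gt_zero2[of \<phi>] sin_monotone_2pi[of \<phi> "pi/2"] by auto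
  have "1 - w = of_real (sin \<phi>) * Complex (sin \<phi>) (cos \<phi>)"
    by (simp add: w_def complex_eq_iff sin_cos_squared_add power2_eq_square)
      (metis add_diff_cancel_left' power2_eq_square sin_cos_squared_add2)
  then have w: "cmod (1 - w) < 1"
    using sin1 by (simp only: norm_mult) (simp add: cmod_def)
  have w0: "w \<noteq> 0" using w by auto
  define \<delta> where "\<delta> = 1 - cmod (1 - w)"
  have \<delta>: "\<delta> > 0" "\<delta> \<le> Re w" using w Re_ge_near_1 by (auto simp: \<delta>_def)
  have "w = exp (Complex (ln (cos \<phi>)) (- \<phi>))"
    using cos0 by (simp add: w_def exp_eq_polar)
  then have "Ln w = Complex (ln (cos \<phi>)) (- \<phi>)"
    using \<phi> by (simp add: Ln_exp)
  then have wa: "cis (pi * \<alpha>) * w powr of_real \<alpha> = exp (Complex (\<alpha> * ln (cos \<phi>)) (\<alpha> * (pi - \<phi>)))"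
  proof -
    have "\<i> * of_real (pi * \<alpha>) + of_real \<alpha> * Complex (ln (cos \<phi>)) (- \<phi>) =
        Complex (\<alpha> * ln (cos \<phi>)) (\<alpha> * (pi - \<phi>))"
      by (simp add: complex_eq_iff algebra_simps)
    with \<open>Ln w = _\<close> w0 show ?thesis
      by (simp only: powr_def cis_conv_exp exp_add[symmetric] if_False)
  qed
  define c where "c = exp (\<alpha> * ln (cos \<phi>)) * cos (\<alpha> * (pi - \<phi>))"
  have c_Re: "c = Re (cis (pi * \<alpha>) * w powr of_real \<alpha>)"
    unfolding wa c_def by (simp add: Re_exp)
  have "0 < cos (\<alpha> * (pi - \<phi>))"
  proof -
    have "0 < pi * (\<alpha> + 1) / 4" "pi * (\<alpha> + 1) / 4 < pi / 2" using \<alpha> by simp_all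
    then show ?thesis unfolding turned using pi_gt_zero by (intro cos_gt_zero_pi) linarith+
  qed
  then have c: "0 < c" by (simp add: c_def)
  \<comment> \<open>halfway between \<open>1\<close> and \<open>1 / \<alpha>\<close>, the bounds imposed at infinity and at \<open>0\<close>\<close>
  define p where "p = (1 + 1 / \<alpha>) / 2"
  have p: "1 < p" "p \<le> 2" "p * \<alpha> < 1"
    using \<alpha> by (auto simp: p_def field_simps)
  define I where "I = (LINT t:{0<..}|lebesgue. t powr (1 - p * \<alpha> - 1) * exp (- \<delta> * t))"
  define C where "C = cmod w * (3 * c powr (- p) * I) / (\<alpha> * pi)"
  have "\<bar>zeta_density \<alpha> \<theta>\<bar> \<le> C * \<theta> powr (- p - 1)" if \<theta>: "\<theta> > 0" for \<theta>
  proof -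
    define F where "F t = exp (- of_real \<theta> * cis (pi * \<alpha>) * w powr of_real \<alpha> * of_real (t powr \<alpha>)) *
        exp (- w * of_real t)" for t :: real
    define G where "G = w * (LINT t:{0<..}|lebesgue. F t)"
    have G: "(\<lambda>n. (- of_real \<theta> * cis (pi * \<alpha>)) ^ n / fact n * of_real (Gamma (real n * \<alpha> + 1))) sums G"
      unfolding G_def F_def by (rule wright_series_integral[OF \<alpha>0 \<alpha>(2) w])
    have Fle: "norm (F t) \<le> 3 * (\<theta> * c) powr (- p) * (t powr (1 - p * \<alpha> - 1) * exp (- \<delta> * t))"
      if t: "t \<in> {0<..}" for t
    proof -
      have t0: "0 < t" using t by simp
      have Re: "Re (- of_real \<theta> * cis (pi * \<alpha>) * w powr of_real \<alpha> * of_real (t powr \<alpha>)) = - (\<theta> * c * t powr \<alpha>)"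
      proof -
        have "- of_real \<theta> * cis (pi * \<alpha>) * w powr of_real \<alpha> * of_real (t powr \<alpha>) =
            of_real (- \<theta> * t powr \<alpha>) * (cis (pi * \<alpha>) * w powr of_real \<alpha>)"
          by (simp add: mult_ac)
        then show ?thesis unfolding c_Re by (simp only: Re_of_real_mult) (simp add: mult_ac)
      qed
      have "norm (F t) = exp (- (\<theta> * c * t powr \<alpha>)) * exp (- Re w * t)"
        unfolding F_def norm_mult norm_exp_eq_Re Re by simp
      also have "\<dots> \<le> (3 * (\<theta> * c * t powr \<alpha>) powr (- p)) * exp (- \<delta> * t)"
        using \<theta> c t0 p \<delta> by (intro mult_mono powr_le_exp) (auto intro: mult_right_mono)
      also have "(\<theta> * c * t powr \<alpha>) powr (- p) = (\<theta> * c) powr (- p) * t powr (1 - p * \<alpha> - 1)"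
        using \<theta> c t0 by (simp add: powr_mult powr_powr mult.commute)
      finally show ?thesis by (simp only: mult.assoc)
    qed
    have "set_integrable lebesgue {0<..} (\<lambda>t. t powr (1 - p * \<alpha> - 1) * exp (- \<delta> * t))"
      using p \<delta> by (intro gamma_kernel_integrable) auto
    then have "norm (LINT t:{0<..}|lebesgue. F t) \<le>
        (LINT t:{0<..}|lebesgue. 3 * (\<theta> * c) powr (- p) * (t powr (1 - p * \<alpha> - 1) * exp (- \<delta> * t)))"
      by (intro norm_set_integral_le AE_I2 impI Fle set_integrable_mult_right)
    also have "\<dots> = 3 * (\<theta> * c) powr (- p) * I"
      unfolding I_def by (rule set_integral_mult_right)
    finally have "cmod G \<le> cmod w * (3 * (\<theta> * c) powr (- p) * I)"
      unfolding G_def norm_mult by (intro mult_left_mono) auto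
    then have "\<bar>Im G\<bar> \<le> cmod w * (3 * (\<theta> * c) powr (- p) * I)"
      using abs_Im_le_cmod[of G] by linarith
    also have "\<dots> = (cmod w * (3 * c powr (- p) * I)) * \<theta> powr (- p)"
      using \<theta> c by (simp add: powr_mult mult_ac)
    finally have "\<bar>Im G\<bar> / (\<alpha> * pi * \<theta>) \<le> (cmod w * (3 * c powr (- p) * I)) * \<theta> powr (- p) / (\<alpha> * pi * \<theta>)"
      using \<theta> \<alpha>0 by (intro divide_right_mono) auto
    also have "\<dots> = C * (\<theta> powr (- p) / \<theta>)" by (simp add: C_def)
    also have "\<theta> powr (- p) / \<theta> = \<theta> powr (- p - 1)" using \<theta> by (simp add: powr_diff)
    finally show ?thesis
      unfolding zeta_density_eq(1)[OF \<alpha>0 \<theta> G] using \<theta> \<alpha>0 by (simp add: abs_mult)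
  qed
  with p(1) show ?thesis by blast
qed

lemma zeta_density_measurable: "zeta_density \<alpha> \<in> borel_measurable borel"
  unfolding zeta_density_def[abs_def] varpi_density_def Let_def by measurable

text \<open>
  Boundedness on \<open>(0, 1]\<close> and decay like \<open>\<theta>\<^sup>-\<^sup>p\<^sup>-\<^sup>1\<close> with \<open>p > 1\<close> beyond; the second integrand loses one power
  and still decays like \<open>\<theta>\<^sup>-\<^sup>p\<close>.
\<close>

theorem zeta_density_integrable:
  assumes \<alpha>: "1 / 2 < \<alpha>" "\<alpha> < 1"
  shows "set_integrable lebesgue {0<..} (zeta_density \<alpha>)"
    and "set_integrable lebesgue {0<..} (\<lambda>\<theta>. \<theta> * zeta_density \<alpha> \<theta>)"
proof -
  obtain C1 where C1: "\<And>\<theta>. 0 < \<theta> \<Longrightarrow> \<theta> \<le> 1 \<Longrightarrow> \<bar>zeta_density \<alpha> \<theta>\<bar> \<le> C1"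
    using zeta_density_near_0[of \<alpha>] \<alpha> by auto
  obtain C2 p where p: "1 < p" and C2: "\<And>\<theta>. 0 < \<theta> \<Longrightarrow> \<bar>zeta_density \<alpha> \<theta>\<bar> \<le> C2 * \<theta> powr (- p - 1)"
    using zeta_density_near_infinity[OF \<alpha>] by blast
  have C20: "C2 \<ge> 0" using C2[of 1] by simp
  have C10: "C1 \<ge> 0" using C1[of 1] by simp
  have near: "set_integrable lebesgue {0<..1} (\<lambda>\<theta>::real. C1)"
    unfolding set_integrable_def by (simp add: integrable_completion)
  have "(\<lambda>\<theta>. \<theta> powr (- p)) integrable_on {1..}"
    using p has_integral_powr_to_inf[where e="- p" and a=1] by (auto simp: integrable_on_def)
  then have "set_integrable lebesgue {1..} (\<lambda>\<theta>. \<theta> powr (- p))"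
    by (intro nonnegative_absolutely_integrable_1) auto
  then have far: "set_integrable lebesgue {1<..} (\<lambda>\<theta>. C2 * \<theta> powr (- p))"
    by (intro set_integrable_mult_right) (rule set_integrable_subset, auto)
  have split: "{0::real<..} = {0<..1} \<union> {1<..}" by auto
  have *: "set_integrable lebesgue {0<..} f"
    if f: "f \<in> borel_measurable borel" "\<And>\<theta>. 0 < \<theta> \<Longrightarrow> \<theta> \<le> 1 \<Longrightarrow> \<bar>f \<theta>\<bar> \<le> C1"
      "\<And>\<theta>. 1 < \<theta> \<Longrightarrow> \<bar>f \<theta>\<bar> \<le> C2 * \<theta> powr (- p)" for f :: "real \<Rightarrow> real"
    unfolding split
  proof (rule set_integrable_Un)
    show "set_integrable lebesgue {0<..1} f"
      using near by (rule set_integrable_bound)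
        (use f C10 in \<open>auto intro!: set_borel_measurable_lebesgueI AE_I2 intro: order_trans\<close>)
    show "set_integrable lebesgue {1<..} f"
      using far by (rule set_integrable_bound)
        (use f C20 in \<open>auto intro!: set_borel_measurable_lebesgueI AE_I2\<close>)
  qed auto
  show "set_integrable lebesgue {0<..} (zeta_density \<alpha>)"
  proof (rule *)
    fix \<theta> :: real assume \<theta>: "1 < \<theta>"
    have "\<theta> powr (- p - 1) \<le> \<theta> powr (- p)" using \<theta> by (intro powr_mono) auto
    then show "\<bar>zeta_density \<alpha> \<theta>\<bar> \<le> C2 * \<theta> powr (- p)"
      using C2[of \<theta>] \<theta> C20 by (meson less_trans mult_left_mono order_trans zero_less_one)
  qed (use zeta_density_measurable C1 in auto)
  show "set_integrable lebesgue {0<..} (\<lambda>\<theta>. \<theta> * zeta_density \<alpha> \<theta>)"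
  proof (rule *)
    show "(\<lambda>\<theta>. \<theta> * zeta_density \<alpha> \<theta>) \<in> borel_measurable borel"
      using zeta_density_measurable by measurable
  next
    fix \<theta> :: real assume \<theta>: "0 < \<theta>" "\<theta> \<le> 1"
    have "\<theta> * \<bar>zeta_density \<alpha> \<theta>\<bar> \<le> 1 * C1" using \<theta> C1[OF \<theta>] by (intro mult_mono) auto
    then show "\<bar>\<theta> * zeta_density \<alpha> \<theta>\<bar> \<le> C1" using \<theta> by (simp add: abs_mult)
  next
    fix \<theta> :: real assume \<theta>: "1 < \<theta>"
    have "\<theta> * \<bar>zeta_density \<alpha> \<theta>\<bar> \<le> \<theta> * (C2 * \<theta> powr (- p - 1))"
      using \<theta> C2[of \<theta>] by (intro mult_left_mono) auto
    also have "\<dots> = C2 * \<theta> powr (- p)" using \<theta> by (simp add: powr_diff)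
    finally show "\<bar>\<theta> * zeta_density \<alpha> \<theta>\<bar> \<le> C2 * \<theta> powr (- p)" using \<theta> by (simp add: abs_mult)
  qed
qed

section \<open>Joint continuity of subordinated families\<close>

lemma jointly_continuous_bounded_family:
  fixes Q :: "real \<Rightarrow> 'a::real_normed_vector \<Rightarrow> 'b::real_normed_vector"
  assumes lin: "\<And>t. t \<in> S \<Longrightarrow> linear (Q t)"
    and bound: "\<And>t x. t \<in> S \<Longrightarrow> norm (Q t x) \<le> M0 * norm x"
    and strong: "\<And>x. continuous_on S (\<lambda>t. Q t x)"
  shows "continuous_on (S \<times> UNIV) (\<lambda>(t, x). Q t x)"
  unfolding continuous_on_sequentially
proof (intro allI ballI impI, elim conjE)
  fix z :: "nat \<Rightarrow> real \<times> 'a" and l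
  assume l: "l \<in> S \<times> UNIV" and z: "\<forall>n. z n \<in> S \<times> UNIV" "z \<longlonglongrightarrow> l"
  define t x where "t n = fst (z n)" and "x n = snd (z n)" for n
  have t: "t n \<in> S" for n using z(1) by (auto simp: t_def mem_Times_iff)
  have lims: "t \<longlonglongrightarrow> fst l" "x \<longlonglongrightarrow> snd l"
    using tendsto_fst[OF z(2)] tendsto_snd[OF z(2)] by (simp_all add: t_def[abs_def] x_def[abs_def])
  have "(\<lambda>n. Q (t n) (snd l)) \<longlonglongrightarrow> Q (fst l) (snd l)"
    using strong[of "snd l"] t lims(1) l unfolding continuous_on_sequentially
    by (auto simp: o_def mem_Times_iff)
  moreover have "(\<lambda>n. Q (t n) (x n - snd l)) \<longlonglongrightarrow> 0"
  proof (rule Lim_null_comparison)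
    show "\<forall>\<^sub>F n in sequentially. norm (Q (t n) (x n - snd l)) \<le> M0 * norm (x n - snd l)"
      using bound t by simp
    have "(\<lambda>n. M0 * norm (x n - snd l)) \<longlonglongrightarrow> M0 * norm (snd l - snd l)"
      using lims(2) by (intro tendsto_intros)
    then show "(\<lambda>n. M0 * norm (x n - snd l)) \<longlonglongrightarrow> 0" by simp
  qed
  ultimately have "(\<lambda>n. Q (t n) (snd l) + Q (t n) (x n - snd l)) \<longlonglongrightarrow> Q (fst l) (snd l) + 0"
    by (rule tendsto_add)
  moreover have "Q (t n) (snd l) + Q (t n) (x n - snd l) = Q (t n) (x n)" for n
    using lin[OF t] by (simp add: linear_diff)
  ultimately show "((\<lambda>(t, x). Q t x) \<circ> z) \<longlonglongrightarrow> (case l of (t, x) \<Rightarrow> Q t x)"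
    by (simp add: o_def case_prod_beta t_def x_def)
qed

text \<open>
  Both \<open>S\<^sub>\<alpha>\<close> and \<open>T\<^sub>\<alpha>\<close> are of this form, with \<open>k(\<theta>) = \<zeta>\<^sub>\<alpha>(\<theta>)\<close> and \<open>k(\<theta>) = \<theta> \<zeta>\<^sub>\<alpha>(\<theta>)\<close>.  The integrand is
  dominated by a multiple of \<open>|k|\<close>, locally uniformly in \<open>y\<close> and uniformly in \<open>t\<close>.
\<close>

lemma subordinated_family:
  fixes Q :: "real \<Rightarrow> 'y::{banach, second_countable_topology} \<Rightarrow> 'y"
    and \<Lambda> :: "'y \<Rightarrow> 'x::{banach, second_countable_topology}"
  assumes \<alpha>: "0 < \<alpha>"
    and \<Lambda>: "bounded_linear \<Lambda>"
    and Q: "\<And>t. 0 \<le> t \<Longrightarrow> linear (Q t)" "\<And>t x. 0 \<le> t \<Longrightarrow> norm (Q t x) \<le> M0 * norm x"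
      "\<And>x. continuous_on {0..} (\<lambda>t. Q t x)"
    and k: "k \<in> borel_measurable borel" "set_integrable lebesgue {0<..} k"
  defines "U \<equiv> (\<lambda>t y. LINT \<theta>:{0<..}|lebesgue. \<Lambda> (k \<theta> *\<^sub>R Q (t powr \<alpha> * \<theta>) y))"
  shows "continuous_on ({0..} \<times> UNIV) (\<lambda>(t, y). U t y)"
    and "\<exists>C\<ge>0. \<forall>t\<ge>0. \<forall>y. norm (U t y) \<le> C * norm y"
proof -
  define \<Lambda>0 where "\<Lambda>0 = onorm \<Lambda>"
  have \<Lambda>0: "\<Lambda>0 \<ge> 0" "\<And>y. norm (\<Lambda> y) \<le> \<Lambda>0 * norm y"
    using onorm_pos_le[OF \<Lambda>] onorm[OF \<Lambda>] by (auto simp: \<Lambda>0_def)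
  define f where "f t y \<theta> = \<Lambda> (k \<theta> *\<^sub>R Q (t powr \<alpha> * \<theta>) y)" for t y \<theta>
  have Qc: "continuous_on ({0..} \<times> UNIV) (\<lambda>(t, x). Q t x)"
    by (rule jointly_continuous_bounded_family[OF Q]) auto
  have f_le: "norm (f t y \<theta>) \<le> (\<Lambda>0 * M0 * norm y) * \<bar>k \<theta>\<bar>" if "\<theta> \<in> {0<..}" for t y \<theta>
  proof -
    have "norm (f t y \<theta>) \<le> \<Lambda>0 * (\<bar>k \<theta>\<bar> * norm (Q (t powr \<alpha> * \<theta>) y))"
      unfolding f_def by (rule order_trans[OF \<Lambda>0(2)]) simp
    also have "\<dots> \<le> \<Lambda>0 * (\<bar>k \<theta>\<bar> * (M0 * norm y))"
      using that \<Lambda>0(1) by (intro mult_left_mono Q(2)) auto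
    finally show ?thesis by (simp only: mult_ac)
  qed
  have kint: "set_integrable lebesgue {0<..} (\<lambda>\<theta>. K * \<bar>k \<theta>\<bar>)" for K
    using set_integrable_norm[OF k(2)] by (intro set_integrable_mult_right) simp
  have f_meas: "set_borel_measurable lebesgue {0<..} (f t y)" for t y
  proof -
    have "continuous_on UNIV (\<lambda>\<theta>. Q (max 0 (t powr \<alpha> * \<theta>)) y)"
      by (rule continuous_on_compose2[OF Q(3)]) (auto intro!: continuous_intros)
    then have "(\<lambda>\<theta>. \<Lambda> (k \<theta> *\<^sub>R Q (max 0 (t powr \<alpha> * \<theta>)) y)) \<in> borel_measurable borel"
      using k(1) by (intro measurable_compose[OF _ borel_measurable_continuous_onI[OF linear_continuous_on[OF \<Lambda>]]]
          borel_measurable_scaleR[OF _ borel_measurable_continuous_onI])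
    then have "set_borel_measurable lebesgue {0<..} (\<lambda>\<theta>. \<Lambda> (k \<theta> *\<^sub>R Q (max 0 (t powr \<alpha> * \<theta>)) y))"
      by (rule set_borel_measurable_lebesgueI) simp
    moreover have "indicator {0<..} \<theta> *\<^sub>R f t y \<theta> =
        indicator {0<..} \<theta> *\<^sub>R \<Lambda> (k \<theta> *\<^sub>R Q (max 0 (t powr \<alpha> * \<theta>)) y)" for \<theta>
      by (auto simp: indicator_def f_def max_def mult_less_0_iff not_le split: if_splits)
    ultimately show ?thesis unfolding set_borel_measurable_def by (simp only:)
  qed
  show "\<exists>C\<ge>0. \<forall>t\<ge>0. \<forall>y. norm (U t y) \<le> C * norm y"
  proof (intro exI[of _ "\<Lambda>0 * \<bar>M0\<bar> * (LINT \<theta>:{0<..}|lebesgue. \<bar>k \<theta>\<bar>)"] conjI allI impI)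
    have I0: "0 \<le> (LINT \<theta>:{0<..}|lebesgue. \<bar>k \<theta>\<bar>)"
      unfolding set_lebesgue_integral_def by (intro Bochner_Integration.integral_nonneg) auto
    then show "0 \<le> \<Lambda>0 * \<bar>M0\<bar> * (LINT \<theta>:{0<..}|lebesgue. \<bar>k \<theta>\<bar>)"
      using \<Lambda>0(1) by simp
    fix t :: real and y
    have "norm (U t y) \<le> (LINT \<theta>:{0<..}|lebesgue. (\<Lambda>0 * M0 * norm y) * \<bar>k \<theta>\<bar>)"
      unfolding U_def f_def[symmetric] by (intro norm_set_integral_le kint AE_I2 impI f_le)
    also have "\<dots> = \<Lambda>0 * M0 * norm y * (LINT \<theta>:{0<..}|lebesgue. \<bar>k \<theta>\<bar>)"
      by (rule set_integral_mult_right)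
    also have "\<dots> \<le> \<Lambda>0 * \<bar>M0\<bar> * norm y * (LINT \<theta>:{0<..}|lebesgue. \<bar>k \<theta>\<bar>)"
      using I0 \<Lambda>0(1) by (intro mult_right_mono mult_left_mono) auto
    finally show "norm (U t y) \<le> \<Lambda>0 * \<bar>M0\<bar> * (LINT \<theta>:{0<..}|lebesgue. \<bar>k \<theta>\<bar>) * norm y"
      by (simp only: mult_ac)
  qed
  show "continuous_on ({0..} \<times> UNIV) (\<lambda>(t, y). U t y)"
    unfolding continuous_on_sequentially
  proof (intro allI ballI impI, elim conjE)
    fix z :: "nat \<Rightarrow> real \<times> 'y" and l
    assume l: "l \<in> {0..} \<times> UNIV" and z: "\<forall>n. z n \<in> {0..} \<times> UNIV" "z \<longlonglongrightarrow> l"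
    define t y where "t n = fst (z n)" and "y n = snd (z n)" for n
    have t: "0 \<le> t n" for n using z(1) by (auto simp: t_def mem_Times_iff)
    have lims: "t \<longlonglongrightarrow> fst l" "y \<longlonglongrightarrow> snd l"
      using tendsto_fst[OF z(2)] tendsto_snd[OF z(2)] by (simp_all add: t_def[abs_def] y_def[abs_def])
    obtain Y where Y: "\<And>n. norm (y n) \<le> Y"
      using lims(2) by (metis convergent_imp_Bseq convergentI BseqE)
    have "(\<lambda>n. LINT \<theta>:{0<..}|lebesgue. f (t n) (y n) \<theta>) \<longlonglongrightarrow> (LINT \<theta>:{0<..}|lebesgue. f (fst l) (snd l) \<theta>)"
    proof (rule set_integral_dominated_convergence(2)[where g="\<lambda>\<theta>. (\<Lambda>0 * \<bar>M0\<bar> * Y) * \<bar>k \<theta>\<bar>"])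
      show "AE \<theta> in lebesgue. \<theta> \<in> {0<..} \<longrightarrow> (\<lambda>n. f (t n) (y n) \<theta>) \<longlonglongrightarrow> f (fst l) (snd l) \<theta>"
      proof (intro AE_I2 impI)
        fix \<theta> :: real assume \<theta>: "\<theta> \<in> {0<..}"
        have "(\<lambda>n. t n powr \<alpha>) \<longlonglongrightarrow> fst l powr \<alpha>"
          by (intro tendsto_powr2 lims tendsto_const \<alpha>) (simp add: t)
        then have "(\<lambda>n. (t n powr \<alpha> * \<theta>, y n)) \<longlonglongrightarrow> (fst l powr \<alpha> * \<theta>, snd l)"
          by (rule tendsto_Pair[OF tendsto_mult_right lims(2)])
        then have "(\<lambda>n. Q (t n powr \<alpha> * \<theta>) (y n)) \<longlonglongrightarrow> Q (fst l powr \<alpha> * \<theta>) (snd l)"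
          using Qc[unfolded continuous_on_sequentially, rule_format,
              of "(fst l powr \<alpha> * \<theta>, snd l)" "\<lambda>n. (t n powr \<alpha> * \<theta>, y n)"] \<theta>
          by (simp add: o_def)
        then show "(\<lambda>n. f (t n) (y n) \<theta>) \<longlonglongrightarrow> f (fst l) (snd l) \<theta>"
          unfolding f_def by (intro bounded_linear.tendsto[OF \<Lambda>] tendsto_intros)
      qed
      fix n and \<theta> :: real assume \<theta>: "\<theta> \<in> {0<..}"
      have "(\<Lambda>0 * M0 * norm (y n)) * \<bar>k \<theta>\<bar> \<le> (\<Lambda>0 * \<bar>M0\<bar> * Y) * \<bar>k \<theta>\<bar>"
      proof -
        have le: "\<Lambda>0 * M0 \<le> \<Lambda>0 * \<bar>M0\<bar>" using \<Lambda>0(1) by (intro mult_left_mono) auto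
        then show ?thesis
          using \<Lambda>0(1) by (intro mult_right_mono mult_mono[OF le Y]) auto
      qed
      then show "norm (f (t n) (y n) \<theta>) \<le> (\<Lambda>0 * \<bar>M0\<bar> * Y) * \<bar>k \<theta>\<bar>"
        using f_le[OF \<theta>, of "t n" "y n"] by linarith
    qed (use f_meas kint in auto)
    then show "((\<lambda>(t, y). U t y) \<circ> z) \<longlonglongrightarrow> (case l of (t, y) \<Rightarrow> U t y)"
      by (simp add: o_def case_prod_beta t_def y_def U_def f_def)
  qed
qed

section \<open>Nonlinear Volterra equations with a weakly singular kernel\<close>

lemma powr_kernel_integral:
  fixes \<alpha> \<tau> p r :: real
  assumes "0 < \<alpha>" "p \<le> r" "r \<le> \<tau>"
  shows "set_integrable lebesgue {p..r} (\<lambda>s. (\<tau> - s) powr (\<alpha> - 1))"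
    and "(LINT s:{p..r}|lebesgue. (\<tau> - s) powr (\<alpha> - 1)) = ((\<tau> - p) powr \<alpha> - (\<tau> - r) powr \<alpha>) / \<alpha>"
proof -
  have "((\<lambda>s. (\<tau> - s) powr (\<alpha> - 1)) has_integral
      (- ((\<tau> - r) powr \<alpha> / \<alpha>) - (- ((\<tau> - p) powr \<alpha> / \<alpha>)))) {p..r}"
  proof (rule fundamental_theorem_of_calculus_interior)
    show "continuous_on {p..r} (\<lambda>s. - ((\<tau> - s) powr \<alpha> / \<alpha>))"
      using assms by (intro continuous_intros continuous_on_powr') auto
    fix s assume "s \<in> {p<..<r}"
    then have "((\<lambda>s. - ((\<tau> - s) powr \<alpha> / \<alpha>)) has_real_derivative (\<tau> - s) powr (\<alpha> - 1)) (at s)"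
      using assms by (auto intro!: derivative_eq_intros simp: powr_diff field_simps)
    then show "((\<lambda>s. - ((\<tau> - s) powr \<alpha> / \<alpha>)) has_vector_derivative (\<tau> - s) powr (\<alpha> - 1)) (at s)"
      by (simp add: has_real_derivative_iff_has_vector_derivative)
  qed (use assms in auto)
  then have hi: "((\<lambda>s. (\<tau> - s) powr (\<alpha> - 1)) has_integral
      ((\<tau> - p) powr \<alpha> - (\<tau> - r) powr \<alpha>) / \<alpha>) {p..r}"
    by (simp add: diff_divide_distrib)
  show *: "set_integrable lebesgue {p..r} (\<lambda>s. (\<tau> - s) powr (\<alpha> - 1))"
    using hi by (intro nonnegative_absolutely_integrable_1) (auto simp: integrable_on_def)
  show "(LINT s:{p..r}|lebesgue. (\<tau> - s) powr (\<alpha> - 1)) = ((\<tau> - p) powr \<alpha> - (\<tau> - r) powr \<alpha>) / \<alpha>"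
    using set_lebesgue_integral_eq_integral(2)[OF *] integral_unique[OF hi] by simp
qed

text \<open>
  Replacing \<open>u s\<close> by \<open>u\<close> at the grid point \<open>\<lfloor>n s\<rfloor> / n\<close> leaves countably many measurable pieces; these
  functions converge almost everywhere because \<open>G s\<close> is continuous for almost every \<open>s\<close>.
\<close>

lemma caratheodory_measurable:
  fixes G :: "real \<Rightarrow> 'y::{banach, second_countable_topology} \<Rightarrow> 'y"
  assumes meas: "\<And>y. set_borel_measurable lebesgue {0..a} (\<lambda>s. G s y)"
    and cont: "AE s in lebesgue. s \<in> {0..a} \<longrightarrow> continuous_on UNIV (G s)"
    and u: "continuous_on {0..a} u"
  shows "set_borel_measurable lebesgue {0..a} (\<lambda>s. G s (u s))"
proof -
  define r where "r n s = max 0 (min a (real_of_int \<lfloor>real (Suc n) * s\<rfloor> / real (Suc n)))" for n and s :: real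
  define f where "f n s = indicator {0..a} s *\<^sub>R G s (u (r n s))" for n s
  have f: "f n \<in> borel_measurable lebesgue" for n
  proof -
    define \<Phi> where "\<Phi> i s = indicator {0..a} s *\<^sub>R G s (u (max 0 (min a (real_of_int i / real (Suc n)))))" for i s
    have "\<Phi> i \<in> borel_measurable lebesgue" for i
      unfolding \<Phi>_def[abs_def] by (rule meas[unfolded set_borel_measurable_def])
    moreover have "(\<lambda>s. \<lfloor>real (Suc n) * s\<rfloor>) \<in> lebesgue \<rightarrow>\<^sub>M count_space UNIV"
      by (rule measurable_completion) measurable
    ultimately have "(\<lambda>s. \<Phi> \<lfloor>real (Suc n) * s\<rfloor> s) \<in> borel_measurable lebesgue"
      by (rule measurable_compose_countable)
    then show ?thesis by (simp add: f_def[abs_def] r_def \<Phi>_def del: of_nat_Suc)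
  qed
  have r: "(\<lambda>n. r n s) \<longlonglongrightarrow> s" "r n s \<in> {0..a}" if s: "s \<in> {0..a}" for s n
  proof -
    have "(\<lambda>n. real_of_int \<lfloor>real (Suc n) * s\<rfloor> / real (Suc n)) \<longlonglongrightarrow> s"
    proof (rule LIM_zero_cancel)
      have "\<bar>real_of_int \<lfloor>real (Suc n) * s\<rfloor> / real (Suc n) - s\<bar> \<le> inverse (real (Suc n))" for n
      proof -
        have "\<bar>real_of_int \<lfloor>real (Suc n) * s\<rfloor> / real (Suc n) - s\<bar> = \<bar>real_of_int \<lfloor>real (Suc n) * s\<rfloor> - real (Suc n) * s\<bar> / real (Suc n)"
          by (simp add: field_simps abs_divide[symmetric] del: of_nat_Suc abs_divide)
        also have "\<dots> \<le> 1 / real (Suc n)"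
          by (intro divide_right_mono) linarith+
        finally show ?thesis by (simp add: inverse_eq_divide)
      qed
      then show "(\<lambda>n. real_of_int \<lfloor>real (Suc n) * s\<rfloor> / real (Suc n) - s) \<longlonglongrightarrow> 0"
        by (intro Lim_null_comparison[OF always_eventually LIMSEQ_inverse_real_of_nat]) simp
    qed
    then have "(\<lambda>n. r n s) \<longlonglongrightarrow> max 0 (min a s)"
      unfolding r_def by (intro tendsto_intros)
    moreover have "max 0 (min a s) = s" using s by auto
    ultimately show "(\<lambda>n. r n s) \<longlonglongrightarrow> s" by (simp only:)
    show "r n s \<in> {0..a}" using s by (auto simp: r_def)
  qed
  have "AE s in lebesgue. lim (\<lambda>n. f n s) = indicator {0..a} s *\<^sub>R G s (u s)"
    using cont
  proof eventually_elim
    fix s assume cont: "s \<in> {0..a} \<longrightarrow> continuous_on UNIV (G s)"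
    have "(\<lambda>n. f n s) \<longlonglongrightarrow> indicator {0..a} s *\<^sub>R G s (u s)"
    proof (cases "s \<in> {0..a}")
      case True
      have "(\<lambda>n. u (r n s)) \<longlonglongrightarrow> u s"
        using u r[OF True] True unfolding continuous_on_sequentially by (auto simp: o_def)
      moreover have "continuous_on UNIV (G s)" using cont True by simp
      ultimately have "(\<lambda>n. G s (u (r n s))) \<longlonglongrightarrow> G s (u s)"
        unfolding continuous_on_sequentially by (auto simp: o_def)
      then show ?thesis unfolding f_def by (intro tendsto_intros)
    qed (simp add: f_def)
    then show "lim (\<lambda>n. f n s) = indicator {0..a} s *\<^sub>R G s (u s)" by (rule limI)
  qed
  moreover have "(\<lambda>s. lim (\<lambda>n. f n s)) \<in> borel_measurable lebesgue"
    using f by (rule borel_measurable_lim_metric)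
  ultimately show ?thesis
    unfolding set_borel_measurable_def by (rule borel_measurable_lebesgue_cong_AE[rotated])
qed

definition singular_convolution ::
    "real \<Rightarrow> (real \<Rightarrow> 'y::{banach, second_countable_topology} \<Rightarrow> 'y) \<Rightarrow> (real \<Rightarrow> 'y) \<Rightarrow> real \<Rightarrow> 'y"
  where "singular_convolution \<alpha> k \<psi> t = (LINT s:{0..t}|lebesgue. (t - s) powr (\<alpha> - 1) *\<^sub>R k (t - s) (\<psi> s))"

text \<open>
  The kernel \<open>k\<close> is the continuous factor that multiplies the singular weight \<open>(t - s)\<^sup>\<alpha>\<^sup>-\<^sup>1\<close>; compactness of
  the unit ball provides compact sets of arguments, on which \<open>k\<close> is uniformly continuous.
\<close>

locale singular_kernel =
  fixes a \<alpha> Ck :: real and k :: "real \<Rightarrow> 'y::{banach, second_countable_topology} \<Rightarrow> 'y"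
  assumes a: "0 < a" and \<alpha>: "0 < \<alpha>" "\<alpha> \<le> 1"
    and compact_cball: "compact (cball (0::'y) 1)"
    and k_cont: "continuous_on ({0..a} \<times> UNIV) (\<lambda>(t, y). k t y)"
    and k_bound: "\<And>t y. t \<in> {0..a} \<Longrightarrow> norm (k t y) \<le> Ck * norm y"
    and Ck: "0 \<le> Ck"
begin

lemma compact_cball_all: "compact (cball (0::'y) R)"
proof (cases "R > 0")
  case True
  then have "cball (0::'y) R = (\<lambda>x. R *\<^sub>R x) ` cball 0 1"
    by (subst cball_scale) auto
  then show ?thesis by (metis compact_scaling compact_cball)
next
  case False
  have "x = 0" if "norm x \<le> R" for x :: 'y
    using False that norm_ge_zero[of x] by (simp add: not_less) (metis norm_le_zero_iff order_trans)
  then have "cball (0::'y) R \<subseteq> {0}" by auto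
  then show ?thesis by (metis finite.emptyI finite_imp_compact finite_insert finite_subset)
qed

lemma integrand_measurable:
  assumes \<psi>: "set_borel_measurable lebesgue {0..a} \<psi>" and "0 \<le> p" "r \<le> \<tau>" "\<tau> \<le> a"
  shows "set_borel_measurable lebesgue {p..r} (\<lambda>s. (\<tau> - s) powr (\<alpha> - 1) *\<^sub>R k (\<tau> - s) (\<psi> s))"
proof -
  define \<psi>' where "\<psi>' s = indicator {0..a} s *\<^sub>R \<psi> s" for s
  have "\<psi>' \<in> borel_measurable lebesgue"
    using \<psi> unfolding set_borel_measurable_def \<psi>'_def[abs_def] .
  moreover have "(\<lambda>s. \<tau> - s) \<in> borel_measurable lebesgue"
    by (intro measurable_completion) simp
  ultimately have "(\<lambda>s. (\<tau> - s, \<psi>' s)) \<in> borel_measurable lebesgue"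
    by (intro borel_measurable_Pair)
  moreover have "continuous_on UNIV (\<lambda>z. k (max 0 (min a (fst z))) (snd z))"
  proof -
    have "continuous_on UNIV (\<lambda>z. (\<lambda>(t, y). k t y) (max 0 (min a (fst z)), snd z))"
      using a by (intro continuous_on_compose2[OF k_cont] continuous_intros) auto
    then show ?thesis by simp
  qed
  ultimately have "(\<lambda>s. k (max 0 (min a (fst (\<tau> - s, \<psi>' s)))) (snd (\<tau> - s, \<psi>' s))) \<in> borel_measurable lebesgue"
    by (rule borel_measurable_continuous_on[rotated])
  moreover have "(\<lambda>s. (\<tau> - s) powr (\<alpha> - 1)) \<in> borel_measurable lebesgue"
    by (intro measurable_completion) simp
  ultimately have "(\<lambda>s. indicator {p..r} s *\<^sub>R ((\<tau> - s) powr (\<alpha> - 1) *\<^sub>R k (max 0 (min a (\<tau> - s))) (\<psi>' s)))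
      \<in> borel_measurable lebesgue"
    by (intro borel_measurable_scaleR borel_measurable_indicator) auto
  moreover have "indicator {p..r} s *\<^sub>R ((\<tau> - s) powr (\<alpha> - 1) *\<^sub>R k (max 0 (min a (\<tau> - s))) (\<psi>' s)) =
      indicator {p..r} s *\<^sub>R ((\<tau> - s) powr (\<alpha> - 1) *\<^sub>R k (\<tau> - s) (\<psi> s))" for s
  proof (cases "s \<in> {p..r}")
    case True
    then have "max 0 (min a (\<tau> - s)) = \<tau> - s" "s \<in> {0..a}" using assms(2-) by auto
    then show ?thesis by (simp add: \<psi>'_def)
  qed simp
  ultimately show ?thesis unfolding set_borel_measurable_def by (simp only:)
qed

lemma integrand_integrable:
  assumes \<psi>: "set_borel_measurable lebesgue {0..a} \<psi>" and b: "\<And>s. s \<in> {0..a} \<Longrightarrow> norm (\<psi> s) \<le> G"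
    and "0 \<le> p" "p \<le> r" "r \<le> \<tau>" "\<tau> \<le> a"
  shows "set_integrable lebesgue {p..r} (\<lambda>s. (\<tau> - s) powr (\<alpha> - 1) *\<^sub>R k (\<tau> - s) (\<psi> s))"
    and "\<And>s. s \<in> {p..r} \<Longrightarrow> norm ((\<tau> - s) powr (\<alpha> - 1) *\<^sub>R k (\<tau> - s) (\<psi> s)) \<le> Ck * G * (\<tau> - s) powr (\<alpha> - 1)"
proof -
  show le: "norm ((\<tau> - s) powr (\<alpha> - 1) *\<^sub>R k (\<tau> - s) (\<psi> s)) \<le> Ck * G * (\<tau> - s) powr (\<alpha> - 1)" if "s \<in> {p..r}" for s
  proof -
    have "norm (k (\<tau> - s) (\<psi> s)) \<le> Ck * norm (\<psi> s)"
      using that assms(3-) by (intro k_bound) auto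
    also have "\<dots> \<le> Ck * G" using that assms(3-) Ck by (intro mult_left_mono b) auto
    finally have "(\<tau> - s) powr (\<alpha> - 1) * norm (k (\<tau> - s) (\<psi> s)) \<le> (\<tau> - s) powr (\<alpha> - 1) * (Ck * G)"
      by (intro mult_left_mono) auto
    then show ?thesis by (simp add: mult_ac)
  qed
  have "set_integrable lebesgue {p..r} (\<lambda>s. Ck * G * (\<tau> - s) powr (\<alpha> - 1))"
    using assms(3-) \<alpha>(1) by (intro set_integrable_mult_right powr_kernel_integral)
  then show "set_integrable lebesgue {p..r} (\<lambda>s. (\<tau> - s) powr (\<alpha> - 1) *\<^sub>R k (\<tau> - s) (\<psi> s))"
  proof (rule set_integrable_bound)
    show "AE s in lebesgue. s \<in> {p..r} \<longrightarrow> norm ((\<tau> - s) powr (\<alpha> - 1) *\<^sub>R k (\<tau> - s) (\<psi> s))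
        \<le> norm (Ck * G * (\<tau> - s) powr (\<alpha> - 1))"
      using le by (intro AE_I2 impI) (auto intro: order_trans[OF _ abs_ge_self])
  qed (use assms in \<open>auto intro!: integrand_measurable\<close>)
qed

text \<open>
  Moving \<open>s\<close> to \<open>t\<close> changes the convolution in three ways.  The new piece over \<open>[s, t]\<close> and the change of the
  weight, which is monotone because \<open>\<alpha> \<le> 1\<close>, each cost at most \<open>C G (t - s)\<^sup>\<alpha> / \<alpha>\<close>, where \<open>C\<close> is the
  bound of the kernel; the change of \<open>k\<close> is small by uniform continuity on the compact set of its
  arguments.  These estimates see \<open>\<psi>\<close> only through its bound and are therefore uniform in \<open>\<psi>\<close>.
\<close>

lemma singular_convolution_equicontinuous:
  assumes e: "0 < e" and G: "0 \<le> G"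
  shows "\<exists>d>0. \<forall>\<psi> s t. set_borel_measurable lebesgue {0..a} \<psi> \<and> (\<forall>s\<in>{0..a}. norm (\<psi> s) \<le> G) \<and>
      0 \<le> s \<and> s \<le> t \<and> t \<le> a \<and> t - s < d \<longrightarrow>
      norm (singular_convolution \<alpha> k \<psi> t - singular_convolution \<alpha> k \<psi> s) \<le> e"
proof -
  \<comment> \<open>\<open>e1\<close> bounds the change of \<open>k\<close>, and \<open>d2\<close> limits \<open>(t - s)\<^sup>\<alpha>\<close>, so that each costs \<open>e / 2\<close>\<close>
  define e1 where "e1 = e * \<alpha> / (2 * (a powr \<alpha> + 1))"
  have e1: "0 < e1" using e \<alpha>(1) by (simp add: e1_def add_nonneg_pos)
  have compG: "compact ({0..a} \<times> cball (0::'y) G)"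
    using compact_cball_all G by (intro compact_Times) auto
  have "uniformly_continuous_on ({0..a} \<times> cball 0 G) (\<lambda>(t, y). k t y)"
    by (rule compact_uniformly_continuous[OF continuous_on_subset[OF k_cont] compG]) auto
  then obtain d1 where d1: "0 < d1" and k_close: "\<And>z z'. z \<in> {0..a} \<times> cball 0 G \<Longrightarrow> z' \<in> {0..a} \<times> cball 0 G \<Longrightarrow>
      dist z' z < d1 \<Longrightarrow> dist (case z' of (t, y) \<Rightarrow> k t y) (case z of (t, y) \<Rightarrow> k t y) < e1"
    using e1 unfolding uniformly_continuous_on_def by metis
  have kc: "norm (k t y - k s y) \<le> e1" if "s \<in> {0..a}" "t \<in> {0..a}" "\<bar>t - s\<bar> < d1" "norm y \<le> G" for s t y
    using k_close[of "(s, y)" "(t, y)"] that by (simp add: dist_Pair_Pair dist_norm)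
  define d2 where "d2 = (e * \<alpha> / (4 * (Ck * G + 1))) powr (1 / \<alpha>)"
  have CG: "0 \<le> Ck * G" using Ck G by simp
  have d2: "0 < d2" using e \<alpha>(1) CG by (simp add: d2_def)
  show ?thesis
  proof (intro exI[of _ "min d1 d2"] conjI allI impI, goal_cases)
    case 1
    then show ?case using d1 d2 by simp
  next
    case (2 \<psi> s t)
    then have \<psi>: "set_borel_measurable lebesgue {0..a} \<psi>" "\<And>s. s \<in> {0..a} \<Longrightarrow> norm (\<psi> s) \<le> G"
      and st: "0 \<le> s" "s \<le> t" "t \<le> a" "t - s < d1" "t - s < d2" by auto
    define F where "F \<tau> r = (\<tau> - r) powr (\<alpha> - 1) *\<^sub>R k (\<tau> - r) (\<psi> r)" for \<tau> r
    have Fint: "set_integrable lebesgue {p..r} (F \<tau>)" "\<And>s. s \<in> {p..r} \<Longrightarrow> norm (F \<tau> s) \<le> Ck * G * (\<tau> - s) powr (\<alpha> - 1)"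
      if "0 \<le> p" "p \<le> r" "r \<le> \<tau>" "\<tau> \<le> a" for p r \<tau>
      unfolding F_def using integrand_integrable[OF \<psi> that] by auto
    have "singular_convolution \<alpha> k \<psi> t = (LINT r:{0..s} \<union> {s..t}|lebesgue. F t r)"
      unfolding singular_convolution_def F_def using st by (simp add: ivl_disj_un_two_touch)
    also have "\<dots> = (LINT r:{0..s}|lebesgue. F t r) + (LINT r:{s..t}|lebesgue. F t r)"
    proof (rule set_integral_Un_AE)
      have "AE r in lebesgue. r \<noteq> s" by (rule AE_completion[OF AE_lborel_singleton])
      then show "AE r in lebesgue. \<not> (r \<in> {0..s} \<and> r \<in> {s..t})"
        by eventually_elim auto
    qed (use Fint st in auto)
    finally have "singular_convolution \<alpha> k \<psi> t - singular_convolution \<alpha> k \<psi> s =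
        (LINT r:{0..s}|lebesgue. F t r - F s r) + (LINT r:{s..t}|lebesgue. F t r)"
      using set_integral_diff(2)[of lebesgue "{0..s}" "F t" "F s"] Fint[of 0 s t] Fint[of 0 s s] st
      by (simp add: singular_convolution_def F_def)
    moreover have "norm (LINT r:{s..t}|lebesgue. F t r) \<le> Ck * G * ((t - s) powr \<alpha> / \<alpha>)"
    proof -
      have "norm (LINT r:{s..t}|lebesgue. F t r) \<le> (LINT r:{s..t}|lebesgue. Ck * G * (t - r) powr (\<alpha> - 1))"
        using st \<alpha>(1) by (intro norm_set_integral_le AE_I2 impI Fint set_integrable_mult_right powr_kernel_integral) auto
      also have "\<dots> = Ck * G * ((t - s) powr \<alpha> / \<alpha>)"
        using st \<alpha>(1) by (simp add: powr_kernel_integral)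
      finally show ?thesis .
    qed
    moreover have "norm (LINT r:{0..s}|lebesgue. F t r - F s r) \<le> Ck * G * ((t - s) powr \<alpha> / \<alpha>) + e1 * (a powr \<alpha> / \<alpha>)"
    proof -
      define \<phi> where "\<phi> r = Ck * G * ((s - r) powr (\<alpha> - 1) - (t - r) powr (\<alpha> - 1)) + e1 * (s - r) powr (\<alpha> - 1)" for r
      have int: "set_integrable lebesgue {0..s} (\<lambda>r. (s - r) powr (\<alpha> - 1))" "set_integrable lebesgue {0..s} (\<lambda>r. (t - r) powr (\<alpha> - 1))"
        using st \<alpha>(1) by (auto intro: powr_kernel_integral)
      have \<phi>_int: "set_integrable lebesgue {0..s} \<phi>"
        unfolding \<phi>_def by (intro set_integral_add set_integrable_mult_right set_integral_diff int)
      have "norm (LINT r:{0..s}|lebesgue. F t r - F s r) \<le> (LINT r:{0..s}|lebesgue. \<phi> r)"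
      proof (rule norm_set_integral_le[OF \<phi>_int])
        have "AE r in lebesgue. r \<noteq> s" by (rule AE_completion[OF AE_lborel_singleton])
        then show "AE r in lebesgue. r \<in> {0..s} \<longrightarrow> norm (F t r - F s r) \<le> \<phi> r"
        proof eventually_elim
          fix r assume rs: "r \<noteq> s"
          show "r \<in> {0..s} \<longrightarrow> norm (F t r - F s r) \<le> \<phi> r"
          proof
            assume r: "r \<in> {0..s}"
            define p q where "p = (t - r) powr (\<alpha> - 1)" and "q = (s - r) powr (\<alpha> - 1)"
            have pq: "0 \<le> p" "p \<le> q"
              using r rs st \<alpha>(2) by (auto simp: p_def q_def intro!: powr_mono2')
            have \<psi>r: "norm (\<psi> r) \<le> G" using r st by (intro \<psi>(2)) auto
            have "norm (k (t - r) (\<psi> r)) \<le> Ck * norm (\<psi> r)" using r st by (intro k_bound) auto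
            also have "\<dots> \<le> Ck * G" using Ck \<psi>r by (intro mult_left_mono)
            finally have n1: "(q - p) * norm (k (t - r) (\<psi> r)) \<le> (q - p) * (Ck * G)"
              using pq by (intro mult_left_mono) auto
            have n2: "q * norm (k (t - r) (\<psi> r) - k (s - r) (\<psi> r)) \<le> q * e1"
              using r st \<psi>r pq by (intro mult_left_mono kc) auto
            have "F t r - F s r = q *\<^sub>R (k (t - r) (\<psi> r) - k (s - r) (\<psi> r)) - (q - p) *\<^sub>R k (t - r) (\<psi> r)"
              by (simp add: F_def p_def q_def algebra_simps)
            then have "norm (F t r - F s r) \<le> q * norm (k (t - r) (\<psi> r) - k (s - r) (\<psi> r)) + (q - p) * norm (k (t - r) (\<psi> r))"
              using norm_triangle_ineq4[of "q *\<^sub>R (k (t - r) (\<psi> r) - k (s - r) (\<psi> r))" "(q - p) *\<^sub>R k (t - r) (\<psi> r)"] pq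
              by simp
            then show "norm (F t r - F s r) \<le> \<phi> r"
              using n1 n2 by (simp add: \<phi>_def p_def[symmetric] q_def[symmetric] mult_ac)
          qed
        qed
      qed
      also have "\<dots> = Ck * G * (s powr \<alpha> / \<alpha> - (t powr \<alpha> - (t - s) powr \<alpha>) / \<alpha>) + e1 * (s powr \<alpha> / \<alpha>)"
        unfolding \<phi>_def using st \<alpha>(1) int
        by (simp add: set_integral_add set_integral_diff powr_kernel_integral)
      also have "\<dots> \<le> Ck * G * ((t - s) powr \<alpha> / \<alpha>) + e1 * (a powr \<alpha> / \<alpha>)"
      proof (intro add_mono mult_left_mono CG)
        have "s powr \<alpha> \<le> t powr \<alpha>" using st \<alpha>(1) by (intro powr_mono2) auto
        then show "s powr \<alpha> / \<alpha> - (t powr \<alpha> - (t - s) powr \<alpha>) / \<alpha> \<le> (t - s) powr \<alpha> / \<alpha>"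
          using \<alpha>(1) by (simp add: field_simps)
        show "s powr \<alpha> / \<alpha> \<le> a powr \<alpha> / \<alpha>"
          using st \<alpha>(1) by (intro divide_right_mono powr_mono2) auto
      qed (use e1 in auto)
      finally show ?thesis .
    qed
    ultimately have "norm (singular_convolution \<alpha> k \<psi> t - singular_convolution \<alpha> k \<psi> s) \<le>
        2 * (Ck * G * ((t - s) powr \<alpha> / \<alpha>)) + e1 * (a powr \<alpha> / \<alpha>)"
      using norm_triangle_ineq[of "LINT r:{0..s}|lebesgue. F t r - F s r" "LINT r:{s..t}|lebesgue. F t r"] by simp
    also have "\<dots> \<le> e / 2 + e / 2"
    proof (rule add_mono)
      have "(t - s) powr \<alpha> \<le> d2 powr \<alpha>" using st \<alpha>(1) by (intro powr_mono2) auto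
      also have "d2 powr \<alpha> = e * \<alpha> / (4 * (Ck * G + 1))"
        using e \<alpha>(1) CG by (simp add: d2_def powr_powr)
      finally have "Ck * G * (t - s) powr \<alpha> \<le> (Ck * G + 1) * (e * \<alpha> / (4 * (Ck * G + 1)))"
        using CG by (intro mult_mono) auto
      also have "\<dots> = e * \<alpha> / 4" using CG by (simp add: field_simps)
      finally show "2 * (Ck * G * ((t - s) powr \<alpha> / \<alpha>)) \<le> e / 2"
        using \<alpha>(1) by (simp add: field_simps)
      have "e1 * a powr \<alpha> \<le> e1 * (a powr \<alpha> + 1)" using e1 by (intro mult_left_mono) auto
      also have "\<dots> = e * \<alpha> / 2"
      proof -
        have "c / (2 * P) * P = c / 2" if "0 < P" for c P :: real using that by simp
        from this[OF add_nonneg_pos[OF powr_ge_zero[of a \<alpha>] zero_less_one]] show ?thesis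
          unfolding e1_def .
      qed
      finally show "e1 * (a powr \<alpha> / \<alpha>) \<le> e / 2"
        using \<alpha>(1) by (simp add: field_simps)
    qed
    finally show ?case by simp
  qed
qed

text \<open>
  Against the weight \<open>exp (l t)\<close> the kernel gains \<open>exp (- l (t - s)) \<le> 3 (l (t - s))\<^sup>-\<^sup>\<alpha>\<^sup>/\<^sup>2\<close>: half of the
  integrability margin \<open>\<alpha>\<close> is spent on a factor that tends to \<open>0\<close> as \<open>l\<close> grows.
\<close>

lemma singular_convolution_weighted_bound:
  assumes \<psi>: "\<And>s. s \<in> {0..a} \<Longrightarrow> norm (\<psi> s) \<le> A + B * (R * exp (l * s))"
    and nonneg: "0 \<le> A" "0 \<le> B" "0 \<le> R" "0 < l" and t: "t \<in> {0..a}"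
  shows "norm (singular_convolution \<alpha> k \<psi> t) \<le>
    Ck * A * (a powr \<alpha> / \<alpha>) + 3 * Ck * B * (a powr (\<alpha> / 2) / (\<alpha> / 2)) * l powr (- (\<alpha> / 2)) * (R * exp (l * t))"
proof -
  define K where "K = Ck * B * R * 3 * l powr (- (\<alpha> / 2)) * exp (l * t)"
  have K: "0 \<le> K" using nonneg Ck by (simp add: K_def)
  have "norm (singular_convolution \<alpha> k \<psi> t) \<le>
      (LINT s:{0..t}|lebesgue. Ck * A * (t - s) powr (\<alpha> - 1) + K * (t - s) powr (\<alpha> / 2 - 1))"
    unfolding singular_convolution_def
  proof (intro norm_set_integral_le AE_I2 impI)
    show "set_integrable lebesgue {0..t} (\<lambda>s. Ck * A * (t - s) powr (\<alpha> - 1) + K * (t - s) powr (\<alpha> / 2 - 1))"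
      using t \<alpha>(1) by (intro set_integral_add set_integrable_mult_right powr_kernel_integral) auto
    fix s assume s: "s \<in> {0..t}"
    show "norm ((t - s) powr (\<alpha> - 1) *\<^sub>R k (t - s) (\<psi> s)) \<le>
        Ck * A * (t - s) powr (\<alpha> - 1) + K * (t - s) powr (\<alpha> / 2 - 1)"
    proof (cases "s = t")
      case True
      then show ?thesis by simp
    next
      case False
      then have ts: "0 < t - s" using s by simp
      have "norm (k (t - s) (\<psi> s)) \<le> Ck * norm (\<psi> s)" using s t by (intro k_bound) auto
      also have "\<dots> \<le> Ck * (A + B * (R * exp (l * s)))" using s t Ck by (intro mult_left_mono \<psi>) auto
      finally have "(t - s) powr (\<alpha> - 1) * norm (k (t - s) (\<psi> s)) \<le>
          (t - s) powr (\<alpha> - 1) * (Ck * (A + B * (R * exp (l * s))))"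
        by (intro mult_left_mono) auto
      also have "\<dots> = Ck * A * (t - s) powr (\<alpha> - 1) + Ck * B * R * exp (l * t) * ((t - s) powr (\<alpha> - 1) * exp (- (l * (t - s))))"
        by (simp add: algebra_simps exp_diff[symmetric] exp_add[symmetric] exp_minus)
      also have "\<dots> \<le> Ck * A * (t - s) powr (\<alpha> - 1) + Ck * B * R * exp (l * t) * ((t - s) powr (\<alpha> - 1) * (3 * (l * (t - s)) powr (- (\<alpha> / 2))))"
        using nonneg Ck ts \<alpha> by (intro add_left_mono mult_left_mono powr_le_exp) auto
      also have "(t - s) powr (\<alpha> - 1) * (3 * (l * (t - s)) powr (- (\<alpha> / 2))) = 3 * l powr (- (\<alpha> / 2)) * (t - s) powr (\<alpha> / 2 - 1)"
        using nonneg ts by (simp add: powr_mult powr_add[symmetric])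
      also have "Ck * B * R * exp (l * t) * (3 * l powr (- (\<alpha> / 2)) * (t - s) powr (\<alpha> / 2 - 1)) = K * (t - s) powr (\<alpha> / 2 - 1)"
        by (simp add: K_def)
      finally show ?thesis by simp
    qed
  qed
  also have "\<dots> = Ck * A * (t powr \<alpha> / \<alpha>) + K * (t powr (\<alpha> / 2) / (\<alpha> / 2))"
  proof -
    have "set_integrable lebesgue {0..t} (\<lambda>s. Ck * A * (t - s) powr (\<alpha> - 1))"
      "set_integrable lebesgue {0..t} (\<lambda>s. K * (t - s) powr (\<alpha> / 2 - 1))"
      using t \<alpha>(1) by (intro set_integrable_mult_right powr_kernel_integral; simp)+
    then show ?thesis
      using t \<alpha>(1) powr_kernel_integral(2)[of \<alpha> 0 t t] powr_kernel_integral(2)[of "\<alpha> / 2" 0 t t]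
      by (simp only: set_integral_add set_integral_mult_right) simp
  qed
  also have "\<dots> \<le> Ck * A * (a powr \<alpha> / \<alpha>) + K * (a powr (\<alpha> / 2) / (\<alpha> / 2))"
    using t \<alpha>(1) nonneg Ck K by (intro add_mono mult_left_mono divide_right_mono powr_mono2) auto
  also have "K * (a powr (\<alpha> / 2) / (\<alpha> / 2)) = 3 * Ck * B * (a powr (\<alpha> / 2) / (\<alpha> / 2)) * l powr (- (\<alpha> / 2)) * (R * exp (l * t))"
    by (simp add: K_def)
  finally show ?thesis .
qed

end

lemma continuous_on_eval_bcontfun:
  "continuous_on S (\<lambda>U :: 'a::topological_space \<Rightarrow>\<^sub>C 'b::metric_space. apply_bcontfun U t)"
proof (rule continuous_onI)
  fix U and e :: real assume "0 < e"
  then show "\<exists>d>0. \<forall>V\<in>S. dist V U < d \<longrightarrow> dist (apply_bcontfun V t) (apply_bcontfun U t) \<le> e"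
    by (intro exI[of _ e]) (auto intro: less_imp_le le_less_trans[OF dist_bounded])
qed

text \<open>
  The theorem of Arzela and Ascoli for functions on an interval, extended by their boundary values to
  the whole line so that they are elements of the Banach space of bounded continuous functions.  A
  function is determined up to a small error by the points of a finite net that are near its values at
  finitely many nodes.
\<close>

lemma compact_equicontinuous_bcontfun:
  fixes S :: "(real \<Rightarrow>\<^sub>C 'y::banach) set"
  assumes clo: "closed S" and comp: "compact (cball (0::'y) R)" and a: "0 < a"
    and clamp: "\<And>U t. U \<in> S \<Longrightarrow> apply_bcontfun U t = apply_bcontfun U (max 0 (min a t))"
    and bound: "\<And>U t. U \<in> S \<Longrightarrow> t \<in> {0..a} \<Longrightarrow> norm (apply_bcontfun U t) \<le> R"
    and equi: "\<And>e. 0 < e \<Longrightarrow> \<exists>d>0. \<forall>U\<in>S. \<forall>s\<in>{0..a}. \<forall>t\<in>{0..a}. \<bar>s - t\<bar> < d \<longrightarrow>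
      dist (apply_bcontfun U s) (apply_bcontfun U t) \<le> e"
  shows "compact S"
  unfolding compact_eq_totally_bounded
proof (intro conjI allI impI)
  show "complete S" using clo by (simp add: complete_eq_closed)
  fix e :: real assume e: "0 < e"
  then obtain d where d: "0 < d" "\<And>U s t. U \<in> S \<Longrightarrow> s \<in> {0..a} \<Longrightarrow> t \<in> {0..a} \<Longrightarrow> \<bar>s - t\<bar> < d \<Longrightarrow>
      dist (apply_bcontfun U s) (apply_bcontfun U t) \<le> e / 5"
    using equi[of "e / 5"] by auto
  obtain N :: nat where N: "0 < N" "a / real N < d"
  proof -
    obtain N :: nat where "a / d < real N" using reals_Archimedean2 by blast
    moreover then have "0 < real N" using a d(1) by (meson divide_pos_pos less_trans)
    ultimately show ?thesis using d(1) by (intro that[of N]) (auto simp: field_simps)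
  qed
  define node where "node i = real i * a / real N" for i :: nat
  have node: "node i \<in> {0..a}" if "i \<in> {..N}" for i
    using that a N(1) by (auto simp: node_def field_simps intro: mult_left_mono)
  have near: "\<exists>i\<in>{..N}. \<bar>t - node i\<bar> < d" if t: "t \<in> {0..a}" for t
  proof
    define i where "i = nat \<lfloor>t * real N / a\<rfloor>"
    have nn: "0 \<le> t * real N / a" using t a by simp
    have i: "real i \<le> t * real N / a" "t * real N / a < real i + 1"
      using nn unfolding i_def by linarith+
    have "t * real N / a \<le> real N" using t a N(1) by (simp add: field_simps)
    then show "i \<in> {..N}" using i(1) by simp
    have "0 \<le> t - node i" using i(1) a N(1) by (simp add: node_def field_simps)
    moreover have "t - node i < a / real N"
    proof -
      have "t * real N < (real i + 1) * a" using i(2) a by (simp add: field_simps)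
      then have "t < (real i + 1) * a / real N" using N(1) by (simp add: pos_less_divide_eq)
      then show ?thesis by (simp add: node_def add_divide_distrib distrib_right)
    qed
    ultimately show "\<bar>t - node i\<bar> < d" using N(2) by linarith
  qed
  obtain F where F: "finite F" "cball (0::'y) R \<subseteq> (\<Union>x\<in>F. ball x (e / 5))"
    using comp e unfolding compact_eq_totally_bounded by (metis divide_pos_pos zero_less_numeral)
  \<comment> \<open>functions with the same pattern agree up to \<open>2 e / 5\<close> at the nodes, hence up to \<open>4 e / 5\<close> everywhere\<close>
  define pat where "pat U = (\<lambda>i\<in>{..N}. SOME x. x \<in> F \<and> dist x (apply_bcontfun U (node i)) < e / 5)" for U
  have pat: "pat U i \<in> F \<and> dist (pat U i) (apply_bcontfun U (node i)) < e / 5" if "U \<in> S" "i \<in> {..N}" for U i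
  proof -
    have "apply_bcontfun U (node i) \<in> cball 0 R" using bound[OF that(1) node[OF that(2)]] by simp
    then have "apply_bcontfun U (node i) \<in> (\<Union>x\<in>F. ball x (e / 5))" by (rule subsetD[OF F(2)])
    then have "\<exists>x. x \<in> F \<and> dist x (apply_bcontfun U (node i)) < e / 5" by auto
    from someI_ex[OF this] show ?thesis using that(2) by (simp add: pat_def)
  qed
  have "pat ` S \<subseteq> PiE {..N} (\<lambda>_. F)"
  proof (intro image_subsetI PiE_I)
    fix U i assume "U \<in> S" "i \<in> {..N}"
    then show "pat U i \<in> F" using pat by blast
  qed (simp add: pat_def)
  then have fin: "finite (pat ` S)"
    by (rule finite_subset) (intro finite_PiE F(1) finite_atMost)
  define rep where "rep \<phi> = (SOME U. U \<in> S \<and> pat U = \<phi>)" for \<phi>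
  have rep: "rep (pat U) \<in> S" "pat (rep (pat U)) = pat U" if "U \<in> S" for U
    using someI[of "\<lambda>V. V \<in> S \<and> pat V = pat U" U] that by (auto simp: rep_def)
  have "U \<in> (\<Union>V\<in>rep ` pat ` S. ball V e)" if U: "U \<in> S" for U
  proof -
    define V where "V = rep (pat U)"
    have V: "V \<in> S" "pat V = pat U" using rep[OF U] by (auto simp: V_def)
    have "dist (apply_bcontfun V t) (apply_bcontfun U t) \<le> 4 * (e / 5)" if t: "t \<in> {0..a}" for t
    proof -
      obtain i where i: "i \<in> {..N}" "\<bar>t - node i\<bar> < d" using near[OF t] by blast
      have "dist (apply_bcontfun V t) (apply_bcontfun U t) \<le>
          dist (apply_bcontfun V t) (apply_bcontfun V (node i)) + dist (apply_bcontfun V (node i)) (pat U i) +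
          dist (pat U i) (apply_bcontfun U (node i)) + dist (apply_bcontfun U (node i)) (apply_bcontfun U t)"
        by (smt (verit) dist_triangle)
      also have "\<dots> \<le> e / 5 + e / 5 + e / 5 + e / 5"
        using d(2)[OF V(1) t node[OF i(1)] i(2)] d(2)[OF U t node[OF i(1)] i(2)] pat[OF U i(1)] pat[OF V(1) i(1)]
        by (intro add_mono) (auto simp: V(2) dist_commute)
      finally show ?thesis by simp
    qed
    then have "dist (apply_bcontfun V t) (apply_bcontfun U t) \<le> 4 * (e / 5)" for t
      using clamp[OF U, of t] clamp[OF V(1), of t] a by simp
    then have "dist V U \<le> 4 * (e / 5)" by (rule dist_bound)
    also have "\<dots> < e" using e by simp
    finally show ?thesis using U by (auto simp: V_def)
  qed
  then show "\<exists>k. finite k \<and> S \<subseteq> (\<Union>x\<in>k. ball x e)"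
    using fin by (intro exI[of _ "rep ` pat ` S"]) auto
qed

text \<open>
  In a compact set every subsequence has a uniform limit point, which the pointwise limit identifies.
\<close>

lemma compact_bcontfun_pointwise_tendsto:
  fixes S :: "('a::topological_space \<Rightarrow>\<^sub>C 'b::metric_space) set"
  assumes comp: "compact S" and X: "\<And>n. X n \<in> S"
    and lim: "\<And>t. (\<lambda>n. apply_bcontfun (X n) t) \<longlonglongrightarrow> apply_bcontfun l t"
  shows "X \<longlonglongrightarrow> l"
proof (rule ccontr)
  assume "\<not> X \<longlonglongrightarrow> l"
  then obtain e where e: "0 < e" and nev: "\<not> eventually (\<lambda>n. dist (X n) l < e) sequentially"
    unfolding tendsto_iff by blast
  from nev have inf: "infinite {n. \<not> dist (X n) l < e}"
    unfolding not_eventually cofinite_eq_sequentially[symmetric] frequently_cofinite .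
  define r where "r = enumerate {n. \<not> dist (X n) l < e}"
  have r: "strict_mono r" "\<not> dist (X (r n)) l < e" for n
    using strict_mono_enumerate[OF inf] enumerate_in_set[OF inf, of n] by (auto simp: r_def)
  obtain l' q where q: "strict_mono (q :: nat \<Rightarrow> nat)" "((X \<circ> r) \<circ> q) \<longlonglongrightarrow> l'"
    using compact_imp_seq_compact[OF comp] X unfolding seq_compact_def by (metis comp_apply)
  have "apply_bcontfun l' t = apply_bcontfun l t" for t
  proof (rule LIMSEQ_unique)
    show "(\<lambda>n. apply_bcontfun (((X \<circ> r) \<circ> q) n) t) \<longlonglongrightarrow> apply_bcontfun l' t"
      using q(2) continuous_on_eval_bcontfun[of UNIV t] unfolding continuous_on_sequentially
      by (auto simp: o_def)
    show "(\<lambda>n. apply_bcontfun (((X \<circ> r) \<circ> q) n) t) \<longlonglongrightarrow> apply_bcontfun l t"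
      using LIMSEQ_subseq_LIMSEQ[OF lim[of t] strict_mono_o[OF r(1) q(1)]] by (simp add: o_def)
  qed
  then have "l' = l" by (rule bcontfun_eqI)
  then have "\<forall>\<^sub>F n in sequentially. dist (((X \<circ> r) \<circ> q) n) l < e"
    using q(2) e by (auto simp: tendsto_iff)
  then show False using r(2) by (auto simp: eventually_sequentially)
qed

context singular_kernel
begin

text \<open>
  Schauder's theorem on the set of functions that satisfy the weighted bound and share one modulus of
  continuity, namely the one that the right-hand side imposes on its values.  Continuity of the
  right-hand side is checked pointwise in \<open>t\<close> only; compactness makes the convergence uniform.
\<close>

theorem singular_volterra_exists:
  fixes c :: "real \<Rightarrow> 'y \<Rightarrow> 'y" and g :: "real \<Rightarrow> 'y \<Rightarrow> 'y" and h :: "(real \<Rightarrow> 'y) \<Rightarrow> 'y"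
  assumes c: "continuous_on ({0..a} \<times> UNIV) (\<lambda>(t, y). c t y)"
    and g_meas: "\<And>y. set_borel_measurable lebesgue {0..a} (\<lambda>s. g s y)"
    and g_cont: "AE s in lebesgue. s \<in> {0..a} \<longrightarrow> continuous_on UNIV (g s)"
    and growth: "\<And>s y. s \<in> {0..a} \<Longrightarrow> norm (g s y) \<le> A + B * norm y"
    and AB: "0 \<le> A" "0 \<le> B"
    and h_bound: "\<And>u. continuous_on {0..a} u \<Longrightarrow> norm (h u) \<le> H"
    and h_lip: "\<And>u v d. continuous_on {0..a} u \<Longrightarrow> continuous_on {0..a} v \<Longrightarrow>
      (\<And>t. t \<in> {0..a} \<Longrightarrow> norm (u t - v t) \<le> d) \<Longrightarrow> norm (h u - h v) \<le> Kh * d"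
  shows "\<exists>u. continuous_on {0..a} u \<and> (\<forall>t\<in>{0..a}.
    set_integrable lebesgue {0..t} (\<lambda>s. (t - s) powr (\<alpha> - 1) *\<^sub>R k (t - s) (g s (u s))) \<and>
    u t = c t (h u) + singular_convolution \<alpha> k (\<lambda>s. g s (u s)) t)"
proof -
  have compH: "compact ({0..a} \<times> cball (0::'y) H)"
    using compact_cball_all by (intro compact_Times) auto
  have cH: "continuous_on ({0..a} \<times> cball 0 H) (\<lambda>(t, y). c t y)"
    by (rule continuous_on_subset[OF c]) auto
  have "bounded ((\<lambda>(t, y). c t y) ` ({0..a} \<times> cball 0 H))"
    by (intro compact_imp_bounded compact_continuous_image cH compH)
  then obtain Cc where Cc: "\<And>z. z \<in> (\<lambda>(t, y). c t y) ` ({0..a} \<times> cball 0 H) \<Longrightarrow> norm z \<le> Cc"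
    unfolding bounded_iff by blast
  have c_le: "norm (c t y) \<le> Cc" if "t \<in> {0..a}" "norm y \<le> H" for t y
    using that by (intro Cc) (force intro: image_eqI[of _ _ "(t, y)"])
  define T where "T u t = c t (h u) + singular_convolution \<alpha> k (\<lambda>s. g s (u s)) t" for u t
  have g_u_meas: "set_borel_measurable lebesgue {0..a} (\<lambda>s. g s (u s))" if "continuous_on {0..a} u" for u
    by (rule caratheodory_measurable[OF g_meas g_cont that])

  \<comment> \<open>\<open>l\<close> is so large that \<open>D1 l\<^sup>-\<^sup>\<alpha>\<^sup>/\<^sup>2 \<le> 1 / 2\<close>: the convolution then contributes at most half of the
      weighted bound \<open>R\<close>, and \<open>R\<close> is chosen to let the remaining terms fit into the other half\<close>
  define D0 where "D0 = Ck * A * (a powr \<alpha> / \<alpha>)"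
  define D1 where "D1 = 3 * Ck * B * (a powr (\<alpha> / 2) / (\<alpha> / 2))"
  have D: "0 \<le> D0" "0 \<le> D1" using AB Ck \<alpha> by (auto simp: D0_def D1_def)
  define l where "l = (2 * D1 + 1) powr (2 / \<alpha>)"
  have l: "0 < l" using D by (simp add: l_def)
  have "l powr (\<alpha> / 2) = 2 * D1 + 1" using D \<alpha> by (simp add: l_def powr_powr)
  then have D1l: "D1 * l powr (- (\<alpha> / 2)) \<le> 1 / 2"
    using D by (simp add: powr_minus field_simps)
  define R where "R = 2 * (max 0 Cc + D0)"
  have R: "0 \<le> R" using D by (simp add: R_def)
  have weighted: "norm (T u t) \<le> R * exp (l * t)"
    if u: "continuous_on {0..a} u" "\<And>s. s \<in> {0..a} \<Longrightarrow> norm (u s) \<le> R * exp (l * s)" and t: "t \<in> {0..a}" for u t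
  proof -
    have "norm (g s (u s)) \<le> A + B * (R * exp (l * s))" if "s \<in> {0..a}" for s
      using growth[OF that, of "u s"] mult_left_mono[OF u(2)[OF that] AB(2)] by linarith
    then have "norm (singular_convolution \<alpha> k (\<lambda>s. g s (u s)) t) \<le> D0 + D1 * l powr (- (\<alpha> / 2)) * (R * exp (l * t))"
      unfolding D0_def D1_def using AB R l t by (intro singular_convolution_weighted_bound)
    also have "\<dots> \<le> D0 + 1 / 2 * (R * exp (l * t))"
      using D1l R by (intro add_left_mono mult_right_mono) auto
    finally have 1: "norm (singular_convolution \<alpha> k (\<lambda>s. g s (u s)) t) \<le> D0 + R * exp (l * t) / 2" by simp
    have "norm (c t (h u)) \<le> max 0 Cc" using c_le[OF t h_bound[OF u(1)]] by simp
    then have "norm (T u t) \<le> max 0 Cc + (D0 + R * exp (l * t) / 2)"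
      unfolding T_def by (intro norm_triangle_le add_mono 1)
    moreover have "max 0 Cc + D0 = R / 2" by (simp add: R_def)
    moreover have "R * 1 \<le> R * exp (l * t)" using R l t by (intro mult_left_mono) auto
    ultimately show ?thesis by linarith
  qed
  define R' where "R' = R * exp (l * a)"
  have le_R': "R * exp (l * t) \<le> R'" if "t \<in> {0..a}" for t
    using that R l unfolding R'_def by (intro mult_left_mono) auto
  have R': "0 \<le> R'" using R by (simp add: R'_def)

  have equi: "\<exists>d>0. \<forall>u. continuous_on {0..a} u \<and> (\<forall>s\<in>{0..a}. norm (u s) \<le> R') \<longrightarrow>
      (\<forall>s\<in>{0..a}. \<forall>t\<in>{0..a}. \<bar>s - t\<bar> < d \<longrightarrow> dist (T u s) (T u t) \<le> e)" if e: "0 < e" for e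
  proof -
    have "uniformly_continuous_on ({0..a} \<times> cball 0 H) (\<lambda>(t, y). c t y)"
      by (rule compact_uniformly_continuous[OF cH compH])
    then obtain d1 where d1: "0 < d1" and c_close: "\<And>z z'. z \<in> {0..a} \<times> cball 0 H \<Longrightarrow> z' \<in> {0..a} \<times> cball 0 H \<Longrightarrow>
        dist z' z < d1 \<Longrightarrow> dist (case z' of (t, y) \<Rightarrow> c t y) (case z of (t, y) \<Rightarrow> c t y) < e / 2"
      using e unfolding uniformly_continuous_on_def by (metis half_gt_zero)
    define G where "G = A + B * R'"
    have G: "0 \<le> G" using AB R' by (simp add: G_def)
    obtain d2 where d2: "0 < d2" and s_close: "\<And>\<psi> s t. set_borel_measurable lebesgue {0..a} \<psi> \<Longrightarrow>
        (\<And>s. s \<in> {0..a} \<Longrightarrow> norm (\<psi> s) \<le> G) \<Longrightarrow> 0 \<le> s \<Longrightarrow> s \<le> t \<Longrightarrow> t \<le> a \<Longrightarrow> t - s < d2 \<Longrightarrow>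
        norm (singular_convolution \<alpha> k \<psi> t - singular_convolution \<alpha> k \<psi> s) \<le> e / 2"
      using singular_convolution_equicontinuous[OF half_gt_zero[OF e] G] by blast
    have main: "dist (T u s) (T u t) \<le> e"
      if u: "continuous_on {0..a} u" "\<forall>s\<in>{0..a}. norm (u s) \<le> R'"
        and st: "s \<in> {0..a}" "t \<in> {0..a}" "s \<le> t" "\<bar>s - t\<bar> < min d1 d2" for u s t
    proof -
      have 1: "dist (c t (h u)) (c s (h u)) \<le> e / 2"
        using c_close[of "(s, h u)" "(t, h u)"] st h_bound[OF u(1)]
        by (simp add: dist_Pair_Pair dist_real_def less_imp_le)
      have "norm (g r (u r)) \<le> G" if "r \<in> {0..a}" for r
        using growth[OF that, of "u r"] mult_left_mono[OF bspec[OF u(2) that] AB(2)] by (simp add: G_def)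
      then have 2: "norm (singular_convolution \<alpha> k (\<lambda>s. g s (u s)) t - singular_convolution \<alpha> k (\<lambda>s. g s (u s)) s) \<le> e / 2"
        using st by (intro s_close g_u_meas u(1)) auto
      have "dist (T u t) (T u s) = norm ((c t (h u) - c s (h u)) +
          (singular_convolution \<alpha> k (\<lambda>s. g s (u s)) t - singular_convolution \<alpha> k (\<lambda>s. g s (u s)) s))"
        by (simp add: T_def dist_norm algebra_simps)
      also have "\<dots> \<le> e / 2 + e / 2"
        by (rule norm_triangle_le[OF add_mono[OF 1[unfolded dist_norm] 2]])
      finally show ?thesis by (simp add: dist_commute)
    qed
    show ?thesis
    proof (intro exI[of _ "min d1 d2"] conjI allI impI ballI)
      show "0 < min d1 d2" using d1 d2 by simp
      fix u :: "real \<Rightarrow> 'y" and s t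
      assume "continuous_on {0..a} u \<and> (\<forall>s\<in>{0..a}. norm (u s) \<le> R')"
        and st: "s \<in> {0..a}" "t \<in> {0..a}" "\<bar>s - t\<bar> < min d1 d2"
      then have u: "continuous_on {0..a} u" "\<forall>s\<in>{0..a}. norm (u s) \<le> R'" by blast+
      show "dist (T u s) (T u t) \<le> e"
        using main[OF u st(1,2)] main[OF u st(2,1)] st(3) by (cases "s \<le> t") (auto simp: dist_commute abs_minus_commute)
    qed
  qed
  then have "\<forall>e. \<exists>d. 0 < e \<longrightarrow> 0 < d \<and> (\<forall>u. continuous_on {0..a} u \<and> (\<forall>s\<in>{0..a}. norm (u s) \<le> R') \<longrightarrow>
      (\<forall>s\<in>{0..a}. \<forall>t\<in>{0..a}. \<bar>s - t\<bar> < d \<longrightarrow> dist (T u s) (T u t) \<le> e))"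
    by blast
  from choice[OF this] obtain \<delta> where \<delta>: "\<And>e. 0 < e \<Longrightarrow> 0 < \<delta> e"
    and \<delta>_close: "\<And>e u s t. 0 < e \<Longrightarrow> continuous_on {0..a} u \<Longrightarrow> (\<forall>s\<in>{0..a}. norm (u s) \<le> R') \<Longrightarrow>
      s \<in> {0..a} \<Longrightarrow> t \<in> {0..a} \<Longrightarrow> \<bar>s - t\<bar> < \<delta> e \<Longrightarrow> dist (T u s) (T u t) \<le> e"
    by blast

  define clamp where "clamp t = max 0 (min a t)" for t
  have clamp: "clamp t \<in> {0..a}" "t \<in> {0..a} \<Longrightarrow> clamp t = t" for t
    using a by (auto simp: clamp_def)
  have clamp_cont: "continuous_on UNIV clamp"
    unfolding clamp_def by (intro continuous_intros)
  define K where "K = {U :: real \<Rightarrow>\<^sub>C 'y. (\<forall>t. apply_bcontfun U t = apply_bcontfun U (clamp t)) \<and>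
    (\<forall>t\<in>{0..a}. norm (apply_bcontfun U t) \<le> R * exp (l * t)) \<and>
    (\<forall>e>0. \<forall>s\<in>{0..a}. \<forall>t\<in>{0..a}. \<bar>s - t\<bar> < \<delta> e \<longrightarrow> dist (apply_bcontfun U s) (apply_bcontfun U t) \<le> e)}"
  have K_R': "norm (apply_bcontfun U t) \<le> R'" if "U \<in> K" "t \<in> {0..a}" for U t
  proof -
    have "norm (apply_bcontfun U t) \<le> R * exp (l * t)" using that unfolding K_def by blast
    then show ?thesis using le_R'[OF that(2)] by linarith
  qed
  have K_cont: "continuous_on {0..a} (apply_bcontfun U)" for U :: "real \<Rightarrow>\<^sub>C 'y" by simp
  have "closed K"
  proof -
    have "K = (\<Inter>t. {U. apply_bcontfun U t = apply_bcontfun U (clamp t)}) \<inter>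
        (\<Inter>t\<in>{0..a}. {U. norm (apply_bcontfun U t) \<le> R * exp (l * t)}) \<inter>
        (\<Inter>e\<in>{0<..}. \<Inter>s\<in>{0..a}. \<Inter>t\<in>{t\<in>{0..a}. \<bar>s - t\<bar> < \<delta> e}.
          {U. dist (apply_bcontfun U s) (apply_bcontfun U t) \<le> e})"
      unfolding K_def by (rule set_eqI) (simp only: Int_iff INT_iff mem_Collect_eq greaterThan_iff, blast)
    moreover have "closed \<dots>"
      by (intro closed_Int closed_INT ballI closed_Collect_eq closed_Collect_le
          continuous_on_norm continuous_on_dist continuous_on_const continuous_on_eval_bcontfun)
    ultimately show ?thesis by (simp only:)
  qed
  then have compK: "compact K"
  proof (rule compact_equicontinuous_bcontfun[OF _ compact_cball_all[of R'] a])
    show "apply_bcontfun U t = apply_bcontfun U (max 0 (min a t))" if "U \<in> K" for U t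
      using that unfolding K_def clamp_def by blast
    show "\<exists>d>0. \<forall>U\<in>K. \<forall>s\<in>{0..a}. \<forall>t\<in>{0..a}. \<bar>s - t\<bar> < d \<longrightarrow>
        dist (apply_bcontfun U s) (apply_bcontfun U t) \<le> e" if "0 < e" for e
      using \<delta>[OF that] that unfolding K_def by blast
  qed (rule K_R')
  have convK: "convex K"
  proof (rule convexI)
    fix U V and p q :: real assume U: "U \<in> K" and V: "V \<in> K" and pq: "0 \<le> p" "0 \<le> q" "p + q = 1"
    have apply_eq: "apply_bcontfun (p *\<^sub>R U + q *\<^sub>R V) t = p *\<^sub>R apply_bcontfun U t + q *\<^sub>R apply_bcontfun V t" for t
      by (simp add: plus_bcontfun.rep_eq scaleR_bcontfun.rep_eq)
    have comb: "norm (p *\<^sub>R x + q *\<^sub>R y) \<le> r" if "norm x \<le> r" "norm y \<le> r" for x y :: 'y and r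
      using convex_bound_le[OF that pq] norm_triangle_le[of "p *\<^sub>R x" "q *\<^sub>R y" r] pq by simp
    have "dist (p *\<^sub>R x + q *\<^sub>R y) (p *\<^sub>R x' + q *\<^sub>R y') \<le> r" if "dist x x' \<le> r" "dist y y' \<le> r" for x y x' y' :: 'y and r
      using comb[OF that[unfolded dist_norm]] by (simp add: dist_norm algebra_simps)
    then show "p *\<^sub>R U + q *\<^sub>R V \<in> K"
      using U V unfolding K_def mem_Collect_eq apply_eq by (auto intro!: comb)
  qed
  have "0 \<in> K" using R by (auto simp: K_def zero_bcontfun.rep_eq less_imp_le)
  then have neK: "K \<noteq> {}" by blast

  have Tu_cont: "continuous_on {0..a} (T (apply_bcontfun U))" if "U \<in> K" for U
  proof (rule continuous_onI)
    fix s and e :: real assume "s \<in> {0..a}" "0 < e"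
    then show "\<exists>d>0. \<forall>t\<in>{0..a}. dist t s < d \<longrightarrow> dist (T (apply_bcontfun U) t) (T (apply_bcontfun U) s) \<le> e"
      using \<delta>[of e] \<delta>_close[of e "apply_bcontfun U" _ s] K_R'[OF that]
      by (intro exI[of _ "\<delta> e"]) (auto simp: dist_real_def)
  qed
  define \<T> where "\<T> U = Bcontfun (\<lambda>t. T (apply_bcontfun U) (clamp t))" for U
  have \<T>: "apply_bcontfun (\<T> U) = (\<lambda>t. T (apply_bcontfun U) (clamp t))" if U: "U \<in> K" for U
    unfolding \<T>_def
  proof (rule Bcontfun_inverse, rule bcontfun_normI)
    show "continuous_on UNIV (\<lambda>t. T (apply_bcontfun U) (clamp t))"
      by (rule continuous_on_compose2[OF Tu_cont[OF U] clamp_cont]) (use clamp in auto)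
    have "\<forall>s\<in>{0..a}. norm (apply_bcontfun U s) \<le> R * exp (l * s)" using U unfolding K_def by blast
    then show "norm (T (apply_bcontfun U) (clamp t)) \<le> R'" for t
      using weighted[OF K_cont _ clamp(1)[of t]] le_R'[OF clamp(1)[of t]] by (meson order_trans)
  qed
  have maps: "\<T> U \<in> K" if U: "U \<in> K" for U
  proof -
    have Ub: "\<forall>s\<in>{0..a}. norm (apply_bcontfun U s) \<le> R * exp (l * s)" using U unfolding K_def by blast
    have "clamp (clamp t) = clamp t" for t using clamp by blast
    moreover have "norm (T (apply_bcontfun U) t) \<le> R * exp (l * t)" if "t \<in> {0..a}" for t
      using Ub that by (intro weighted K_cont) auto
    moreover have "dist (T (apply_bcontfun U) s) (T (apply_bcontfun U) t) \<le> e"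
      if "0 < e" "s \<in> {0..a}" "t \<in> {0..a}" "\<bar>s - t\<bar> < \<delta> e" for e s t
      using that K_R'[OF U] by (intro \<delta>_close[of e]) auto
    ultimately show ?thesis
      unfolding K_def mem_Collect_eq \<T>[OF U] by (simp add: clamp(2))
  qed
  have "continuous_on K \<T>"
    unfolding continuous_on_sequentially
  proof (intro allI ballI impI, elim conjE)
    fix X and U assume U: "U \<in> K" and X: "\<forall>n. X n \<in> K" "X \<longlonglongrightarrow> U"
    have XK: "X n \<in> K" for n using X(1) by blast
    define d where "d n = dist (X n) U" for n
    have d: "d \<longlonglongrightarrow> 0" using X(2) unfolding d_def by (simp add: tendsto_dist_iff[symmetric])
    have Xd: "norm (apply_bcontfun (X n) t - apply_bcontfun U t) \<le> d n" for n t
      using dist_bounded[of "X n" t U] by (simp add: d_def dist_norm)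
    have Xt: "(\<lambda>n. apply_bcontfun (X n) t) \<longlonglongrightarrow> apply_bcontfun U t" for t
      by (rule LIM_zero_cancel, rule Lim_null_comparison[OF always_eventually d]) (use Xd in auto)
    have "(\<lambda>n. h (apply_bcontfun (X n)) - h (apply_bcontfun U)) \<longlonglongrightarrow> 0"
    proof (rule Lim_null_comparison[OF always_eventually])
      show "\<forall>n. norm (h (apply_bcontfun (X n)) - h (apply_bcontfun U)) \<le> Kh * d n"
        using Xd by (auto intro!: h_lip)
      show "(\<lambda>n. Kh * d n) \<longlonglongrightarrow> 0" using tendsto_mult_right_zero[OF d] .
    qed
    then have hX: "(\<lambda>n. h (apply_bcontfun (X n))) \<longlonglongrightarrow> h (apply_bcontfun U)"
      by (rule LIM_zero_cancel)
    have TX: "(\<lambda>n. T (apply_bcontfun (X n)) t) \<longlonglongrightarrow> T (apply_bcontfun U) t" if t: "t \<in> {0..a}" for t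
    proof -
      have "(\<lambda>n. (t, h (apply_bcontfun (X n)))) \<longlonglongrightarrow> (t, h (apply_bcontfun U))"
        by (intro tendsto_Pair tendsto_const hX)
      then have 1: "(\<lambda>n. c t (h (apply_bcontfun (X n)))) \<longlonglongrightarrow> c t (h (apply_bcontfun U))"
        using c[unfolded continuous_on_sequentially, rule_format, of "(t, h (apply_bcontfun U))"
            "\<lambda>n. (t, h (apply_bcontfun (X n)))"] t by (simp add: o_def)
      have g_le: "norm (g s (apply_bcontfun V s)) \<le> A + B * R'" if "V \<in> K" "s \<in> {0..a}" for V s
        using growth[OF that(2), of "apply_bcontfun V s"] mult_left_mono[OF K_R'[OF that] AB(2)] by linarith
      have 2: "(\<lambda>n. singular_convolution \<alpha> k (\<lambda>s. g s (apply_bcontfun (X n) s)) t)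
          \<longlonglongrightarrow> singular_convolution \<alpha> k (\<lambda>s. g s (apply_bcontfun U s)) t"
        unfolding singular_convolution_def
      proof (rule set_integral_dominated_convergence(2)[where g="\<lambda>s. Ck * (A + B * R') * (t - s) powr (\<alpha> - 1)"])
        show "set_integrable lebesgue {0..t} (\<lambda>s. Ck * (A + B * R') * (t - s) powr (\<alpha> - 1))"
          using t \<alpha>(1) by (intro set_integrable_mult_right powr_kernel_integral) auto
        show "AE s in lebesgue. s \<in> {0..t} \<longrightarrow>
            (\<lambda>n. (t - s) powr (\<alpha> - 1) *\<^sub>R k (t - s) (g s (apply_bcontfun (X n) s)))
            \<longlonglongrightarrow> (t - s) powr (\<alpha> - 1) *\<^sub>R k (t - s) (g s (apply_bcontfun U s))"
          using g_cont
        proof eventually_elim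
          fix s assume gc: "s \<in> {0..a} \<longrightarrow> continuous_on UNIV (g s)"
          show "s \<in> {0..t} \<longrightarrow>
            (\<lambda>n. (t - s) powr (\<alpha> - 1) *\<^sub>R k (t - s) (g s (apply_bcontfun (X n) s)))
            \<longlonglongrightarrow> (t - s) powr (\<alpha> - 1) *\<^sub>R k (t - s) (g s (apply_bcontfun U s))"
          proof
            assume s: "s \<in> {0..t}"
            then have "continuous_on UNIV (g s)" using gc t by auto
            then have "(\<lambda>n. g s (apply_bcontfun (X n) s)) \<longlonglongrightarrow> g s (apply_bcontfun U s)"
              using Xt[of s] unfolding continuous_on_sequentially by (auto simp: o_def)
            then have "(\<lambda>n. (t - s, g s (apply_bcontfun (X n) s))) \<longlonglongrightarrow> (t - s, g s (apply_bcontfun U s))"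
              by (intro tendsto_Pair tendsto_const)
            then have "(\<lambda>n. k (t - s) (g s (apply_bcontfun (X n) s))) \<longlonglongrightarrow> k (t - s) (g s (apply_bcontfun U s))"
              using k_cont[unfolded continuous_on_sequentially, rule_format, of "(t - s, g s (apply_bcontfun U s))"
                  "\<lambda>n. (t - s, g s (apply_bcontfun (X n) s))"] s t by (simp add: o_def)
            then show "(\<lambda>n. (t - s) powr (\<alpha> - 1) *\<^sub>R k (t - s) (g s (apply_bcontfun (X n) s)))
                \<longlonglongrightarrow> (t - s) powr (\<alpha> - 1) *\<^sub>R k (t - s) (g s (apply_bcontfun U s))"
              by (intro tendsto_scaleR tendsto_const)
          qed
        qed
        show "norm ((t - s) powr (\<alpha> - 1) *\<^sub>R k (t - s) (g s (apply_bcontfun (X n) s))) \<le>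
            Ck * (A + B * R') * (t - s) powr (\<alpha> - 1)" if "s \<in> {0..t}" for n s
          using t that by (intro integrand_integrable(2)[OF g_u_meas[OF K_cont] g_le[OF XK], of 0 t t]) auto
      qed (use t in \<open>auto intro!: integrand_measurable g_u_meas K_cont\<close>)
      show ?thesis unfolding T_def by (intro tendsto_add 1 2)
    qed
    have "(\<lambda>n. \<T> (X n)) \<longlonglongrightarrow> \<T> U"
      using compK maps[OF XK]
      by (rule compact_bcontfun_pointwise_tendsto) (simp only: \<T>[OF XK] \<T>[OF U] TX[OF clamp(1)])
    then show "(\<T> \<circ> X) \<longlonglongrightarrow> \<T> U" by (simp add: o_def)
  qed
  then obtain U where U: "U \<in> K" "\<T> U = U"
    using schauder_compact[OF compK convK neK] maps by blast
  have Ub: "norm (g s (apply_bcontfun U s)) \<le> A + B * R'" if "s \<in> {0..a}" for s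
    using growth[OF that, of "apply_bcontfun U s"] mult_left_mono[OF K_R'[OF U(1) that] AB(2)] by linarith
  show ?thesis
  proof (intro exI[of _ "apply_bcontfun U"] conjI ballI)
    show "continuous_on {0..a} (apply_bcontfun U)" by simp
    fix t assume t: "t \<in> {0..a}"
    show "set_integrable lebesgue {0..t} (\<lambda>s. (t - s) powr (\<alpha> - 1) *\<^sub>R k (t - s) (g s (apply_bcontfun U s)))"
      using t by (intro integrand_integrable(1)[OF g_u_meas[OF K_cont] Ub]) auto
    show "apply_bcontfun U t = c t (h (apply_bcontfun U)) + singular_convolution \<alpha> k (\<lambda>s. g s (apply_bcontfun U s)) t"
      using fun_cong[OF \<T>[OF U(1)], of t] U(2) clamp(2)[OF t] by (simp add: T_def)
  qed
qed

end

section \<open>Existence of a mild solution\<close>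

text \<open>
  The inverse fractional power is such an integral, with the resolvents as \<open>R t\<close>.  It is linear on the
  subspace \<open>N\<close> of those \<open>x\<close> whose integral converges, and \<open>0\<close> elsewhere.  Being onto, it already maps \<open>N\<close>
  onto the space, and dimension forces \<open>N\<close> to be everything: convergence follows from surjectivity
  without any estimate of the resolvents.
\<close>

lemma linear_if_surj_integral:
  fixes F :: "'a::{banach, second_countable_topology} set" and R :: "'b \<Rightarrow> 'a \<Rightarrow> 'a" and P :: "'a \<Rightarrow> 'a"
  assumes F: "finite F" "span F = UNIV"
    and R: "\<And>t. t \<in> D \<Longrightarrow> linear (R t)"
    and P: "\<And>x. P x = c *\<^sub>R (LINT t:D|\<mu>. k t *\<^sub>R R t x)"
    and surj: "surj P"
  shows "linear P"
proof -
  define N where "N = {x. set_integrable \<mu> D (\<lambda>t. k t *\<^sub>R R t x)}"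
  have eqs: "(\<lambda>t. indicator D t *\<^sub>R (k t *\<^sub>R R t (x + y))) =
        (\<lambda>t. indicator D t *\<^sub>R (k t *\<^sub>R R t x) + indicator D t *\<^sub>R (k t *\<^sub>R R t y))"
      "(\<lambda>t. indicator D t *\<^sub>R (k t *\<^sub>R R t (r *\<^sub>R x))) = (\<lambda>t. r *\<^sub>R (indicator D t *\<^sub>R (k t *\<^sub>R R t x)))"
      "(\<lambda>t. indicator D t *\<^sub>R (k t *\<^sub>R R t 0)) = (\<lambda>t. 0)" for x y r
    using R by (auto simp: fun_eq_iff indicator_def linear_add linear_scale linear_0 scaleR_add_right)
  have N: "subspace N"
    unfolding subspace_def N_def set_integrable_def mem_Collect_eq eqs
    by (intro conjI allI ballI impI integrable_zero)
      (auto simp del: scaleR_scaleR intro!: Bochner_Integration.integrable_add integrable_scaleR_right)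
  have add: "P (x + y) = P x + P y" if "x \<in> N" "y \<in> N" for x y
    using that unfolding P N_def set_integrable_def set_lebesgue_integral_def eqs mem_Collect_eq
    by (simp only: Bochner_Integration.integral_add scaleR_add_right)
  have scale: "P (r *\<^sub>R x) = r *\<^sub>R P x" for r x
    unfolding P set_lebesgue_integral_def eqs(2) by (simp add: scaleR_left_commute del: scaleR_scaleR)
  have off: "P x = 0" if "x \<notin> N" for x
    using that by (simp add: P N_def set_integrable_def set_lebesgue_integral_def not_integrable_integral_eq)
  have "P ` N = UNIV"
  proof -
    have "y \<in> P ` N" for y
    proof -
      obtain x where x: "y = P x" using surj by blast
      show ?thesis
      proof (cases "x \<in> N")
        case False
        then have "y = P 0" using off x scale[of 0 0] by simp
        then show ?thesis using N subspace_0 by blast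
      qed (use x in blast)
    qed
    then show ?thesis by blast
  qed
  then have "N = UNIV"
    using subspace_eq_UNIV_if_image_UNIV[OF F N] add scale by blast
  with add scale show ?thesis by (intro linearI) auto
qed

lemma continuous_if_Lipschitz_on_balls:
  fixes g :: "'a::real_normed_vector \<Rightarrow> 'b::real_normed_vector"
  assumes "\<And>n::nat. \<exists>K. \<forall>u v. norm u \<le> real n \<and> norm v \<le> real n \<longrightarrow> norm (g u - g v) \<le> K * norm (u - v)"
  shows "continuous_on UNIV g"
proof -
  have "continuous (at x) g" for x
  proof -
    obtain n :: nat where n: "norm x < real n" using reals_Archimedean2 by blast
    obtain K where K: "\<And>u v. norm u \<le> real n \<Longrightarrow> norm v \<le> real n \<Longrightarrow> norm (g u - g v) \<le> K * norm (u - v)"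
      using assms by blast
    have "((\<lambda>u. g u - g x) \<longlongrightarrow> 0) (at x)"
    proof (rule Lim_null_comparison)
      have "\<forall>\<^sub>F u in at x. norm u < real n"
        by (rule order_tendstoD(2)[OF tendsto_norm[OF tendsto_ident_at] n])
      then show "\<forall>\<^sub>F u in at x. norm (g u - g x) \<le> K * norm (u - x)"
        by eventually_elim (use K n in auto)
      have "((\<lambda>u. K * norm (u - x)) \<longlongrightarrow> K * norm (x - x)) (at x)" by (intro tendsto_intros)
      then show "((\<lambda>u. K * norm (u - x)) \<longlongrightarrow> 0) (at x)" by simp
    qed
    then show ?thesis unfolding continuous_at by (rule LIM_zero_cancel)
  qed
  then show ?thesis by (simp add: continuous_on_eq_continuous_at)
qed

lemma clinear_on_scaleR:
  assumes "clinear_on D F" "x \<in> D"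
  shows "F (r *\<^sub>R x) = r *\<^sub>R F x"
  using assms unfolding clinear_on_def scaleR_scaleC by blast

theorem theorem1:
  fixes a \<alpha> q M0 :: real
    and \<iota> :: "'y::{complex_banach, second_countable_topology} \<Rightarrow> 'x::{complex_banach, second_countable_topology}"
    and DE DL DM :: "'x set"
    and E L :: "'x \<Rightarrow> 'y"
    and M :: "'x \<Rightarrow> 'x"
    and Q :: "real \<Rightarrow> 'y \<Rightarrow> 'y"
    and S :: "'r::finite \<Rightarrow> 'y set"
    and B :: "'r \<Rightarrow> real \<Rightarrow> 'y \<Rightarrow> 'y"
    and f :: "real \<Rightarrow> 'y ^ 'r \<Rightarrow> 'y"
    and h :: "(real \<Rightarrow> 'y) \<Rightarrow> 'y"
    and u0 :: 'y and v0 :: 'x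
    and k1 k2 a_f :: real
  defines "DA \<equiv> {y. inv_into DL L y \<in> DE}"
    and "A \<equiv> (\<lambda>y. E (inv_into DL L y))"
  defines "Xq \<equiv> frac_power_dom DA A q"
    and "nq \<equiv> frac_norm DA A q"
  assumes a_pos: "0 < a"
    and embedding: "bounded_clinear \<iota>" "inj \<iota>" "closure (range \<iota>) = UNIV"
    and E: "clinear_on DE E" "closed_operator DE E"
    and L: "clinear_on DL L" "bij_betw L DL UNIV" "compact_operator (inv_into DL L)"
    and M: "clinear_on DM M" "bij_betw M DM UNIV" "compact_operator (inv_into DM M)"
    and domains: "DM \<subseteq> DL" "DL \<subseteq> DE"
    and semigroup: "analytic_semigroup Q" "compact_semigroup Q"
      "\<forall>t\<ge>0. onorm (Q t) \<le> M0"
      "infinitesimal_generator DA A Q"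
    and zero_resolvent: "0 \<in> resolvent_set DA A"
    and params: "1 / 2 < \<alpha>" "\<alpha> < 1" "0 < q" "q < 1" "\<alpha> * q < 1"
    and u0: "u0 \<in> Xq"
    and B_ops: "\<forall>i. DA \<subseteq> S i \<and> dense_in (S i) Xq nq"
      "\<forall>i. \<forall>t\<in>{0..a}. clinear_on (S i) (B i t) \<and> closed_operator_from Xq nq (S i) (B i t)"
    and f_measurable:
      "\<forall>W. (\<forall>i. W $ i \<in> Xq) \<longrightarrow> (\<lambda>t. f t W) \<in> borel_measurable (lebesgue_on {0..a})"
      "\<forall>u. (\<forall>i. u \<in> S i) \<and> (\<forall>t\<in>{0..a}. \<forall>i. B i t u \<in> Xq) \<longrightarrow>
         (\<lambda>t. f t (\<chi> i. B i t u)) \<in> borel_measurable (lebesgue_on {0..a})"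
    and f_Lipschitz:
      "\<forall>\<rho>>0. \<exists>Lf>0. \<exists>m :: 'r \<Rightarrow> real \<Rightarrow> real.
         (\<forall>i. set_integrable lebesgue {0..a} (m i) \<and> (\<forall>t\<in>{0..a}. 0 \<le> m i t)) \<and>
         (AE t in lebesgue_on {0..a}. \<forall>u v.
            u \<in> Xq \<and> v \<in> Xq \<and> nq u \<le> \<rho> \<and> nq v \<le> \<rho> \<and>
            (\<forall>i. u \<in> S i \<and> v \<in> S i \<and> B i t u \<in> Xq \<and> B i t v \<in> Xq) \<longrightarrow>
            norm (f t (\<chi> i. B i t u) - f t (\<chi> i. B i t v))
              \<le> Lf * (\<Sum>i\<in>UNIV. m i t) * nq (u - v))"
    and f_growth: "0 < a_f"
      "\<forall>t\<in>{0..a}. \<forall>u. u \<in> Xq \<and> (\<forall>i. u \<in> S i \<and> B i t u \<in> Xq) \<longrightarrow>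
         norm (f t (\<chi> i. B i t u)) \<le> a_f * (1 + real CARD('r) * nq u)"
    and h: "0 < k1" "0 < k2"
      "\<forall>u\<in>cont_fun_space a Xq nq. h u \<in> Xq \<and> nq (h u) \<le> k2"
      "\<forall>u\<in>cont_fun_space a Xq nq. \<forall>v\<in>cont_fun_space a Xq nq.
         nq (h u - h v) \<le> k1 * sup_norm a nq (\<lambda>t. u t - v t)"
  shows "\<exists>u. mild_solution a \<alpha> \<iota> DL L DM M Q Xq nq u0 v0 h S B f u"
proof -
  define \<Lambda> where "\<Lambda> = inv_into DL L"
  have \<Lambda>: "bounded_linear \<Lambda>"
    using L(3) by (simp add: \<Lambda>_def compact_operator_def bounded_clinear_def)
  have \<Lambda>_DL: "\<Lambda> y \<in> DL" for y
    unfolding \<Lambda>_def using L(2) by (intro inv_into_into) (simp add: bij_betw_def)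
  have DA: "DA = UNIV"
    using \<Lambda>_DL domains(2) by (auto simp: DA_def \<Lambda>_def[symmetric])
  have linA: "linear A"
  proof (rule linearI)
    have D: "\<Lambda> y \<in> DE" for y using \<Lambda>_DL domains(2) by blast
    show "A (x + y) = A x + A y" for x y
      using E(1) D unfolding A_def \<Lambda>_def[symmetric] clinear_on_def
      by (simp add: linear_add[OF bounded_linear.linear[OF \<Lambda>]])
    show "A (r *\<^sub>R x) = r *\<^sub>R A x" for r x
      using clinear_on_scaleR[OF E(1) D] unfolding A_def \<Lambda>_def[symmetric]
      by (simp only: linear_scale[OF bounded_linear.linear[OF \<Lambda>]])
  qed

  have C0: "C0_semigroup Q" using semigroup(1) by (simp add: analytic_semigroup_def)
  have Q_bl: "bounded_linear (Q t)" if "0 \<le> t" for t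
    using C0 that by (simp add: C0_semigroup_def bounded_clinear_def)
  have Q_lin: "linear (Q t)" if "0 \<le> t" for t
    using Q_bl[OF that] by (rule bounded_linear.linear)
  have Q_bound: "norm (Q t x) \<le> M0 * norm x" if "0 \<le> t" for t x
    using onorm[OF Q_bl[OF that], of x] semigroup(3) that by (meson mult_right_mono norm_ge_zero order_trans)
  have Q0: "Q 0 x = x" for x using C0 by (simp add: C0_semigroup_def)
  have Q_sg: "Q (s + t) x = Q s (Q t x)" if "0 \<le> s" "0 \<le> t" for s t x
    using C0 that by (simp add: C0_semigroup_def)
  have Q_diff: "((\<lambda>t. (1 / t) *\<^sub>R (Q t x - x)) \<longlongrightarrow> A x) (at_right 0)" for x
    using semigroup(4) DA by (simp add: infinitesimal_generator_def)
  obtain C where C: "0 \<le> C" "\<And>t x. 0 < t \<Longrightarrow> t \<le> 1 \<Longrightarrow> norm (Q t x - x) \<le> C * t * norm x"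
  proof -
    have "\<exists>C\<ge>0. \<forall>t x. 0 < t \<and> t \<le> 1 \<longrightarrow> norm (Q t x - x) \<le> C * t * norm x"
      by (rule difference_quotients_bounded[OF Q_bl Q_bound]) (assumption+, rule exI, rule Q_diff)
    then show ?thesis using that by blast
  qed
  have Q_comp: "compact (closure (Q t ` cball 0 1))" if "0 < t" for t
    using semigroup(2) that by (simp add: compact_semigroup_def compact_operator_def)
  have ball: "compact (cball (0::'y) 1)"
    by (rule compact_cball_if_compact_approximations[OF C Q_comp])
  obtain F where F: "finite F" "span F = (UNIV :: 'y set)"
    using finite_span_if_compact_cball[OF ball] by blast
  have Q_cont: "continuous_on {0..} (\<lambda>t. Q t x)" for x
    using C(2)[of _ x] by (intro strongly_continuous_if_Lipschitz_at_0[OF Q_lin Q_bound Q_sg, of x "C * norm x"])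
      (simp_all add: mult_ac)

  define P where "P = frac_power_inv DA A q"
  \<comment> \<open>the domains \<open>S i\<close> lie between \<open>DA\<close> and \<open>Xq\<close>, and there is at least one index\<close>
  have Xq: "Xq = UNIV"
  proof -
    have "DA \<subseteq> S i" "S i \<subseteq> Xq" for i using B_ops(1) by (auto simp: dense_in_def)
    then show ?thesis using DA by blast
  qed
  then have surjP: "surj P" by (simp add: Xq_def frac_power_dom_def P_def)
  have res: "linear (resolvent_op DA A (complex_of_real t))" if t: "t \<in> {0<..}" for t
  proof -
    define R where "R x = t *\<^sub>R x - A x" for x
    have R: "linear R"
      unfolding R_def by (intro linear_compose_sub linear_scale_self linA)
    have "x = 0" if "R x = 0" for x
      using that Q_diff[of x] t
      by (intro positive_not_eigenvalue[OF Q_lin Q_bound Q0 Q_sg, where z=t]) (auto simp: R_def)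
    then have "inj R" using linear_injective_0[OF R] by blast
    then have "bij R" using surj_iff_inj_if_finite_span[OF F R] by (simp add: bij_def)
    moreover have "resolvent_op DA A (complex_of_real t) = inv R"
      by (simp add: resolvent_op_def DA R_def[abs_def] scaleR_scaleC)
    ultimately show ?thesis using linear_inv_if_bij[OF R] by simp
  qed
  have linP: "linear P"
    by (rule linear_if_surj_integral[OF F res _ surjP]) (auto simp: P_def frac_power_inv_def)
  have "bij P" using surjP surj_iff_inj_if_finite_span[OF F linP] by (simp add: bij_def)
  then have lin_invP: "linear (inv P)" by (rule linear_inv_if_bij[OF linP])
  have nq_eq: "nq y = norm (inv P y)" for y
    by (simp add: nq_def frac_norm_def frac_power_def P_def)
  obtain N1 where N1: "0 \<le> N1" "\<And>y. nq y \<le> N1 * norm y"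
    using linear_bounded_on_span_finite[OF F(1) lin_invP] F(2) by (auto simp: nq_eq)
  obtain N2 where N2: "0 \<le> N2" "\<And>y. norm y \<le> N2 * nq y"
  proof -
    obtain K where K: "0 \<le> K" "\<And>y. norm (P y) \<le> K * norm y"
      using linear_bounded_on_span_finite[OF F(1) linP] F(2) by auto
    have "norm y \<le> K * nq y" for y
      using K(2)[of "inv P y"] surj_f_inv_f[OF surjP] by (simp add: nq_eq)
    with K(1) that show ?thesis by blast
  qed
  have in_space: "u \<in> cont_fun_space a Xq nq" if u: "continuous_on {0..a} u" for u
    unfolding cont_fun_space_def mem_Collect_eq
  proof (intro ballI conjI)
    fix t assume t: "t \<in> {0..a}"
    show "u t \<in> Xq" by (simp add: Xq)
    have "((\<lambda>s. N1 * norm (u s - u t)) \<longlongrightarrow> N1 * norm (u t - u t)) (at t within {0..a})"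
      using u t unfolding continuous_on_def by (intro tendsto_intros) auto
    then show "((\<lambda>s. nq (u s - u t)) \<longlongrightarrow> 0) (at t within {0..a})"
      by (intro Lim_null_comparison[where f="\<lambda>s. nq (u s - u t)"]) (auto simp: nq_eq[symmetric] N1(2) intro!: always_eventually, simp add: nq_eq N1(2)[unfolded nq_eq])
  qed

  have bl\<iota>: "bounded_linear \<iota>" using embedding(1) by (simp add: bounded_clinear_def)
  have lin\<iota>: "linear \<iota>" using bl\<iota> by (rule bounded_linear.linear)
  have surj\<iota>: "surj \<iota>" and FX: "span (\<iota> ` F) = UNIV"
    using surj_if_dense_range_finite_span[OF F lin\<iota> embedding(3)] by auto
  have finX: "finite (\<iota> ` F)" using F(1) by simp
  have \<iota>inv: "\<iota> (inv \<iota> x) = x" for x by (rule surj_f_inv_f[OF surj\<iota>])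
  have "bij \<iota>" using surj\<iota> embedding(2) by (simp add: bij_def)
  then have bl_inv: "bounded_linear (inv \<iota>)"
    by (intro bounded_linear_if_finite_span[OF finX FX] linear_inv_if_bij[OF lin\<iota>])
  define D where "D x = L (inv_into DM M x)" for x
  have blD: "bounded_linear D"
  proof (rule bounded_linear_if_finite_span[OF finX FX], rule linearI)
    have linM: "linear (inv_into DM M)"
      using M(3) by (simp add: compact_operator_def bounded_clinear_def bounded_linear.linear)
    have in_DL: "inv_into DM M x \<in> DL" for x
      using inv_into_into[of x M DM] M(2) domains(1) by (auto simp: bij_betw_def)
    show "D (x + y) = D x + D y" for x y
      using L(1) in_DL unfolding D_def clinear_on_def by (simp add: linear_add[OF linM])
    show "D (r *\<^sub>R x) = r *\<^sub>R D x" for r x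
      using clinear_on_scaleR[OF L(1) in_DL] unfolding D_def by (simp only: linear_scale[OF linM])
  qed

  have \<alpha>0: "0 < \<alpha>" using params by simp
  note \<zeta>_int = zeta_density_integrable[OF params(1,2)]
  have S_cont: "continuous_on ({0..} \<times> UNIV) (\<lambda>(t, y). S_op \<alpha> \<Lambda> Q t y)"
    unfolding S_op_def
    by (rule subordinated_family(1)[OF \<alpha>0 \<Lambda> Q_lin Q_bound Q_cont zeta_density_measurable \<zeta>_int(1)])
  have T_meas: "(\<lambda>\<theta>. \<theta> * zeta_density \<alpha> \<theta>) \<in> borel_measurable borel"
    using zeta_density_measurable[of \<alpha>] by measurable
  note T_family = subordinated_family[OF \<alpha>0 \<Lambda> Q_lin Q_bound Q_cont T_meas \<zeta>_int(2)]
  have T_cont: "continuous_on ({0..} \<times> UNIV) (\<lambda>z. T_op \<alpha> \<Lambda> Q (fst z) (snd z))"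
    unfolding T_op_def using T_family(1) by (intro continuous_intros) (simp add: case_prod_beta)
  obtain CT where CT: "0 \<le> CT" "\<And>t y. 0 \<le> t \<Longrightarrow> norm (T_op \<alpha> \<Lambda> Q t y) \<le> CT * norm y"
  proof -
    obtain K where "0 \<le> K" "\<And>t y. 0 \<le> t \<Longrightarrow>
        norm (LINT \<theta>:{0<..}|lebesgue. \<Lambda> ((\<theta> * zeta_density \<alpha> \<theta>) *\<^sub>R Q (t powr \<alpha> * \<theta>) y)) \<le> K * norm y"
      using T_family(2) by blast
    then show ?thesis
      using \<alpha>0 by (intro that[of "\<alpha> * K"]) (auto simp: T_op_def mult.assoc)
  qed
  define k where "k t y = inv \<iota> (T_op \<alpha> \<Lambda> Q t y)" for t y
  \<comment> \<open>the elementary integral of \<open>(t - s) powr (- \<alpha>)\<close> is carried out in advance\<close>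
  define c where "c t \<eta> = inv \<iota> (S_op \<alpha> \<Lambda> Q t (D (v0 + (1 / Gamma (1 - \<alpha>)) *\<^sub>R
      ((t powr (1 - \<alpha>) / (1 - \<alpha>)) *\<^sub>R \<iota> (u0 + \<eta>)))))" for t \<eta>
  have c_cont: "continuous_on ({0..a} \<times> UNIV) (\<lambda>(t, \<eta>). c t \<eta>)"
  proof -
    have pw: "continuous_on ({0..a} \<times> UNIV) (\<lambda>z :: real \<times> 'y. fst z powr (1 - \<alpha>))"
      using params by (intro continuous_on_powr' continuous_intros) auto
    have "continuous_on ({0..a} \<times> UNIV) (\<lambda>z. D (v0 + (1 / Gamma (1 - \<alpha>)) *\<^sub>R
        ((fst z powr (1 - \<alpha>) / (1 - \<alpha>)) *\<^sub>R \<iota> (u0 + snd z))))"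
      using params
      by (intro bounded_linear.continuous_on[OF blD] bounded_linear.continuous_on[OF bl\<iota>] continuous_on_add
          continuous_on_scaleR continuous_on_divide continuous_on_const pw continuous_on_snd continuous_on_id) simp_all
    then have "continuous_on ({0..a} \<times> UNIV) (\<lambda>z. (\<lambda>(t, y). S_op \<alpha> \<Lambda> Q t y) (fst z, D (v0 + (1 / Gamma (1 - \<alpha>)) *\<^sub>R
        ((fst z powr (1 - \<alpha>) / (1 - \<alpha>)) *\<^sub>R \<iota> (u0 + snd z)))))"
      by (intro continuous_on_compose2[OF S_cont] continuous_on_Pair continuous_on_fst continuous_on_id) auto
    from bounded_linear.continuous_on[OF bl_inv this] show ?thesis
      by (simp add: c_def case_prod_beta)
  qed
  define g where "g s y = f s (\<chi> i. B i s y)" for s y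
  have Su: "S i = UNIV" for i using B_ops(1) DA by auto
  define Ck where "Ck = onorm (inv \<iota>) * CT"
  interpret singular_kernel a \<alpha> Ck k
  proof
    show "continuous_on ({0..a} \<times> UNIV) (\<lambda>(t, y). k t y)"
      unfolding k_def case_prod_beta
      by (intro bounded_linear.continuous_on[OF bl_inv] continuous_on_subset[OF T_cont]) auto
    fix t y assume "t \<in> {0..a}"
    then have "onorm (inv \<iota>) * norm (T_op \<alpha> \<Lambda> Q t y) \<le> onorm (inv \<iota>) * (CT * norm y)"
      by (intro mult_left_mono CT onorm_pos_le bl_inv) auto
    then show "norm (k t y) \<le> Ck * norm y"
      unfolding k_def Ck_def mult.assoc by (rule order_trans[OF onorm[OF bl_inv]])
  qed (use a_pos \<alpha>0 params ball onorm_pos_le[OF bl_inv] CT(1) in \<open>auto simp: Ck_def\<close>)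
  have "\<exists>u. continuous_on {0..a} u \<and> (\<forall>t\<in>{0..a}.
      set_integrable lebesgue {0..t} (\<lambda>s. (t - s) powr (\<alpha> - 1) *\<^sub>R k (t - s) (g s (u s))) \<and>
      u t = c t (h u) + singular_convolution \<alpha> k (\<lambda>s. g s (u s)) t)"
  proof (rule singular_volterra_exists[OF c_cont])
    show "set_borel_measurable lebesgue {0..a} (\<lambda>s. g s y)" for y
      using f_measurable(2)[rule_format, of y]
      by (simp add: Su Xq g_def set_borel_measurable_def borel_measurable_restrict_space_iff)
    \<comment> \<open>the exceptional null set depends on the radius, so the radii are restricted to countably many\<close>
    have "AE s in lebesgue_on {0..a}. \<forall>n::nat. \<exists>K. \<forall>u v. nq u \<le> real (Suc n) \<and> nq v \<le> real (Suc n) \<longrightarrow>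
        norm (g s u - g s v) \<le> K * nq (u - v)"
      unfolding AE_all_countable
    proof
      fix n :: nat
      obtain Lf and m :: "'r \<Rightarrow> real \<Rightarrow> real" where "AE t in lebesgue_on {0..a}. \<forall>u v.
            u \<in> Xq \<and> v \<in> Xq \<and> nq u \<le> real (Suc n) \<and> nq v \<le> real (Suc n) \<and>
            (\<forall>i. u \<in> S i \<and> v \<in> S i \<and> B i t u \<in> Xq \<and> B i t v \<in> Xq) \<longrightarrow>
            norm (f t (\<chi> i. B i t u) - f t (\<chi> i. B i t v))
              \<le> Lf * (\<Sum>i\<in>UNIV. m i t) * nq (u - v)"
        using f_Lipschitz[rule_format, of "real (Suc n)"] by auto
      then show "AE s in lebesgue_on {0..a}. \<exists>K. \<forall>u v. nq u \<le> real (Suc n) \<and> nq v \<le> real (Suc n) \<longrightarrow>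
          norm (g s u - g s v) \<le> K * nq (u - v)"
        by eventually_elim (simp only: Su Xq g_def UNIV_I simp_thms, blast)
    qed
    then have "AE s in lebesgue_on {0..a}. continuous_on UNIV (g s)"
    proof eventually_elim
      fix s assume lip: "\<forall>n::nat. \<exists>K. \<forall>u v. nq u \<le> real (Suc n) \<and> nq v \<le> real (Suc n) \<longrightarrow>
        norm (g s u - g s v) \<le> K * nq (u - v)"
      show "continuous_on UNIV (g s)"
      proof (rule continuous_if_Lipschitz_on_balls)
        fix n :: nat
        obtain m :: nat where m: "N1 * real n \<le> real m" using real_arch_simple by blast
        obtain K where K: "\<And>u v. nq u \<le> real (Suc m) \<Longrightarrow> nq v \<le> real (Suc m) \<Longrightarrow> norm (g s u - g s v) \<le> K * nq (u - v)"
          using lip by blast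
        have in_ball: "nq u \<le> real (Suc m)" if "norm u \<le> real n" for u
          using N1(2)[of u] mult_left_mono[OF that N1(1)] m by simp
        have "norm (g s u - g s v) \<le> \<bar>K\<bar> * N1 * norm (u - v)" if "norm u \<le> real n" "norm v \<le> real n" for u v
        proof -
          have "norm (g s u - g s v) \<le> \<bar>K\<bar> * nq (u - v)"
            by (rule order_trans[OF K[OF in_ball in_ball, OF that]]) (simp add: nq_eq mult_right_mono)
          also have "\<dots> \<le> \<bar>K\<bar> * (N1 * norm (u - v))" by (intro mult_left_mono N1(2)) simp
          finally show ?thesis by (simp only: mult.assoc)
        qed
        then show "\<exists>K. \<forall>u v. norm u \<le> real n \<and> norm v \<le> real n \<longrightarrow> norm (g s u - g s v) \<le> K * norm (u - v)"
          by blast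
      qed
    qed
    then show "AE s in lebesgue. s \<in> {0..a} \<longrightarrow> continuous_on UNIV (g s)"
      by (simp add: AE_restrict_space_iff)
    show "norm (g s y) \<le> a_f + (a_f * real CARD('r) * N1) * norm y" if "s \<in> {0..a}" for s y
    proof -
      have "norm (g s y) \<le> a_f * (1 + real CARD('r) * nq y)"
        using f_growth(2) that by (simp add: Su Xq g_def)
      also have "\<dots> \<le> a_f * (1 + real CARD('r) * (N1 * norm y))"
        using f_growth(1) by (intro mult_left_mono add_left_mono N1(2)) auto
      finally show ?thesis by (simp add: algebra_simps)
    qed
    show "0 \<le> a_f" "0 \<le> a_f * real CARD('r) * N1" using f_growth(1) N1(1) by auto
    show "norm (h u) \<le> N2 * k2" if "continuous_on {0..a} u" for u
      using N2 h(3) in_space[OF that] by (meson mult_left_mono order_trans)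
    show "norm (h u - h v) \<le> N2 * k1 * N1 * d" if u: "continuous_on {0..a} u" and v: "continuous_on {0..a} v"
      and d: "\<And>t. t \<in> {0..a} \<Longrightarrow> norm (u t - v t) \<le> d" for u v d
    proof -
      have "sup_norm a nq (\<lambda>t. u t - v t) \<le> N1 * d"
        unfolding sup_norm_def using a_pos d N1
        by (intro cSUP_least) (auto intro: order_trans[OF N1(2)] mult_left_mono)
      then have "nq (h u - h v) \<le> k1 * (N1 * d)"
        using h(4) in_space[OF u] in_space[OF v] h(1) by (meson less_imp_le mult_left_mono order_trans)
      then have "N2 * nq (h u - h v) \<le> N2 * (k1 * (N1 * d))" using N2(1) by (rule mult_left_mono)
      then show ?thesis using N2(2)[of "h u - h v"] by (simp add: mult_ac)
    qed
  qed
  then obtain u where u: "continuous_on {0..a} u"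
    and u_int: "\<And>t. t \<in> {0..a} \<Longrightarrow> set_integrable lebesgue {0..t} (\<lambda>s. (t - s) powr (\<alpha> - 1) *\<^sub>R k (t - s) (g s (u s)))"
    and u_eq: "\<And>t. t \<in> {0..a} \<Longrightarrow> u t = c t (h u) + singular_convolution \<alpha> k (\<lambda>s. g s (u s)) t"
    by blast
  have "mild_solution a \<alpha> \<iota> DL L DM M Q Xq nq u0 v0 h S B f u"
    unfolding mild_solution_def \<Lambda>_def[symmetric] D_def[symmetric] g_def[symmetric]
  proof (intro conjI ballI allI)
    fix t assume t: "t \<in> {0..a}"
    have \<iota>k: "\<iota> ((t - s) powr (\<alpha> - 1) *\<^sub>R k (t - s) (g s (u s))) =
        (t - s) powr (\<alpha> - 1) *\<^sub>R T_op \<alpha> \<Lambda> Q (t - s) (g s (u s))" for s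
      by (simp add: linear_scale[OF lin\<iota>] k_def \<iota>inv)
    note push = set_integral_bounded_linear[OF bl\<iota> u_int[OF t], unfolded \<iota>k]
    show "set_integrable lebesgue {0..t} (\<lambda>s. (t - s) powr (\<alpha> - 1) *\<^sub>R T_op \<alpha> \<Lambda> Q (t - s) (g s (u s)))"
      by (rule push(1))
    have kernel: "(LINT s:{0..t}|lebesgue. (1 / (t - s) powr \<alpha>) *\<^sub>R \<iota> (u0 + h u)) =
        (t powr (1 - \<alpha>) / (1 - \<alpha>)) *\<^sub>R \<iota> (u0 + h u)"
    proof -
      have "(LINT s:{0..t}|lebesgue. (1 / (t - s) powr \<alpha>) *\<^sub>R \<iota> (u0 + h u)) =
          (LINT s:{0..t}|lebesgue. (t - s) powr (1 - \<alpha> - 1)) *\<^sub>R \<iota> (u0 + h u)"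
        using powr_kernel_integral(1)[of "1 - \<alpha>" 0 t t] params t
        by (subst set_integral_bounded_linear(2)[OF bounded_linear_scaleR_left, symmetric])
          (auto simp: powr_minus_divide)
      then show ?thesis
        using powr_kernel_integral(2)[of "1 - \<alpha>" 0 t t] params t by simp
    qed
    show "\<iota> (u t) = S_op \<alpha> \<Lambda> Q t (D (v0 + (1 / Gamma (1 - \<alpha>)) *\<^sub>R
               (LINT s:{0..t}|lebesgue. (1 / (t - s) powr \<alpha>) *\<^sub>R \<iota> (u0 + h u))))
        + (LINT s:{0..t}|lebesgue. (t - s) powr (\<alpha> - 1) *\<^sub>R T_op \<alpha> \<Lambda> Q (t - s) (g s (u s)))"
      unfolding push(2) kernel
      by (subst u_eq[OF t]) (simp add: linear_add[OF lin\<iota>] c_def \<iota>inv singular_convolution_def)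
  qed (use in_space[OF u] in \<open>auto simp: Su Xq\<close>)
  then show ?thesis by blast
qed

end
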